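(* Let $l,k$ be positive integers with $l\ge 2$, let $s=kl$ and $m=m^*=\dfrac{(2k+1)!!}{(2kl+1)!_{(2l)}}$. Then the origin of the planar polynomial system $$\dot x = y^{2l-1}-x^{2k+1},\qquad \dot y=-x+m\,y^{2s+1}$$ is always a repeller.
   Context: For a non-negative real number $a$ and a positive integer $n$, $a!_{(n)}$ is defined recursively by $a!_{(n)}=a\cdot (a-n)!_{(n)}$ if $a>0$ and $a!_{(n)}=1$ if $a\le 0$; $a!!$ abbreviates $a!_{(2)}$. Thus $(2k+1)!!=\prod_{j=0}^{k}(2j+1)$ and $(2kl+1)!_{(2l)}=\prod_{j=0}^{k}(2jl+1)$. The origin is called a repeller if it is a (locally) asymptotically stable equilibrium of the system with time reversed. (The standing condition $2\le l\le 2s$ on the family holds automatically when $s=kl$ and $l\ge2$.) *)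

theory Defs
  imports "HOL-Analysis.Analysis"
begin

text \<open>The generalized factorial \<open>a!\<^bsub>(n)\<^esub>\<close>. It is only meaningful for \<open>n > 0\<close>; the value 1 for
  \<open>n = 0\<close> is a dummy that makes the recursion terminate.\<close>

function multifact :: "nat \<Rightarrow> real \<Rightarrow> real" where
  "multifact n a = (if n = 0 \<or> a \<le> 0 then 1 else a * multifact n (a - real n))"
  by pat_completeness auto
termination
proof (relation "Wellfounded.measure (\<lambda>(n, a). nat \<lceil>a\<rceil>)", goal_cases)
  case 1
  show ?case by simp
next
  case (2 n a)
  then have "\<lceil>a - real n\<rceil> < \<lceil>a\<rceil>" "0 < \<lceil>a\<rceil>"
    by (auto simp: ceiling_diff_of_int[where z = "int n", simplified])
  then show ?case by simp
qed

declare multifact.simps [simp del]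

lemma multifact_pos:
  assumes "n > 0" "a > 0"
  shows "multifact n a = a * multifact n (a - real n)"
  using assms by (subst multifact.simps) simp

lemma multifact_nonpos: "a \<le> 0 \<Longrightarrow> multifact n a = 1"
  by (subst multifact.simps) simp

lemma multifact_mult_add_1:
  assumes "n > 0"
  shows "multifact n (real (n * k + 1)) = (\<Prod>j=0..k. real (n * j + 1))"
proof (induction k)
  case 0
  have "multifact n (1 - real n) = 1"
    using assms by (subst multifact.simps) simp
  then show ?case
    using assms by (subst multifact.simps) simp
next
  case (Suc k)
  have "multifact n (real (n * Suc k + 1)) = real (n * Suc k + 1) * multifact n (real (n * k + 1))"
    using multifact_pos[OF assms, of "real (n * Suc k + 1)"]
    by (simp add: algebra_simps add_pos_nonneg)
  then show ?case
    unfolding Suc.IH prod.atLeast0_atMost_Suc by (simp only: mult.commute)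
qed

text \<open>Forward solutions of the autonomous system \<open>z' = f z\<close> on an interval \<open>J\<close> (the
  derivative is one-sided at endpoints of \<open>J\<close>).\<close>

definition solves_on :: "('a::real_normed_vector \<Rightarrow> 'a) \<Rightarrow> (real \<Rightarrow> 'a) \<Rightarrow> real set \<Rightarrow> bool" where
  "solves_on f z J \<longleftrightarrow> (\<forall>t\<in>J. (z has_vector_derivative f (z t)) (at t within J))"

definition equilibrium :: "('a::real_normed_vector \<Rightarrow> 'a) \<Rightarrow> 'a \<Rightarrow> bool" where
  "equilibrium f p \<longleftrightarrow> f p = 0"

text \<open>Stability bounds every solution on every compact time interval \<open>[0, T]\<close>, so solutions that
  are not known to be global are covered as well.\<close>

definition lyapunov_stable :: "('a::real_normed_vector \<Rightarrow> 'a) \<Rightarrow> 'a \<Rightarrow> bool" where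
  "lyapunov_stable f p \<longleftrightarrow>
     (\<forall>\<epsilon>>0. \<exists>\<delta>>0. \<forall>T\<ge>0. \<forall>z. solves_on f z {0..T} \<longrightarrow> dist (z 0) p < \<delta> \<longrightarrow>
        (\<forall>t\<in>{0..T}. dist (z t) p < \<epsilon>))"

text \<open>Attractivity includes the existence, for initial points near \<open>p\<close>, of a solution for all
  forward time, so that it cannot hold vacuously.\<close>

definition locally_attractive :: "('a::real_normed_vector \<Rightarrow> 'a) \<Rightarrow> 'a \<Rightarrow> bool" where
  "locally_attractive f p \<longleftrightarrow>
     (\<exists>\<delta>>0. \<forall>z0. dist z0 p < \<delta> \<longrightarrow>
        (\<exists>z. solves_on f z {0..} \<and> z 0 = z0) \<and>
        (\<forall>z. solves_on f z {0..} \<longrightarrow> z 0 = z0 \<longrightarrow> (z \<longlongrightarrow> p) at_top))"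

definition asymptotically_stable :: "('a::real_normed_vector \<Rightarrow> 'a) \<Rightarrow> 'a \<Rightarrow> bool" where
  "asymptotically_stable f p \<longleftrightarrow>
     equilibrium f p \<and> lyapunov_stable f p \<and> locally_attractive f p"

text \<open>Reversing time turns \<open>z' = f z\<close> into \<open>z' = - f z\<close>.\<close>

definition repeller :: "('a::real_normed_vector \<Rightarrow> 'a) \<Rightarrow> 'a \<Rightarrow> bool" where
  "repeller f p \<longleftrightarrow> asymptotically_stable (\<lambda>z. - f z) p"

end

theory Submission
  imports Defs
begin

text \<open>
  Put \<open>H = x\<^sup>2/2 + y\<^bsup>2l\<^esup>/(2l)\<close>, let \<open>X = (y\<^bsup>2l-1\<^esup>, -x)\<close> be its Hamiltonian field and
  \<open>P = (-x\<^bsup>2k+1\<^esup>, m y\<^bsup>2s+1\<^esup>)\<close> the perturbation. For the weights \<open>(l, 1)\<close> of \<open>(x, y)\<close> both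
  fields are quasihomogeneous and \<open>P = -(b/H) X + (G/(2lH)) (lx, y)\<close> with polynomials \<open>G = P H\<close>
  and \<open>b\<close>. At \<open>m = m\<^sup>*\<close> there is a polynomial \<open>W\<close> with \<open>X W = \<kappa> G\<close>, where
  \<open>\<kappa> = k - 1/2 + 1/(2l)\<close>, so the first order average of \<open>G\<close> along the orbits of \<open>X\<close> vanishes; the
  second order one vanishes because the reflections in the axes reverse \<open>X\<close> and preserve \<open>P\<close>. With
  \<open>X Z\<^sub>2 = \<kappa> G b\<close> and a further corrector \<open>Z\<^sub>3\<close>, the derivative of
  \<open>V = H\<^bsup>-\<kappa>\<^esup> (1 + W/H + Z\<^sub>2/H\<^sup>2 + Z\<^sub>3/H\<^sup>3)\<close> along the system has, to leading order, the sign
  opposite to the average of \<open>G (b\<^sup>2 - Z\<^sub>2)\<close>, equivalently (integrating \<open>G Z\<^sub>2\<close> by parts) of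
  \<open>G b (b + W)\<close>. Averages of monomials are ratios of Pochhammer symbols, and the resulting finite
  sums are positive since \<open>1/(2l) < 1/2\<close>. Hence \<open>V\<close>, which tends to \<open>\<infinity>\<close> at the origin,
  increases strictly when time is reversed.
\<close>

section \<open>Positivity of the third order average\<close>

text \<open>The first two averages vanish for all \<open>l\<close> and \<open>k\<close>, so the sign
  is decided at third order, by finite sums with terms of both signs. These sums vanish at
  \<open>e = 1/2\<close>, where \<open>E = F\<close>, \<open>s = t\<close> and the exchange of the
  two variables makes them antisymmetric. The numerical constants therefore live on the gap
  \<open>e <= 1/4\<close> that \<open>l >= 2\<close> provides.

  To keep the computation algebraic, no angular variable and no integral is introduced. That an
  average vanishes is expressed by an explicit primitive along \<open>X\<close>, and averages are
  compared by reducing monomials to one normal form modulo such derivatives. Size bounds in powers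
  of \<open>H\<close> travel with the weights, so that the error terms need no compactness of level
  curves.

  The exponent is chosen so that \<open>2 * l * (\<kappa> + 1)\<close> is the weight of
  \<open>W\<close>: then \<open>W * H powr (-\<kappa> - 1)\<close> has weight zero and the Euler
  part of the field does not see it. With another exponent a term in \<open>G * W\<close> would join
  \<open>G * b\<close> at second order.\<close>

lemma pochhammer_mono_real:
  fixes x y :: real
  assumes "0 \<le> x" "x \<le> y"
  shows "pochhammer x n \<le> pochhammer y n"
  unfolding pochhammer_prod using assms by (intro prod_mono) auto

lemma pochhammer_shift:
  fixes x :: real
  shows "pochhammer x n * (x + real n) = x * pochhammer (x + 1) n"
  using pochhammer_rec[of x n] by (simp add: pochhammer_Suc)

lemma pochhammer_split:
  fixes x :: real
  assumes "p = n + m"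
  shows "pochhammer x p = pochhammer x n * pochhammer (x + real n) m"
  using assms by (simp add: pochhammer_product')

text \<open>The factor \<open>(z + 1/5) / (z + k + 1/5)\<close> is a telescoping correction. The constant \<open>1/5\<close> is
  chosen so that consecutive ratios of \<open>gratio\<close> are still increasing in \<open>z\<close>, while the bound \<open>7/9\<close>
  in \<open>A'_le_A_top\<close> follows.\<close>

definition gratio :: "nat \<Rightarrow> real \<Rightarrow> real" where
  "gratio k z = pochhammer z (Suc k) ^ 3 * (z + 1/5) /
     (z\<^sup>2 * pochhammer (3 * z) (3 * k + 1) * (z + real k + 1/5))"

lemma gratio_Suc:
  assumes "z > 0"
  shows "gratio (Suc k) z = gratio k z *
    ((z + real k + 1)\<^sup>2 * (z + real k + 1/5) /
     (3 * (3 * z + 3 * real k + 1) * (3 * z + 3 * real k + 2) * (z + real k + 6/5)))"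
proof -
  have p1: "pochhammer z (Suc (Suc k)) = pochhammer z (Suc k) * (z + real k + 1)"
    by (simp add: pochhammer_Suc[of z "Suc k"] algebra_simps)
  have p2: "pochhammer (3 * z) (3 * Suc k + 1) = pochhammer (3 * z) (3 * k + 1) *
    (3 * z + 3 * real k + 1) * (3 * z + 3 * real k + 2) * (3 * (z + real k + 1))"
    by (simp add: pochhammer_Suc algebra_simps numeral_eq_Suc)
  define p where "p = pochhammer z (Suc k)"
  define q where "q = pochhammer (3 * z) (3 * k + 1)"
  define c where "c = z + real k"
  have pos: "p > 0" "q > 0" "c > 0" "z > 0"
    using assms by (auto simp: p_def q_def c_def intro!: pochhammer_pos add_pos_nonneg)
  have e: "z + real (Suc k) + 1/5 = c + 6/5" "z + real k + 1 = c + 1"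
     "3 * z + 3 * real k + 1 = 3 * c + 1" "3 * z + 3 * real k + 2 = 3 * c + 2"
     "z + real k + 1/5 = c + 1/5" "z + real k + 6/5 = c + 6/5"
    by (auto simp: c_def)
  show ?thesis
    unfolding gratio_def p1 p2 p_def[symmetric] q_def[symmetric] e
    using pos by (simp add: divide_simps) (simp add: algebra_simps power2_eq_square power3_eq_cube)
qed

text \<open>The denominator is 27 times the numerator plus \<open>3/5 * (x + 2)\<close>, so the
  fraction increases as soon as the numerator divided by \<open>x + 2\<close> does, and that splits
  into two increasing factors. In the use below, \<open>a\<close> and \<open>b\<close> are the
  values of \<open>z + k + 1\<close>.\<close>

lemma gratio_step_mono:
  fixes a b :: real
  assumes "1 \<le> a" "a \<le> b"
  shows "a\<^sup>2 * (a - 4/5) / (3 * (3 * a - 2) * (3 * a - 1) * (a + 1/5))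
       \<le> b\<^sup>2 * (b - 4/5) / (3 * (3 * b - 2) * (3 * b - 1) * (b + 1/5))"
proof -
  have e: "3 * (3 * x - 2) * (3 * x - 1) * (x + 1/5) = 27 * (x\<^sup>2 * (x - 4/5)) + 3/5 * (x + 2)" for x :: real
    by (simp add: algebra_simps power2_eq_square)
  have h1: "a * (a - 4/5) \<le> b * (b - 4/5)" using assms by (intro mult_mono) auto
  have h2: "a * (b + 2) \<le> b * (a + 2)" using assms by (simp add: algebra_simps)
  have "(a * (a - 4/5)) * (a * (b + 2)) \<le> (b * (b - 4/5)) * (b * (a + 2))"
    using assms by (intro mult_mono h1 h2) auto
  then have h: "a\<^sup>2 * (a - 4/5) * (b + 2) \<le> b\<^sup>2 * (b - 4/5) * (a + 2)"
    by (simp add: power2_eq_square mult_ac)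
  define A where "A = a\<^sup>2 * (a - 4/5)"
  define B where "B = b\<^sup>2 * (b - 4/5)"
  have pos: "A > 0" "B > 0" using assms by (auto simp: A_def B_def)
  have "A / (27 * A + 3/5 * (a + 2)) \<le> B / (27 * B + 3/5 * (b + 2))"
    using pos assms h[folded A_def B_def] by (simp add: divide_simps) (simp add: algebra_simps)
  then show ?thesis unfolding e A_def B_def .
qed

text \<open>\<open>gratio 0\<close> is the constant \<open>1/3\<close>, and each further step
  multiplies by a positive factor that increases with \<open>z\<close>. The two arguments of
  interest are \<open>e\<close> and \<open>1/2\<close>, since \<open>3 * z\<close> is then
  \<open>t\<close> and \<open>s\<close>.\<close>

lemma gratio_mono:
  assumes "0 < x" "x \<le> y"
  shows "gratio k x \<le> gratio k y"
proof (induction k)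
  case 0
  then show ?case using assms by (simp add: gratio_def power2_eq_square power3_eq_cube)
next
  case (Suc k)
  have nn: "0 \<le> gratio k x" if "0 < x" for x :: real
    using that unfolding gratio_def
    by (intro divide_nonneg_nonneg mult_nonneg_nonneg zero_le_power) (auto intro!: pochhammer_nonneg)
  have s: "(z + real k + 1)\<^sup>2 * (z + real k + 1/5) /
     (3 * (3 * z + 3 * real k + 1) * (3 * z + 3 * real k + 2) * (z + real k + 6/5))
    = (z + real k + 1)\<^sup>2 * (z + real k + 1 - 4/5) /
     (3 * (3 * (z + real k + 1) - 2) * (3 * (z + real k + 1) - 1) * (z + real k + 1 + 1/5))" for z :: real
    by (simp add: algebra_simps)
  show ?case unfolding gratio_Suc[OF assms(1)] gratio_Suc[OF less_le_trans[OF assms]] s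
    using assms nn[of x] nn[of y] by (intro mult_mono Suc.IH gratio_step_mono) auto
qed

text \<open>Here \<open>e = 1/(2l)\<close>, and \<open>P a b\<close> below is the average of \<open>x\<^sup>2 y\<^sup>2 u\<^sup>a v\<^sup>b\<close>, where
  \<open>u = x\<^sup>2/2\<close> and \<open>v = y\<^bsup>2l\<^esup>/(2l)\<close>, up to a factor depending only on \<open>a + b\<close>.\<close>

locale averaging =
  fixes e :: real and k :: nat
  assumes e_pos: "0 < e" and e_le: "e \<le> 1/4" and k_ge: "1 \<le> k"
begin

text \<open>\<open>F / E\<close> is the critical value of \<open>m\<close> up to a power of
  \<open>l\<close>. The bases \<open>s\<close> and \<open>t\<close> belong to the averages of
  monomials with the extra factor \<open>x^2 y^2\<close>, which raises \<open>1/2\<close> and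
  \<open>e\<close> to \<open>3/2\<close> and \<open>3 * e\<close>.\<close>

definition E :: real where "E = pochhammer e (Suc k)"
definition F :: real where "F = pochhammer (1/2) (Suc k)"
definition s :: real where "s = 3/2"
definition t :: real where "t = 3 * e"
text \<open>Up to a common factor these are the coefficients of \<open>W\<close>. They solve the
  two-term recurrence \<open>nn_Suc\<close>, normalised so that the two ends of the telescoping sum
  for \<open>X W\<close> carry the coefficients \<open>E\<close> and \<open>F\<close>.\<close>

definition nn :: "nat \<Rightarrow> real" where
  "nn j = pochhammer (1 + e) k * pochhammer (3/2) k / (pochhammer (1 + e) j * pochhammer (3/2) (k - j))"

lemma nn_0: "nn 0 = pochhammer (1 + e) k"
proof -
  have "pochhammer (3/2::real) k \<noteq> 0" using pochhammer_pos[of "3/2::real" k] by simp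
  then show ?thesis by (simp add: nn_def)
qed

lemma nn_k: "nn k = pochhammer (3/2) k"
proof -
  have "pochhammer (1 + e) k \<noteq> 0" using pochhammer_pos[of "1 + e" k] e_pos by simp
  then show ?thesis by (simp add: nn_def)
qed

lemma E_eq: "E = e * nn 0"
  by (simp add: E_def nn_0 pochhammer_rec add.commute)

lemma F_eq: "F = 1/2 * nn k"
  by (simp add: F_def nn_k pochhammer_rec)

lemma E_pos: "E > 0" and F_pos: "F > 0" and s_pos: "s > 0" and t_pos: "t > 0"
  using e_pos by (auto simp: E_def F_def s_def t_def intro!: pochhammer_pos)

lemma nn_pos: "nn j > 0"
  unfolding nn_def using e_pos by (intro divide_pos_pos mult_pos_pos pochhammer_pos) auto

lemma nn_Suc: "j < k \<Longrightarrow> nn j * (real (k - j) + 1/2) = nn (Suc j) * (real (Suc j) + e)"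
proof -
  assume j: "j < k"
  then obtain d where d: "k - j = Suc d" "k - Suc j = d" by (metis Suc_diff_Suc)
  have "pochhammer (1 + e) j > 0" "pochhammer (3/2::real) d > 0"
    using e_pos by (auto intro!: pochhammer_pos)
  then show ?thesis
    using e_pos unfolding nn_def d by (simp add: pochhammer_Suc divide_simps)
qed

lemma nn_mono:
  assumes "2 * j \<le> k"
  shows "nn j \<le> nn (k - j)"
proof -
  obtain m where m: "k - j = j + m" using assms by (intro that[of "k - 2 * j"]) auto
  have kk: "k - (k - j) = j" using assms by auto
  have "pochhammer (1 + e + real j) m \<le> pochhammer (3/2 + real j) m"
    using e_pos e_le by (intro pochhammer_mono_real) auto
  then have "pochhammer (1 + e) j * pochhammer (3/2) j * pochhammer (1 + e + real j) m
     \<le> pochhammer (1 + e) j * pochhammer (3/2) j * pochhammer (3/2 + real j) m"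
    using e_pos by (intro mult_left_mono mult_nonneg_nonneg pochhammer_nonneg) auto
  then have "pochhammer (1 + e) (k - j) * pochhammer (3/2) j \<le> pochhammer (1 + e) j * pochhammer (3/2) (k - j)"
    unfolding m by (simp add: pochhammer_product' mult_ac)
  then show ?thesis unfolding nn_def kk
    using e_pos by (intro divide_left_mono mult_pos_pos pochhammer_pos mult_nonneg_nonneg pochhammer_nonneg) (auto simp: mult_ac)
qed

section \<open>Termwise bounds for the average of \<open>G b W\<close>\<close>

text \<open>\<open>A\<close> collects the \<open>F^2\<close> terms of the average and
  \<open>A'\<close> the \<open>E^2\<close> terms, the latter with the index reversed so that both
  are compared at the same \<open>j\<close>. \<open>B\<close> is the common part of the two mixed
  terms.\<close>

definition A :: "nat \<Rightarrow> real" where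
  "A j = F\<^sup>2 * nn j * pochhammer s (k - j) * pochhammer t (2 * k + 1 + j)"
definition A' :: "nat \<Rightarrow> real" where
  "A' j = E\<^sup>2 * nn (k - j) * pochhammer t (k - j) * pochhammer s (2 * k + 1 + j)"
definition B :: "nat \<Rightarrow> real" where
  "B j = E * F * nn j * pochhammer s (2 * k - j) * pochhammer t (k + j)"

lemma ps_pos: "pochhammer s n > 0" and pt_pos: "pochhammer t n > 0"
  using s_pos t_pos by (auto intro: pochhammer_pos)

lemma A_pos: "A j > 0" and B_pos: "B j > 0"
  unfolding A_def B_def using ps_pos pt_pos E_pos F_pos nn_pos by auto

text \<open>The monotone ratio at \<open>e\<close> is compared with its value at \<open>1/2\<close>;
  \<open>7/9\<close> is what its correction factor leaves in the worst case
  \<open>e = 1/4\<close>.\<close>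

lemma A'_le_A_top: "E ^ 3 / e * pochhammer s (3 * k + 1) \<le> 7/9 * (2 * F ^ 3 * pochhammer t (3 * k + 1))"
proof -
  have g: "gratio k e \<le> gratio k (1/2)" using e_pos e_le by (intro gratio_mono) auto
  have g': "E ^ 3 * (e + 1/5) / (e\<^sup>2 * pochhammer t (3 * k + 1) * (e + real k + 1/5))
     \<le> F ^ 3 * (7/10) / (1/4 * pochhammer s (3 * k + 1) * (7/10 + real k))"
    using g by (simp add: gratio_def E_def F_def s_def t_def power2_eq_square add.commute)
  define T where "T = pochhammer t (3 * k + 1)"
  define S where "S = pochhammer s (3 * k + 1)"
  have TS: "T > 0" "S > 0" using ps_pos pt_pos by (auto simp: T_def S_def)
  have h: "E ^ 3 * S * (e + 1/5) * (7/10 + real k) \<le> F ^ 3 * (14/5) * e\<^sup>2 * T * (e + real k + 1/5)"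
    using g'[folded T_def S_def] TS e_pos by (simp add: divide_simps) (simp add: algebra_simps)
  have "F ^ 3 * (14/5) * e\<^sup>2 * T * (e + real k + 1/5) \<le> F ^ 3 * (14/5) * e\<^sup>2 * T * (7/10 + real k)"
    using TS e_pos e_le F_pos by (intro mult_left_mono) auto
  with h have "(E ^ 3 * S * (e + 1/5)) * (7/10 + real k) \<le> (F ^ 3 * (14/5) * e\<^sup>2 * T) * (7/10 + real k)"
    by linarith
  then have h2: "E ^ 3 * S * (e + 1/5) \<le> F ^ 3 * (14/5) * e\<^sup>2 * T"
    by (rule mult_right_le_imp_le) (simp add: add_pos_nonneg)
  \<comment> \<open>\<open>14/5 * e <= 14/9 * (e + 1/5)\<close> is an equality at
    \<open>e = 1/4\<close>.\<close>
  have "F ^ 3 * T * e * (14/5 * e) \<le> F ^ 3 * T * e * (14/9 * (e + 1/5))"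
    using TS e_pos e_le F_pos by (intro mult_left_mono) auto
  moreover have "F ^ 3 * (14/5) * e\<^sup>2 * T = F ^ 3 * T * e * (14/5 * e)" by (simp add: power2_eq_square)
  ultimately have "(E ^ 3 * S) * (e + 1/5) \<le> (F ^ 3 * T * e * (14/9)) * (e + 1/5)"
    using h2 by (simp only: mult.assoc)
  then have "E ^ 3 * S \<le> F ^ 3 * T * e * (14/9)"
    by (rule mult_right_le_imp_le) (use e_pos in simp)
  then show ?thesis unfolding T_def S_def using e_pos by (simp add: divide_simps mult_ac)
qed

lemma A_top: "A k = 2 * F ^ 3 * pochhammer t (3 * k + 1)"
proof -
  have "2 * k + 1 + k = 3 * k + 1" by simp
  then show ?thesis unfolding A_def using F_eq by (simp add: power2_eq_square power3_eq_cube)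
qed

lemma A'_top: "A' k = E ^ 3 / e * pochhammer s (3 * k + 1)"
proof -
  have *: "2 * k + 1 + k = 3 * k + 1" by simp
  have "nn 0 = E / e" using E_eq e_pos by simp
  then show ?thesis unfolding A'_def * by (simp add: power2_eq_square power3_eq_cube)
qed

text \<open>Says that \<open>A' / A\<close> increases with the index, which carries the bound at the
  top index down to all \<open>j\<close> with \<open>k <= 3 * j\<close>.\<close>

lemma A_chain:
  assumes "j < k" "k \<le> 3 * j"
  shows "A (Suc j) * A' j \<le> A j * A' (Suc j)"
proof -
  define d where "d = k - Suc j"
  have k: "k - j = Suc d" "k - Suc j = d" "k = Suc (j + d)" using assms by (auto simp: d_def)
  have n1: "nn j * (real d + 3/2) = nn (Suc j) * (real j + 1 + e)"
    using nn_Suc[OF assms(1)] by (simp add: k(1) algebra_simps)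
  have "d < k" using k(3) by simp
  have kd: "k - d = Suc j" using k(3) by simp
  have n2: "nn d * (real j + 3/2) = nn (Suc d) * (real d + 1 + e)"
    using nn_Suc[OF \<open>d < k\<close>] by (simp add: kd algebra_simps)
  have nS: "nn (Suc j) = nn j * (real d + 3/2) / (real j + 1 + e)"
    using n1 e_pos by (simp add: field_simps add_nonneg_eq_0_iff)
  have nd: "nn d = nn (Suc d) * (real d + 1 + e) / (real j + 3/2)"
    using n2 e_pos by (simp add: field_simps)
  have pS: "pochhammer s (Suc d) = pochhammer s d * (s + real d)"
    "pochhammer t (Suc d) = pochhammer t d * (t + real d)"
    "pochhammer s (2 * k + 1 + Suc j) = pochhammer s (2 * k + 1 + j) * (s + 2 * real k + 1 + real j)"
    "pochhammer t (2 * k + 1 + Suc j) = pochhammer t (2 * k + 1 + j) * (t + 2 * real k + 1 + real j)"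
    by (simp_all add: pochhammer_Suc algebra_simps)
  define C where "C = F\<^sup>2 * nn j * pochhammer s d * pochhammer t (2 * k + 1 + j) *
     (E\<^sup>2 * nn (Suc d) * pochhammer t d * pochhammer s (2 * k + 1 + j))"
  have Cpos: "C > 0" unfolding C_def using E_pos F_pos nn_pos ps_pos pt_pos by auto
  have L: "A (Suc j) * A' j = C * ((real d + 3/2) / (real j + 1 + e) * (t + 2 * real k + 1 + real j) * (t + real d))"
    unfolding A_def A'_def k(1,2) nS pS C_def by simp
  have R: "A j * A' (Suc j) = C * ((s + real d) * ((real d + 1 + e) / (real j + 3/2)) * (s + 2 * real k + 1 + real j))"
    unfolding A_def A'_def k(1,2) nd pS C_def by simp
  define x where "x = real j"
  define y where "y = real d"
  have xy: "x \<ge> 1" "y \<ge> 0" "y \<le> 2 * x - 1" using assms k(3) by (auto simp: x_def y_def)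
  have kk: "real k = x + y + 1" using k(3) by (simp add: x_def y_def)
  have key: "(y + 3/2) * (x + 3/2) * (t + 3 * x + 2 * y + 3) * (t + y)
     \<le> (x + 1 + e) * (y + 1 + e) * (s + y) * (s + 3 * x + 2 * y + 3)"
  proof -
    define N where "N = (\<lambda>z. (y + 1 + z) * (x + 1 + z))"
    define M where "M = (\<lambda>z. (z + y / 3) * (z + (3 * x + 2 * y + 3) / 3))"
    \<comment> \<open>The expression is antisymmetric in \<open>e\<close> and \<open>1/2\<close>, so
      \<open>1/2 - e\<close> splits off. The cofactor is nonnegative because
      \<open>y <= 2 * x - 1\<close>, which is the hypothesis \<open>k <= 3 * j\<close>.\<close>
    have id: "N e * M (1/2) - N (1/2) * M e = (1/2 - e) * ((x+y+1) * ((y+1)*(x+1)) - (x+y+2) * (y * (3*x+2*y+3) / 9)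
        + ((y+1)*(x+1) - y * (3*x+2*y+3) / 9) * (1/2 + e) + (1/2) * e)"
      unfolding N_def M_def by (simp add: field_simps)
    have a: "y * (3*x+2*y+3) * (x + y + 2) \<le> 9 * ((x+y+1) * ((y+1)*(x+1)))"
    proof -
      have "(3*x+2*y+3) * (x+y+2) \<le> (3*(x+y+1)) * (3*(x+1))"
        using xy by (intro mult_mono) auto
      then have "y * ((3*x+2*y+3) * (x+y+2)) \<le> (y + 1) * ((3*(x+y+1)) * (3*(x+1)))"
        using xy by (intro mult_mono) auto
      moreover have "(y + 1) * ((3*(x+y+1)) * (3*(x+1))) = 9 * ((x+y+1) * ((y+1)*(x+1)))" by (simp add: algebra_simps)
      ultimately show ?thesis by (simp only: mult_ac)
    qed
    have b: "y * (3*x+2*y+3) / 9 \<le> (y+1)*(x+1)"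
    proof -
      have "y * (3*x+2*y+3) \<le> (y+1) * (9 * (x+1))" using xy by (intro mult_mono) auto
      then show ?thesis by (simp add: algebra_simps)
    qed
    have "(x + y + 2) * (y * (3 * x + 2 * y + 3) / 9) = y * (3*x+2*y+3) * (x + y + 2) / 9" by simp
    then have a': "(x + y + 2) * (y * (3 * x + 2 * y + 3) / 9) \<le> (x+y+1) * ((y+1)*(x+1))" using a by linarith
    have "N e * M (1/2) - N (1/2) * M e \<ge> 0"
      unfolding id using a' b e_pos e_le by (intro mult_nonneg_nonneg add_nonneg_nonneg) auto
    then have "N (1/2) * M e \<le> N e * M (1/2)" by simp
    then have "9 * (N (1/2) * M e) \<le> 9 * (N e * M (1/2))" by simp
    moreover have "(y + 3/2) * (x + 3/2) * (t + 3 * x + 2 * y + 3) * (t + y) = 9 * (N (1/2) * M e)"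
      unfolding N_def M_def t_def by (simp add: field_simps)
    moreover have "(x + 1 + e) * (y + 1 + e) * (s + y) * (s + 3 * x + 2 * y + 3) = 9 * (N e * M (1/2))"
      unfolding N_def M_def s_def by (simp add: field_simps)
    ultimately show ?thesis by simp
  qed
  have pos: "x + 1 + e > 0" "x + 3/2 > 0" using xy e_pos by auto
  have e1: "t + 2 * (x + y + 1) + 1 + x = t + 3 * x + 2 * y + 3" "s + 2 * (x + y + 1) + 1 + x = s + 3 * x + 2 * y + 3"
    by simp_all
  define D where "D = (x + 1 + e) * (x + 3/2)"
  have D: "D > 0" using pos by (simp add: D_def)
  have l: "(y + 3/2) / (x + 1 + e) * (t + 3 * x + 2 * y + 3) * (t + y)
     = (y + 3/2) * (x + 3/2) * (t + 3 * x + 2 * y + 3) * (t + y) / D"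
    using pos by (simp add: D_def)
  have r: "(s + y) * ((y + 1 + e) / (x + 3/2)) * (s + 3 * x + 2 * y + 3)
     = (x + 1 + e) * (y + 1 + e) * (s + y) * (s + 3 * x + 2 * y + 3) / D"
    using pos by (simp add: D_def)
  show ?thesis unfolding L R kk x_def[symmetric] y_def[symmetric] e1 l r
    using key D Cpos by (intro mult_left_mono divide_right_mono) auto
qed

lemma A'_le:
  assumes "j \<le> k" "k \<le> 3 * j"
  shows "A' j \<le> 7/9 * A j"
  using assms
proof (induction rule: inc_induct)
  case base
  show ?case using A'_le_A_top unfolding A_top A'_top .
next
  case (step n)
  then have IH: "A' (Suc n) \<le> 7/9 * A (Suc n)" by auto
  have "A (Suc n) * A' n \<le> A n * A' (Suc n)" using step by (intro A_chain) auto
  also have "\<dots> \<le> A n * (7/9 * A (Suc n))" using IH A_pos[of n] by (intro mult_left_mono) auto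
  finally have "A (Suc n) * A' n \<le> A (Suc n) * (7/9 * A n)" by (simp add: mult_ac)
  then show ?case using A_pos[of "Suc n"] by (rule mult_left_le_imp_le)
qed

lemma E_le_F:
  assumes "3 \<le> k" shows "E \<le> 7/20 * F"
proof -
  obtain m where m: "Suc k = 4 + m" using le_Suc_ex[of 4 "Suc k"] assms by auto
  have p4: "pochhammer x 4 = x * (x + 1) * (x + 2) * (x + 3)" for x :: real
    by (simp add: pochhammer_Suc numeral_eq_Suc algebra_simps)
  \<comment> \<open>At \<open>e = 1/4\<close> the quotient of the first four factors is just below
    \<open>7/20\<close>, while three factors give only \<open>3/8\<close>; hence
    \<open>3 <= k\<close>. The later factors of \<open>E\<close> are at most those of
    \<open>F\<close>.\<close>
  have "e * (e + 1) * (e + 2) * (e + 3) \<le> 1/4 * (1/4 + 1) * (1/4 + 2) * (1/4 + 3)"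
    using e_pos e_le by (intro mult_mono) auto
  also have "\<dots> \<le> 7/20 * pochhammer (1/2) 4" unfolding p4 by simp
  finally have "pochhammer e 4 \<le> 7/20 * pochhammer (1/2) 4" unfolding p4 .
  then have "pochhammer e 4 * pochhammer (e + 4) m \<le> (7/20 * pochhammer (1/2) 4) * pochhammer (1/2 + 4) m"
    using e_pos e_le by (intro mult_mono pochhammer_mono_real) (auto intro!: pochhammer_nonneg mult_nonneg_nonneg)
  then show ?thesis unfolding E_def F_def m by (simp add: pochhammer_product')
qed

text \<open>Outside the range of \<open>A_chain\<close> the comparison is with the reflected index.
  There \<open>j + 2 <= k - j\<close>, so the symbol based at \<open>s + j\<close> is dominated by
  the one based at \<open>t + (k - j)\<close>, and only the squared quotient of \<open>E\<close> and
  \<open>F\<close> remains: \<open>49/400\<close> is the square of \<open>7/20\<close>.\<close>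

lemma A'_le_far:
  assumes "3 \<le> k" "3 * j < k"
  shows "A' j \<le> 49/400 * A (k - j)"
proof -
  define J where "J = k - j"
  have J: "k - J = j" "j + 2 \<le> J" using assms by (auto simp: J_def)
  have p: "pochhammer s (2 * k + 1 + j) = pochhammer s j * pochhammer (s + real j) (2 * k + 1)"
    "pochhammer t (2 * k + 1 + J) = pochhammer t J * pochhammer (t + real J) (2 * k + 1)"
    by (rule pochhammer_split; simp)+
  have "E\<^sup>2 \<le> (7/20 * F)\<^sup>2" using E_le_F[OF assms(1)] E_pos by (intro power_mono) auto
  then have E2: "E\<^sup>2 \<le> 49/400 * F\<^sup>2" by (simp add: power2_eq_square)
  have q: "pochhammer (s + real j) (2 * k + 1) \<le> pochhammer (t + real J) (2 * k + 1)"
    using J t_pos s_def by (intro pochhammer_mono_real) auto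
  have "E\<^sup>2 * pochhammer (s + real j) (2 * k + 1) \<le> (49/400 * F\<^sup>2) * pochhammer (t + real J) (2 * k + 1)"
    using E2 q s_pos by (intro mult_mono) (auto intro!: pochhammer_nonneg)
  then have "(nn J * pochhammer t J * pochhammer s j) * (E\<^sup>2 * pochhammer (s + real j) (2 * k + 1)) \<le>
     (nn J * pochhammer t J * pochhammer s j) * ((49/400 * F\<^sup>2) * pochhammer (t + real J) (2 * k + 1))"
    using nn_pos[of J] ps_pos pt_pos by (intro mult_left_mono) (auto simp: less_imp_le)
  then show ?thesis unfolding A_def A'_def J_def[symmetric] J p by (simp add: mult_ac)
qed

text \<open>The constant is \<open>7/20 * 7/13 * 1/2\<close>: the bound for \<open>E / F\<close>, a
  quotient of Pochhammer symbols, and the linear factor against the last factor of the longer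
  symbol.\<close>

lemma B_le:
  assumes "3 \<le> k" "2 * j \<le> k"
  shows "B j * (real k + s - t - 2 * real j) \<le> 49/520 * A (k - j)"
proof -
  define n where "n = 2 * k - 2 * j"
  define x where "x = real j"
  have p: "pochhammer s (2 * k - j) = pochhammer s j * pochhammer (s + real j) n"
    "pochhammer t (2 * k + 1 + (k - j)) = pochhammer t (k + j) * pochhammer (t + real (k + j)) (Suc n)"
    using assms by (intro pochhammer_split; simp add: n_def)+
  have kj: "k - (k - j) = j" using assms by simp
  have n: "real n = 2 * real k - 2 * x" using assms by (simp add: n_def x_def of_nat_diff)
  have kx: "2 * x \<le> real k" "3 \<le> real k" "0 \<le> x" using assms by (auto simp: x_def)
  \<comment> \<open>Two base points at distance one are put between \<open>s + j\<close> and
    \<open>t + k + j\<close>; the quotient \<open>p0 / p1\<close> then telescopes to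
    \<open>(x + 2) / (x + 2 + n)\<close>.\<close>
  define p0 where "p0 = pochhammer (x + 2) n"
  define p1 where "p1 = pochhammer (x + 3) n"
  have pp: "p0 > 0" "p1 > 0" unfolding p0_def p1_def using kx by (auto intro!: pochhammer_pos)
  have sh: "p0 * (x + 2 + real n) = (x + 2) * p1"
    using pochhammer_shift[of "x + 2" n] by (simp add: p0_def p1_def add.commute add.left_commute)
  have ps: "pochhammer (s + real j) n \<le> p0" unfolding p0_def s_def x_def
    by (intro pochhammer_mono_real) auto
  have pt: "p1 \<le> pochhammer (t + real (k + j)) n" unfolding p1_def using kx t_pos
    by (intro pochhammer_mono_real) (auto simp: x_def)
  have ptS: "pochhammer (t + real (k + j)) (Suc n) = pochhammer (t + real (k + j)) n * (t + 3 * real k - x)"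
    by (simp add: pochhammer_Suc n) (simp add: x_def algebra_simps)
  have c1: "real k + s - t - 2 * x \<le> 1/2 * (t + 3 * real k - x)"
    using kx t_pos by (simp add: s_def)
  have c0: "0 \<le> t + 3 * real k - x" using kx t_pos by simp
  \<comment> \<open>Under \<open>2 * x <= k\<close> and \<open>3 <= k\<close> the extreme point is
    \<open>k = 3\<close>, \<open>x = 3/2\<close>, where both sides agree.\<close>
  have "p0 * (13 * (x + 2)) \<le> p0 * (7 * (x + 2 + real n))"
    using pp kx n by (intro mult_left_mono) auto
  also have "\<dots> = 7 * ((x + 2) * p1)" unfolding sh[symmetric] by (simp only: mult_ac)
  finally have "(13 * p0) * (x + 2) \<le> (7 * p1) * (x + 2)" by (simp add: mult_ac)
  then have c2: "p0 \<le> 7/13 * p1" using kx by simp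
  have c3: "pochhammer (s + real j) n \<le> 7/13 * pochhammer (t + real (k + j)) n"
    using ps pt c2 by linarith
  have pnn: "0 \<le> pochhammer (s + real j) n" "0 \<le> pochhammer (t + real (k + j)) n"
    using s_pos t_pos by (auto intro!: pochhammer_nonneg)
  have "pochhammer (s + real j) n * (real k + s - t - 2 * x) \<le>
     pochhammer (s + real j) n * (1/2 * (t + 3 * real k - x))"
    using c1 pnn by (intro mult_left_mono)
  also have "\<dots> \<le> (7/13 * pochhammer (t + real (k + j)) n) * (1/2 * (t + 3 * real k - x))"
    using c3 c0 by (intro mult_right_mono) auto
  finally have c4: "pochhammer (s + real j) n * (real k + s - t - 2 * x) \<le> 7/26 * pochhammer (t + real (k + j)) (Suc n)"
    unfolding ptS by simp
  have nm: "nn j \<le> nn (k - j)" using assms by (intro nn_mono)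
  have en: "E * nn j \<le> (7/20 * F) * nn (k - j)"
    using E_le_F[OF assms(1)] nm E_pos F_pos nn_pos[of j] by (intro mult_mono) auto
  have PS: "0 \<le> pochhammer (t + real (k + j)) (Suc n)" using t_pos by (auto intro!: pochhammer_nonneg)
  have "(E * nn j) * (pochhammer (s + real j) n * (real k + s - t - 2 * x)) \<le>
     (E * nn j) * (7/26 * pochhammer (t + real (k + j)) (Suc n))"
    using c4 E_pos nn_pos[of j] by (intro mult_left_mono) auto
  also have "\<dots> \<le> ((7/20 * F) * nn (k - j)) * (7/26 * pochhammer (t + real (k + j)) (Suc n))"
    using en PS by (intro mult_right_mono) auto
  finally have "(F * pochhammer s j * pochhammer t (k + j)) * ((E * nn j) * (pochhammer (s + real j) n * (real k + s - t - 2 * x))) \<le>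
    (F * pochhammer s j * pochhammer t (k + j)) * (((7/20 * F) * nn (k - j)) * (7/26 * pochhammer (t + real (k + j)) (Suc n)))"
    using F_pos ps_pos[of j] pt_pos[of "k + j"] by (intro mult_left_mono) auto
  then show ?thesis unfolding A_def B_def p kj x_def by (simp add: mult_ac power2_eq_square)
qed

lemma B_le_mid:
  assumes "3 \<le> k" "k < 2 * j" "j \<le> k"
  shows "B j \<le> 7/160 * A j"
proof -
  have p: "pochhammer s (2 * k - j) = pochhammer s (k - j) * pochhammer (s + real (k - j)) k"
    "pochhammer t (2 * k + 1 + j) = pochhammer t (k + j) * pochhammer (t + real (k + j)) (Suc k)"
    using assms by (intro pochhammer_split; simp)+
  have q: "pochhammer (s + real (k - j)) k \<le> pochhammer (t + real (k + j)) k"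
    using t_pos s_pos assms by (intro pochhammer_mono_real) (auto simp: s_def)
  \<comment> \<open>\<open>3 <= k < 2 * j\<close> forces \<open>2 <= j\<close>, so the last factor
    \<open>t + 2 * k + j\<close> is at least \<open>8\<close>; this gives
    \<open>7/160 = 7/20 * 1/8\<close>.\<close>
  have q': "pochhammer (t + real (k + j)) k * 8 \<le> pochhammer (t + real (k + j)) (Suc k)"
    unfolding pochhammer_Suc using t_pos assms by (intro mult_left_mono) (auto intro!: pochhammer_nonneg)
  have q0: "0 \<le> pochhammer (s + real (k - j)) k" using s_pos by (auto intro!: pochhammer_nonneg)
  have "E * pochhammer (s + real (k - j)) k \<le> (7/20 * F) * (1/8 * pochhammer (t + real (k + j)) (Suc k))"
    using q q' q0 E_pos F_pos E_le_F[OF assms(1)] by (intro mult_mono) auto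
  then have "(F * nn j * pochhammer s (k - j) * pochhammer t (k + j)) * (E * pochhammer (s + real (k - j)) k)
    \<le> (F * nn j * pochhammer s (k - j) * pochhammer t (k + j)) * ((7/20 * F) * (1/8 * pochhammer (t + real (k + j)) (Suc k)))"
    using F_pos nn_pos[of j] ps_pos[of "k - j"] pt_pos[of "k + j"] by (intro mult_left_mono) auto
  then show ?thesis unfolding A_def B_def p by (simp add: mult_ac power2_eq_square)
qed

definition X :: "nat \<Rightarrow> real" where
  "X j = A j - A' j + B j * (2 * real j - real k - (s - t))"

text \<open>For small \<open>j\<close> the negative terms of \<open>X j\<close> are small multiples of \<open>A (k - j)\<close>.\<close>

lemma X_pair:
  assumes "3 \<le> k" "2 * j \<le> k"
  shows "X j + X (k - j) > 0"
proof -
  define J where "J = k - j"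
  have J: "k \<le> 2 * J" "J \<le> k" "real J = real k - real j" "k - J = j" using assms by (auto simp: J_def of_nat_diff)
  have b1: "B j * (2 * real j - real k - (s - t)) \<ge> - (49/520) * A J"
    using B_le[OF assms] unfolding J_def by (simp add: algebra_simps)
  have aJ: "A' J \<le> 7/9 * A J" using J by (intro A'_le) auto
  have b2: "B J * (2 * real J - real k - (s - t)) \<ge> - (7/320) * A J" if "j \<noteq> J"
  proof -
    have lt: "k < 2 * J" using that assms J by (auto simp: J_def)
    then have "2 * real J - real k \<ge> 1" by linarith
    then have "2 * real J - real k - (s - t) \<ge> - (1/2)" using t_pos by (simp add: s_def)
    then have "B J * (2 * real J - real k - (s - t)) \<ge> B J * (- (1/2))"
      using B_pos[of J] by (intro mult_left_mono) auto
    moreover have "B J \<le> 7/160 * A J" using assms(1) lt J(2) by (rule B_le_mid)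
    ultimately show ?thesis by linarith
  qed
  have AJ: "A J > 0" "A j > 0" by (rule A_pos)+
  \<comment> \<open>Everything negative is paid for by \<open>A J\<close>. When
    \<open>3 * j < k\<close>, the costs \<open>7/9 + 49/520 + 49/400\<close> stay below
    \<open>1\<close> by less than \<open>1/100\<close>, so the loss \<open>7/320\<close> of
    \<open>b2\<close> is not affordable; there, however, \<open>2 * J >= k + 2\<close> makes that
    term nonnegative.\<close>
  consider "j = J" | "j \<noteq> J" "k \<le> 3 * j" | "3 * j < k" by linarith
  then have "X j + X J > 0"
  proof cases
    case 1
    then show ?thesis unfolding X_def using b1 aJ AJ by auto
  next
    case 2
    have "A' j \<le> 7/9 * A j" using 2 assms by (intro A'_le) auto
    then show ?thesis unfolding X_def using b1 aJ AJ b2[OF 2(1)] by linarith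
  next
    case 3
    then have "k + 2 \<le> 2 * J" using assms by (auto simp: J_def)
    then have "2 * real J - real k - (s - t) \<ge> 0" using t_pos by (simp add: s_def)
    then have "B J * (2 * real J - real k - (s - t)) \<ge> 0" using B_pos[of J] by (intro mult_nonneg_nonneg) auto
    moreover have "A' j \<le> 49/400 * A J" unfolding J_def using assms(1) 3 by (rule A'_le_far)
    ultimately show ?thesis unfolding X_def using b1 aJ AJ by linarith
  qed
  then show ?thesis unfolding J_def .
qed

lemma sum_X_pos:
  assumes "3 \<le> k"
  shows "(\<Sum>j\<le>k. X j) > 0"
proof -
  have rev: "(\<Sum>j\<le>k. X (k - j)) = (\<Sum>j\<le>k. X j)"
    by (rule sum.nat_diff_reindex[of X "Suc k", unfolded lessThan_Suc_atMost, simplified])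
  have "X j + X (k - j) > 0" if "j \<le> k" for j
  proof (cases "2 * j \<le> k")
    case True
    then show ?thesis using X_pair assms by blast
  next
    case False
    then have "2 * (k - j) \<le> k" "k - (k - j) = j" using that by auto
    then show ?thesis using X_pair[OF assms, of "k - j"] by (simp add: add.commute)
  qed
  then have "(\<Sum>j\<le>k. X j + X (k - j)) > 0" by (intro sum_pos) auto
  then show ?thesis unfolding sum.distrib rev by simp
qed

section \<open>The two averages of third order and their signs\<close>

definition P :: "nat \<Rightarrow> nat \<Rightarrow> real" where
  "P a b = pochhammer s a * pochhammer t b"

text \<open>Up to positive factors, \<open>I\<^sub>B\<close> is the average of \<open>G b W\<close>
  and \<open>I\<^sub>A\<close> that of \<open>G b^2\<close>: the products are expanded and each
  \<open>x^2 y^2 u^i v^j\<close> is replaced by \<open>P i j\<close>.\<close>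

definition I\<^sub>B :: real where
  "I\<^sub>B = (\<Sum>j\<le>k. nn j * (F\<^sup>2 * P (k - j) (2 * k + 1 + j) + E * F * P (2 * k - j) (k + j + 1)
      - E * F * P (2 * k + 1 - j) (k + j) - E\<^sup>2 * P (3 * k + 1 - j) j))"

definition I\<^sub>A :: real where
  "I\<^sub>A = F ^ 3 * P 0 (3 * k + 1) - E ^ 3 * P (3 * k + 1) 0 + 2 * E * F\<^sup>2 * P k (2 * k + 1)
     - 2 * E\<^sup>2 * F * P (2 * k + 1) k + E\<^sup>2 * F * P (2 * k) (k + 1) - E * F\<^sup>2 * P (k + 1) (2 * k)"

text \<open>The two mixed terms differ only in which symbol is one factor longer, and the difference
  of these factors is \<open>(t + k + j) - (s + 2 * k - j)\<close>. The \<open>E^2\<close> terms are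
  summed in reverse order.\<close>

lemma I\<^sub>B_eq: "I\<^sub>B = (\<Sum>j\<le>k. X j)"
proof -
  have a': "E\<^sup>2 * nn j * P (3 * k + 1 - j) j = A' (k - j)" if "j \<le> k" for j
  proof -
    have "2 * k + 1 + (k - j) = 3 * k + 1 - j" "k - (k - j) = j" using that by auto
    then show ?thesis unfolding A'_def P_def by (simp only: mult_ac)
  qed
  have b: "E * F * nn j * P (2 * k - j) (k + j + 1) - E * F * nn j * P (2 * k + 1 - j) (k + j)
     = B j * (2 * real j - real k - (s - t))" if "j \<le> k" for j
  proof -
    have "2 * k + 1 - j = Suc (2 * k - j)" "real (2 * k - j) = 2 * real k - real j" using that by (auto simp: of_nat_diff)
    then show ?thesis unfolding B_def P_def by (simp add: pochhammer_Suc algebra_simps)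
  qed
  have "I\<^sub>B = (\<Sum>j\<le>k. A j - A' (k - j) + B j * (2 * real j - real k - (s - t)))"
    unfolding I\<^sub>B_def
  proof (rule sum.cong)
    fix j assume "j \<in> {..k}"
    then have j: "j \<le> k" by simp
    show "nn j * (F\<^sup>2 * P (k - j) (2 * k + 1 + j) + E * F * P (2 * k - j) (k + j + 1)
      - E * F * P (2 * k + 1 - j) (k + j) - E\<^sup>2 * P (3 * k + 1 - j) j)
      = A j - A' (k - j) + B j * (2 * real j - real k - (s - t))"
      unfolding a'[OF j, symmetric] b[OF j, symmetric] A_def P_def by (simp add: algebra_simps)
  qed simp
  also have "\<dots> = (\<Sum>j\<le>k. A j) - (\<Sum>j\<le>k. A' (k - j)) + (\<Sum>j\<le>k. B j * (2 * real j - real k - (s - t)))"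
    by (simp add: sum.distrib sum_subtractf)
  also have "(\<Sum>j\<le>k. A' (k - j)) = (\<Sum>j\<le>k. A' j)"
    by (rule sum.nat_diff_reindex[of A' "Suc k", unfolded lessThan_Suc_atMost, simplified])
  finally show ?thesis unfolding X_def by (simp add: sum.distrib sum_subtractf)
qed

text \<open>\<open>k = 1\<close> and \<open>k = 2\<close> escape the bound
  \<open>E <= 7/20 * F\<close> and are computed outright. The factor \<open>e * (1 - 2 * e)\<close>
  is to be expected: at \<open>e = 0\<close> both \<open>E\<close> and every nonempty symbol based
  at \<open>t\<close> vanish, and at \<open>e = 1/2\<close> the sum is antisymmetric. What remains
  has positive coefficients.\<close>

lemma I\<^sub>B_1:
  assumes "k = 1"
  shows "I\<^sub>B = e * (1 - 2 * e) * (81/4 + 1107/16 * e^1 + 1161/16 * e^2 + 189/8 * e^3)"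
proof -
  have n: "averaging.nn e (Suc 0) 0 = 1 + e" "averaging.nn e (Suc 0) (Suc 0) = 3/2"
    using nn_0 nn_k by (simp_all add: assms)
  show ?thesis unfolding I\<^sub>B_def P_def E_def F_def s_def t_def
    by (simp add: assms n numeral_eq_Suc pochhammer_rec) algebra
qed

lemma I\<^sub>B_2:
  assumes "k = 2"
  shows "I\<^sub>B = e * (1 - 2 * e) * (637875/16 + 15387975/64 * e^1 + 17797725/32 * e^2 + 163496475/256 * e^3 + 49472775/128 * e^4 + 30101625/256 * e^5 + 1808325/128 * e^6)"
proof -
  have n1: "nn 1 = 5/2 * (2 + e)"
  proof -
    have "nn 1 * (1 + e) = (5/2 * (2 + e)) * (1 + e)"
      using nn_Suc[of 0] nn_0 by (simp add: assms numeral_eq_Suc pochhammer_rec) (use e_pos in \<open>auto simp: algebra_simps\<close>)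
    then show ?thesis using e_pos by simp
  qed
  have n: "nn 0 = (1 + e) * (2 + e)" "nn 1 = 5/2 * (2 + e)" "nn 2 = 15/4"
    using nn_0 nn_k n1 by (simp_all add: assms pochhammer_Suc numeral_2_eq_2)
  have I: "I\<^sub>B = nn 0 * (F\<^sup>2 * P 2 5 + E * F * P 4 3 - E * F * P 5 2 - E\<^sup>2 * P 7 0)
     + nn 1 * (F\<^sup>2 * P 1 6 + E * F * P 3 4 - E * F * P 4 3 - E\<^sup>2 * P 6 1)
     + nn 2 * (F\<^sup>2 * P 0 7 + E * F * P 2 5 - E * F * P 3 4 - E\<^sup>2 * P 5 2)"
  proof -
    have "{..k} = {0, 1, 2}" using assms by auto
    then show ?thesis unfolding I\<^sub>B_def by (simp add: assms eval_nat_numeral)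
  qed
  have EF: "E = e * (e + 1) * (e + 2)" "F = 15/8"
    unfolding E_def F_def by (simp_all add: assms numeral_2_eq_2 pochhammer_Suc algebra_simps)
  have S: "pochhammer s 0 = 1" "pochhammer s 1 = 3/2" "pochhammer s 2 = 15/4" "pochhammer s 3 = 105/8"
     "pochhammer s 4 = 945/16" "pochhammer s 5 = 10395/32" "pochhammer s 6 = 135135/64" "pochhammer s 7 = 2027025/128"
    by (simp_all add: s_def numeral_eq_Suc pochhammer_Suc)
  have T: "pochhammer t 0 = 1" "pochhammer t 1 = 3*e" "pochhammer t 2 = 3*e * (3*e+1)"
     "pochhammer t 3 = 3*e * (3*e+1) * (3*e+2)" "pochhammer t 4 = 3*e * (3*e+1) * (3*e+2) * (3*e+3)"
     "pochhammer t 5 = 3*e * (3*e+1) * (3*e+2) * (3*e+3) * (3*e+4)"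
     "pochhammer t 6 = 3*e * (3*e+1) * (3*e+2) * (3*e+3) * (3*e+4) * (3*e+5)"
     "pochhammer t 7 = 3*e * (3*e+1) * (3*e+2) * (3*e+3) * (3*e+4) * (3*e+5) * (3*e+6)"
    by (simp_all add: t_def numeral_eq_Suc pochhammer_Suc)
  show ?thesis unfolding I P_def S T n EF by algebra
qed

lemma I\<^sub>A_1:
  assumes "k = 1"
  shows "I\<^sub>A = e * (1 - 2 * e) * (243/32 + 243/4 * e^1 + 3537/32 * e^2 + 297/4 * e^3 + 135/8 * e^4)"
  unfolding I\<^sub>A_def P_def E_def F_def s_def t_def
    by (simp add: assms numeral_eq_Suc pochhammer_rec) algebra

lemma I\<^sub>B_pos: "I\<^sub>B > 0"
proof -
  consider "k = 1" | "k = 2" | "3 \<le> k" using k_ge by linarith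
  then show ?thesis
  proof cases
    case 1
    then show ?thesis unfolding I\<^sub>B_1[OF 1] using e_pos e_le by (intro mult_pos_pos add_pos_nonneg) auto
  next
    case 2
    then show ?thesis unfolding I\<^sub>B_2[OF 2] using e_pos e_le by (intro mult_pos_pos add_pos_nonneg) auto
  next
    case 3
    then show ?thesis unfolding I\<^sub>B_eq by (rule sum_X_pos)
  qed
qed

lemma E_le_half_F: "E \<le> 1/2 * F"
proof -
  have "e * pochhammer (e + 1) k \<le> 1/4 * pochhammer (1/2 + 1) k"
    using e_pos e_le by (intro mult_mono pochhammer_mono_real) (auto intro!: pochhammer_nonneg)
  then show ?thesis unfolding E_def F_def pochhammer_rec by simp
qed

text \<open>Relative to \<open>F^3 * P 0 (3 * k + 1)\<close> the \<open>E^3\<close> term costs at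
  most \<open>7/18\<close> and the \<open>E^2 F\<close> terms together at most \<open>3/8\<close>,
  while the \<open>E F^2\<close> terms add up to something nonnegative. The second bound rests on
  \<open>s <= t + k\<close>, which fails for \<open>k = 1\<close> and small \<open>e\<close>; that
  case is computed.\<close>

lemma I\<^sub>A_pos: "I\<^sub>A > 0"
proof (cases "k = 1")
  case True
  then show ?thesis unfolding I\<^sub>A_1[OF True] using e_pos e_le by (intro mult_pos_pos add_pos_nonneg) auto
next
  case False
  then have k2: "2 \<le> k" using k_ge by simp
  have e3: "E ^ 3 * P (3 * k + 1) 0 \<le> 7/18 * F ^ 3 * P 0 (3 * k + 1)"
  proof -
    define S T where "S = pochhammer s (3 * k + 1)" and "T = F ^ 3 * pochhammer t (3 * k + 1)"
    have ST: "S > 0" "T > 0" using ps_pos pt_pos F_pos by (auto simp: S_def T_def)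
    have "E ^ 3 / e * S \<le> 14/9 * T" using A'_le_A_top by (simp add: S_def T_def mult_ac)
    then have "E ^ 3 * S \<le> e * (14/9 * T)" using e_pos by (simp add: pos_divide_le_eq mult.commute)
    also have "\<dots> \<le> 1/4 * (14/9 * T)" using ST e_le by (intro mult_right_mono) auto
    finally show ?thesis by (simp add: P_def S_def T_def)
  qed
  have p0: "pochhammer x (2 * k) = pochhammer x k * pochhammer (x + real k) k" for x :: real
    by (rule pochhammer_split) simp
  have p1: "pochhammer x (2 * k + 1) = pochhammer x k * pochhammer (x + real k) k * (x + 2 * real k)" for x :: real
    using p0[of x] by (simp add: pochhammer_Suc)
  have p2: "pochhammer x (k + 1) = pochhammer x k * (x + real k)" for x :: real
    by (simp add: pochhammer_Suc)
  have p: "P k (2 * k + 1) = P k k * pochhammer (t + real k) k * (t + 2 * real k)"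
    "P (k + 1) (2 * k) = P k k * (s + real k) * pochhammer (t + real k) k"
    "P (2 * k + 1) k = P k k * pochhammer (s + real k) k * (s + 2 * real k)"
    "P (2 * k) (k + 1) = P k k * pochhammer (s + real k) k * (t + real k)"
    unfolding P_def p0 p1 p2 by (simp_all only: mult_ac)
  have q: "2 * P k (2 * k + 1) - P (k + 1) (2 * k) \<ge> 0"
  proof -
    have "2 * P k (2 * k + 1) - P (k + 1) (2 * k) = P k k * pochhammer (t + real k) k * (3 * real k + 2 * t - s)"
      unfolding p by (simp add: algebra_simps)
    also have "\<dots> \<ge> 0" using k2 t_pos ps_pos[of k] pt_pos[of k] unfolding P_def
      by (intro mult_nonneg_nonneg pochhammer_nonneg) (auto simp: s_def)
    finally show ?thesis .
  qed
  have r: "2 * P (2 * k + 1) k - P (2 * k) (k + 1) \<le> 3/2 * P 0 (3 * k + 1)"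
  proof -
    have "2 * P (2 * k + 1) k - P (2 * k) (k + 1) = pochhammer t k * pochhammer s (2 * k) * (3 * real k + 2 * s - t)"
      unfolding p p0 by (simp add: P_def algebra_simps)
    also have "pochhammer s (2 * k) * (3 * real k + 2 * s - t) \<le> pochhammer (t + real k) (2 * k) * (3/2 * (t + 3 * real k))"
      using k2 t_pos s_pos e_le by (intro mult_mono pochhammer_mono_real) (auto simp: s_def t_def intro!: pochhammer_nonneg)
    then have "pochhammer t k * pochhammer s (2 * k) * (3 * real k + 2 * s - t)
       \<le> pochhammer t k * (pochhammer (t + real k) (2 * k) * (3/2 * (t + 3 * real k)))"
      using pt_pos[of k] by (simp add: mult.assoc)
    also have "\<dots> = 3/2 * P 0 (3 * k + 1)"
      using pochhammer_split[of "3 * k" k "2 * k" t] by (simp add: P_def pochhammer_Suc)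
    finally show ?thesis .
  qed
  have "E\<^sup>2 * F * (2 * P (2 * k + 1) k - P (2 * k) (k + 1)) \<le> E\<^sup>2 * F * (3/2 * P 0 (3 * k + 1))"
    using r E_pos F_pos by (intro mult_left_mono) auto
  also have "\<dots> \<le> (1/2 * F)\<^sup>2 * F * (3/2 * P 0 (3 * k + 1))"
    using E_le_half_F E_pos F_pos pt_pos[of "3 * k + 1"] by (intro mult_right_mono power_mono) (auto simp: P_def)
  finally have r2: "E\<^sup>2 * F * (2 * P (2 * k + 1) k - P (2 * k) (k + 1)) \<le> 3/8 * (F ^ 3 * P 0 (3 * k + 1))"
    by (simp add: power2_eq_square power3_eq_cube)
  have q2: "E * F\<^sup>2 * (2 * P k (2 * k + 1) - P (k + 1) (2 * k)) \<ge> 0"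
    using q E_pos by (intro mult_nonneg_nonneg) auto
  have "F ^ 3 * P 0 (3 * k + 1) > 0" using F_pos pt_pos by (simp add: P_def)
  then show ?thesis using e3 r2 q2 unfolding I\<^sub>A_def by (simp add: algebra_simps)
qed

end

section \<open>Asymptotic stability from a Lyapunov function with a pole\<close>

text \<open>Picard iteration in the norm weighted by \<open>exp (- c * t)\<close>, in which a single
  contraction covers the whole half-line. The unknown is
  \<open>w t = exp (- c * t) *\<^sub>R z t\<close>, a bounded continuous function, and
  \<open>c > 2 * L\<close> brings the contraction factor \<open>L / c\<close> below
  \<open>1/2\<close>.\<close>

lemma global_solution:
  fixes g :: "'a::euclidean_space \<Rightarrow> 'a"
  assumes lip: "L-lipschitz_on UNIV g" and bdd: "\<And>x. norm (g x) \<le> B"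
  obtains z where "solves_on g z {0..}" "z 0 = z0"
proof -
  have L: "L \<ge> 0" using lip by (rule lipschitz_on_nonneg)
  define c where "c = 2 * L + 1"
  have c: "c > 0" "L / c \<le> 1/2" using L by (auto simp: c_def field_simps)
  have B: "B \<ge> 0" using bdd norm_ge_zero order_trans by blast
  have gcont: "continuous_on S g" for S
    using lipschitz_on_continuous_on[OF lip] continuous_on_subset by blast
  define G where "G = (\<lambda>w s. g (exp (c * s) *\<^sub>R apply_bcontfun w s))"
  have Gcont: "continuous_on S (G w)" for S w
    unfolding G_def by (intro continuous_on_compose2[OF gcont[of UNIV]] continuous_intros) auto
  define I where "I = (\<lambda>w u. integral {0..u} (G w))"
  have Ider: "(I w has_vector_derivative G w u) (at u within {0..})" if "u \<ge> 0" for w u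
  proof -
    have "(I w has_vector_derivative G w u) (at u within {0..u+1})"
      unfolding I_def using that by (intro integral_has_vector_derivative Gcont) auto
    moreover have "at u within {0..} = at u within {0..u+1}"
      using that by (intro at_within_nhd[of _ "{..<u+1}"]) auto
    ultimately show ?thesis by simp
  qed
  have Icont: "continuous_on {0..} (I w)" for w
    by (rule continuous_on_vector_derivative[of _ _ "G w"]) (use Ider in auto)
  \<comment> \<open>Bounded continuous functions are defined on the whole line, so negative times
    are clamped to \<open>0\<close>.\<close>
  define F where "F = (\<lambda>w t. exp (- c * max t 0) *\<^sub>R (z0 + I w (max t 0)))"
  have Fcont: "continuous_on UNIV (F w)" for w
    unfolding F_def by (intro continuous_intros continuous_on_compose2[OF Icont]) auto
  have Ibd: "norm (I w u) \<le> B * u" if "u \<ge> 0" for w u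
    using integral_bound[of 0 u "G w" B] that Gcont bdd unfolding I_def G_def by simp
  have Fbd: "norm (F w t) \<le> norm z0 + B / c" for w t
  proof -
    define u where "u = max t 0"
    have u: "u \<ge> 0" by (simp add: u_def)
    \<comment> \<open>A bounded \<open>g\<close> lets the integral grow linearly, and
      \<open>u * exp (- c * u) <= 1 / c\<close> absorbs this growth.\<close>
    have "c * u \<le> exp (c * u)" using exp_ge_add_one_self[of "c * u"] by linarith
    then have e: "exp (- c * u) * u \<le> 1 / c"
      using c by (simp add: exp_minus field_simps)
    have "norm (F w t) = exp (- c * u) * norm (z0 + I w u)" by (simp add: F_def u_def)
    also have "\<dots> \<le> exp (- c * u) * (norm z0 + B * u)"
      using norm_triangle_ineq[of z0 "I w u"] Ibd[OF u, of w] by (intro mult_left_mono) auto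
    also have "\<dots> = exp (- c * u) * norm z0 + B * (exp (- c * u) * u)" by (simp add: algebra_simps)
    also have "\<dots> \<le> 1 * norm z0 + B * (1 / c)"
      using e B c u by (intro add_mono mult_right_mono mult_left_mono) auto
    finally show ?thesis by simp
  qed
  define \<Phi> where "\<Phi> = (\<lambda>w. Bcontfun (F w))"
  have \<Phi>: "apply_bcontfun (\<Phi> w) = F w" for w
    unfolding \<Phi>_def by (rule Bcontfun_inverse, rule bcontfun_normI[OF Fcont Fbd])
  have contr: "dist (\<Phi> w) (\<Phi> v) \<le> 1/2 * dist w v" for w v
  proof (rule dist_bound)
    fix t :: real
    define u where "u = max t 0"
    define d where "d = dist w v"
    have u: "u \<ge> 0" by (simp add: u_def)
    have d: "d \<ge> 0" by (simp add: d_def)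
    have pt: "norm (G w s - G v s) \<le> L * d * exp (c * s)" for s
    proof -
      have "norm (G w s - G v s) \<le> L * norm (exp (c * s) *\<^sub>R apply_bcontfun w s - exp (c * s) *\<^sub>R apply_bcontfun v s)"
        using lipschitz_onD[OF lip] unfolding G_def by (simp add: dist_norm)
      also have "\<dots> = L * (exp (c * s) * dist (apply_bcontfun w s) (apply_bcontfun v s))"
        unfolding scaleR_diff_right[symmetric] by (simp add: dist_norm)
      also have "\<dots> \<le> L * (exp (c * s) * d)"
        unfolding d_def using L by (intro mult_left_mono dist_bounded) auto
      finally show ?thesis by (simp add: mult_ac)
    qed
    have "((\<lambda>s. L * d * exp (c * s)) has_integral (L * d / c * exp (c * u) - L * d / c * exp (c * 0))) {0..u}"
      using u c by (intro fundamental_theorem_of_calculus)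
        (auto intro!: derivative_eq_intros simp: has_real_derivative_iff_has_vector_derivative[symmetric])
    then have hi: "integral {0..u} (\<lambda>s. L * d * exp (c * s)) = L * d / c * exp (c * u) - L * d / c"
      using integral_unique by (simp only: mult_zero_right exp_zero mult_1_right)
    have "I w u - I v u = integral {0..u} (\<lambda>s. G w s - G v s)"
      unfolding I_def by (intro integral_diff[symmetric] integrable_continuous_interval Gcont)
    also have "norm \<dots> \<le> integral {0..u} (\<lambda>s. L * d * exp (c * s))"
      by (intro integral_norm_bound_integral integrable_continuous_interval continuous_intros Gcont pt)
    finally have Ibound: "norm (I w u - I v u) \<le> integral {0..u} (\<lambda>s. L * d * exp (c * s))" .
    have Ibound2: "norm (I w u - I v u) \<le> L / c * d * exp (c * u)"
    proof -
      have "L * d / c \<ge> 0" using L d c by simp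
      then show ?thesis using Ibound unfolding hi by (simp add: mult_ac)
    qed
    have "dist (F w t) (F v t) = exp (- c * u) * norm (I w u - I v u)"
      unfolding F_def u_def dist_norm scaleR_diff_right[symmetric] by simp
    also have "\<dots> \<le> exp (- c * u) * (L / c * d * exp (c * u))"
      by (intro mult_left_mono) (use Ibound2 in auto)
    also have "\<dots> = L / c * d" by (simp add: exp_minus)
    also have "\<dots> \<le> 1/2 * d" using c d by (intro mult_right_mono)
    finally show "dist (apply_bcontfun (\<Phi> w) t) (apply_bcontfun (\<Phi> v) t) \<le> 1/2 * dist w v"
      unfolding \<Phi> d_def .
  qed
  have "\<exists>!w. \<Phi> w = w"
    by (rule banach_fix_type[of "1/2"]) (use contr in auto)
  then obtain w where w: "\<Phi> w = w" by blast
  define z where "z = (\<lambda>t. z0 + I w t)"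
  have zw: "exp (c * t) *\<^sub>R apply_bcontfun w t = z t" if "t \<ge> 0" for t
  proof -
    have "apply_bcontfun w t = F w t" using w \<Phi> by metis
    then show ?thesis using that by (simp add: F_def z_def exp_minus max_def)
  qed
  have "solves_on g z {0..}"
    unfolding solves_on_def
  proof
    fix t :: real assume "t \<in> {0..}"
    then have t: "t \<ge> 0" by simp
    have "(z has_vector_derivative G w t) (at t within {0..})"
      unfolding z_def using Ider[OF t, of w] by (auto intro!: derivative_eq_intros)
    then show "(z has_vector_derivative g (z t)) (at t within {0..})"
      unfolding G_def using zw[OF t] by simp
  qed
  moreover have "z 0 = z0" by (simp add: z_def I_def)
  ultimately show ?thesis by (rule that)
qed

lemma solves_on_subset: "solves_on f z J \<Longrightarrow> K \<subseteq> J \<Longrightarrow> solves_on f z K"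
  unfolding solves_on_def by (meson has_vector_derivative_within_subset subsetD)

lemma solves_on_continuous: "solves_on f z J \<Longrightarrow> continuous_on J z"
  unfolding solves_on_def by (rule continuous_on_vector_derivative) auto

lemma solves_on_shift:
  assumes "solves_on f z {0..}" "t0 \<ge> 0"
  shows "solves_on f (\<lambda>t. z (t0 + t)) {0..}"
  unfolding solves_on_def
proof
  fix t :: real assume t: "t \<in> {0..}"
  have s: "((+) t0) ` {0..} \<subseteq> {0..}" using assms(2) by auto
  have "(z has_vector_derivative f (z (t0 + t))) (at (t0 + t) within ((+) t0) ` {0..})"
    using assms t s unfolding solves_on_def by (intro has_vector_derivative_within_subset[OF _ s]) auto
  moreover have "((+) t0 has_vector_derivative 1) (at t within {0..})"
    by (auto intro!: derivative_eq_intros)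
  ultimately have "((z \<circ> (+) t0) has_vector_derivative 1 *\<^sub>R f (z (t0 + t))) (at t within {0..})"
    by (intro vector_diff_chain_within)
  then show "((\<lambda>t. z (t0 + t)) has_vector_derivative f (z (t0 + t))) (at t within {0..})"
    by (simp add: o_def)
qed

lemma deriv_along_solution:
  assumes "solves_on f z J" "t \<in> interior J" "(V has_derivative V') (at (z t))"
  shows "((\<lambda>t. V (z t)) has_real_derivative V' (f (z t))) (at t)"
proof -
  have "t \<in> J" using assms(2) interior_subset by blast
  then have "(z has_vector_derivative f (z t)) (at t)"
    using assms(1) at_within_interior[OF assms(2)] unfolding solves_on_def by force
  then have "((V \<circ> z) has_vector_derivative V' (f (z t))) (at t)"
    by (rule vector_derivative_diff_chain_within[of _ _ _ UNIV, simplified]) (use assms(3) has_derivative_at_withinI in blast)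
  then show ?thesis by (simp add: has_real_derivative_iff_has_vector_derivative o_def)
qed

section \<open>Lyapunov functions with a pole at the equilibrium\<close>

text \<open>\<open>V\<close> increases along solutions. The rate is bounded below by a separate
  function \<open>D\<close>, because \<open>V'\<close> is not assumed continuous and a uniform rate
  is needed on compact sets away from \<open>p\<close>.\<close>

locale lyapunov =
  fixes f :: "'a::euclidean_space \<Rightarrow> 'a" and p :: 'a and r L :: real
    and V :: "'a \<Rightarrow> real" and V' :: "'a \<Rightarrow> 'a \<Rightarrow> real" and D :: "'a \<Rightarrow> real"
  assumes equil: "f p = 0" and r_pos: "r > 0" and lip: "L-lipschitz_on (cball p r) f"
    and V_deriv: "\<And>z. z \<in> cball p r - {p} \<Longrightarrow> (V has_derivative V' z) (at z)"
    and V'_ge: "\<And>z. z \<in> cball p r - {p} \<Longrightarrow> D z \<le> V' z (f z)"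
    and D_pos: "\<And>z. z \<in> cball p r - {p} \<Longrightarrow> 0 < D z"
    and D_cont: "continuous_on (cball p r - {p}) D"
    and V_lim: "filterlim V at_top (at p)"
begin

lemma V_cont: "S \<subseteq> cball p r - {p} \<Longrightarrow> continuous_on S V"
  using V_deriv by (meson continuous_at_imp_continuous_on has_derivative_continuous subsetD)

text \<open>Stated for any \<open>g\<close> that equals \<open>f\<close> on the ball, so that it
  also serves the truncated field of \<open>solution_exists\<close>.\<close>

lemma V_growth:
  assumes g: "\<And>x. x \<in> cball p r \<Longrightarrow> g x = f x" and sol: "solves_on g z J"
    and J: "{a..b} \<subseteq> J" and ab: "a \<le> b" and c: "\<And>t. t \<in> {a..b} \<Longrightarrow> z t \<in> cball p r - {p} \<and> c \<le> D (z t)"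
  shows "V (z a) + c * (b - a) \<le> V (z b)"
proof -
  have zc: "continuous_on {a..b} z"
    using solves_on_continuous[OF sol] J by (rule continuous_on_subset)
  have "continuous_on {a..b} (\<lambda>t. V (z t) - c * t)"
    by (intro continuous_intros continuous_on_compose2[OF V_cont[OF order_refl] zc]) (use c in blast)
  moreover have "\<exists>y. ((\<lambda>t. V (z t) - c * t) has_real_derivative y) (at t) \<and> y \<ge> 0" if "a < t" "t < b" for t
  proof -
    have t: "t \<in> {a..b}" using that by auto
    have ti: "t \<in> interior {a..b}" using that by simp
    have "((\<lambda>t. V (z t)) has_real_derivative V' (z t) (g (z t))) (at t)"
      using solves_on_subset[OF sol J] ti V_deriv c[OF t] by (intro deriv_along_solution[of g z "{a..b}"]) auto
    then have "((\<lambda>t. V (z t) - c * t) has_real_derivative V' (z t) (g (z t)) - c) (at t)"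
      by (auto intro!: derivative_eq_intros)
    moreover have "V' (z t) (g (z t)) - c \<ge> 0"
      using V'_ge[of "z t"] c[OF t] g[of "z t"] by force
    ultimately show ?thesis by blast
  qed
  ultimately have "V (z a) - c * a \<le> V (z b) - c * b"
    using ab by (cases "a = b") (auto intro!: DERIV_nonneg_imp_increasing_open[where f = "\<lambda>t. V (z t) - c * t"])
  then show ?thesis by (simp add: algebra_simps)
qed

text \<open>Near \<open>p\<close> the value of \<open>V\<close> exceeds its maximum on the sphere of
  radius \<open>\<epsilon>\<close>, and \<open>V\<close> cannot decrease, so the sphere is out of
  reach.\<close>

lemma confined:
  assumes g: "\<And>x. x \<in> cball p r \<Longrightarrow> g x = f x" and \<epsilon>: "0 < \<epsilon>" "\<epsilon> \<le> r"
  shows "\<exists>\<delta>>0. \<forall>T z. solves_on g z {0..T} \<longrightarrow> dist (z 0) p < \<delta> \<longrightarrow> (\<forall>t\<in>{0..T}. dist (z t) p < \<epsilon>)"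
proof -
  have "compact (V ` sphere p \<epsilon>)"
    using \<epsilon> by (intro compact_continuous_image V_cont) auto
  then obtain M where M: "\<And>x. dist x p = \<epsilon> \<Longrightarrow> V x \<le> M"
  proof -
    obtain M where "\<And>y. y \<in> V ` sphere p \<epsilon> \<Longrightarrow> norm y \<le> M"
      using compact_imp_bounded[OF \<open>compact _\<close>] unfolding bounded_iff by blast
    then have "V x \<le> M" if "dist x p = \<epsilon>" for x
      using that abs_le_D1[of "V x" M] by (simp add: dist_commute)
    then show ?thesis by (rule that)
  qed
  have "eventually (\<lambda>x. M < V x) (at p)"
    using V_lim by (simp add: filterlim_at_top_dense)
  then obtain d where d: "d > 0" "\<And>x. x \<noteq> p \<Longrightarrow> dist x p < d \<Longrightarrow> M < V x"
    unfolding eventually_at by auto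
  define \<delta> where "\<delta> = min d \<epsilon>"
  have \<delta>: "\<delta> > 0" "\<delta> \<le> \<epsilon>" "\<delta> \<le> d" using d \<epsilon> by (auto simp: \<delta>_def)
  have "dist (z t) p < \<epsilon>" if sol: "solves_on g z {0..T}" and z0: "dist (z 0) p < \<delta>" and t: "t \<in> {0..T}" for T z t
  proof (rule ccontr)
    assume "\<not> dist (z t) p < \<epsilon>"
    then have far: "\<epsilon> \<le> dist (z t) p" by simp
    define \<phi> where "\<phi> = (\<lambda>t. dist (z t) p)"
    have cont: "continuous_on {0..T} \<phi>"
      unfolding \<phi>_def by (intro continuous_intros solves_on_continuous[OF sol])
    have cont': "continuous_on {x..y} \<phi>" if "0 \<le> x" "y \<le> T" for x y
      using cont by (rule continuous_on_subset) (use that in auto)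
    have level: "compact {x \<in> {0..y}. \<phi> x = v}" if "y \<le> T" for y v
    proof -
      have "closed {x \<in> {0..y}. \<phi> x = v}"
        using that by (intro continuous_closed_preimage_constant cont') auto
      moreover have "bounded {x \<in> {0..y}. \<phi> x = v}"
        by (rule bounded_subset[OF bounded_closed_interval]) auto
      ultimately show ?thesis by (simp add: compact_eq_bounded_closed)
    qed
    have "\<exists>x\<ge>0. x \<le> t \<and> \<phi> x = \<epsilon>"
      using far z0 \<delta> t by (intro IVT' cont') (auto simp: \<phi>_def)
    then have "{x \<in> {0..t}. \<phi> x = \<epsilon>} \<noteq> {}" by auto
    then obtain a where a: "0 \<le> a" "a \<le> t" "\<phi> a = \<epsilon>"
      and a_min: "\<And>x. 0 \<le> x \<Longrightarrow> x \<le> t \<Longrightarrow> \<phi> x = \<epsilon> \<Longrightarrow> a \<le> x"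
      using compact_attains_inf[OF level, of t \<epsilon>] t by auto
    have below: "\<phi> x \<le> \<epsilon>" if "0 \<le> x" "x \<le> a" for x
    proof (rule ccontr)
      assume "\<not> \<phi> x \<le> \<epsilon>"
      then have "\<exists>y\<ge>0. y \<le> x \<and> \<phi> y = \<epsilon>"
        using z0 \<delta> t that a by (intro IVT' cont') (auto simp: \<phi>_def)
      then obtain y where "0 \<le> y" "y \<le> x" "\<phi> y = \<epsilon>" by blast
      moreover from this have "a \<le> y" using that a by (intro a_min) auto
      ultimately have "y = x" using that by simp
      then show False using \<open>\<phi> y = \<epsilon>\<close> \<open>\<not> \<phi> x \<le> \<epsilon>\<close> by simp
    qed
    \<comment> \<open>A solution may start at \<open>p\<close> or run through it, where
      \<open>V\<close> has no derivative. Growth of \<open>V\<close> is therefore used only after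
      the last passage through the level \<open>\<delta>1\<close> before \<open>a\<close>; the
      maximum with \<open>\<delta> / 2\<close> keeps this level positive when
      \<open>z 0 = p\<close>.\<close>
    define \<delta>1 where "\<delta>1 = max (\<phi> 0) (\<delta> / 2)"
    have \<delta>1: "0 < \<delta>1" "\<delta>1 < \<delta>" "\<phi> 0 \<le> \<delta>1" using \<delta> z0 by (auto simp: \<delta>1_def \<phi>_def)
    have "\<exists>x\<ge>0. x \<le> a \<and> \<phi> x = \<delta>1"
      using \<delta>1 \<delta> a t by (intro IVT' cont') auto
    then have "{x \<in> {0..a}. \<phi> x = \<delta>1} \<noteq> {}" by auto
    then obtain b where b: "0 \<le> b" "b \<le> a" "\<phi> b = \<delta>1"
      and b_max: "\<And>x. 0 \<le> x \<Longrightarrow> x \<le> a \<Longrightarrow> \<phi> x = \<delta>1 \<Longrightarrow> x \<le> b"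
      using compact_attains_sup[OF level, of a \<delta>1] t a by auto
    have above: "\<delta>1 \<le> \<phi> x" if "b \<le> x" "x \<le> a" for x
    proof (rule ccontr)
      assume "\<not> \<delta>1 \<le> \<phi> x"
      then have "\<exists>y\<ge>x. y \<le> a \<and> \<phi> y = \<delta>1"
        using \<delta>1 \<delta> t that a b by (intro IVT' cont') auto
      then obtain y where "x \<le> y" "y \<le> a" "\<phi> y = \<delta>1" by blast
      moreover from this have "y \<le> b" using that b by (intro b_max) auto
      ultimately have "y = x" using that by simp
      then show False using \<open>\<phi> y = \<delta>1\<close> \<open>\<not> \<delta>1 \<le> \<phi> x\<close> by simp
    qed
    have in_ball: "z x \<in> cball p r - {p} \<and> 0 \<le> D (z x)" if "x \<in> {b..a}" for x
    proof -
      have "\<phi> x \<le> r" "0 < \<phi> x" using below[of x] above[of x] that b \<epsilon> \<delta>1 by auto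
      then have "z x \<in> cball p r - {p}" by (auto simp: \<phi>_def dist_commute)
      then show ?thesis using D_pos[of "z x"] by auto
    qed
    have "V (z b) + 0 * (a - b) \<le> V (z a)"
      by (rule V_growth[OF g sol _ b(2) in_ball]) (use a b t in auto)
    moreover have "V (z a) \<le> M" using M[of "z a"] a by (simp add: \<phi>_def)
    moreover have "M < V (z b)" using d(2)[of "z b"] b(3) \<delta>1 \<delta> by (auto simp: \<phi>_def)
    ultimately show False by simp
  qed
  then show ?thesis using \<delta>(1) by blast
qed

lemma stable: "lyapunov_stable f p"
  unfolding lyapunov_stable_def
proof (intro allI impI)
  fix \<epsilon> :: real assume "\<epsilon> > 0"
  then have \<epsilon>r: "0 < min \<epsilon> r" using r_pos by simp
  from confined[OF refl this min.cobounded2]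
  show "\<exists>\<delta>>0. \<forall>T\<ge>0. \<forall>z. solves_on f z {0..T} \<longrightarrow> dist (z 0) p < \<delta> \<longrightarrow> (\<forall>t\<in>{0..T}. dist (z t) p < \<epsilon>)"
    by auto
qed

text \<open>Composing \<open>f\<close> with the nearest point projection onto the ball gives a
  bounded, globally Lipschitz field. Its solutions from points near \<open>p\<close> are global and
  by \<open>confined\<close> stay in the ball, where the two fields agree.\<close>

lemma solution_exists:
  obtains \<delta> where "\<delta> > 0" "\<And>z0. dist z0 p < \<delta> \<Longrightarrow> \<exists>z. solves_on f z {0..} \<and> z 0 = z0"
proof -
  define \<pi> where "\<pi> = closest_point (cball p r)"
  have ball: "convex (cball p r)" "closed (cball p r)" "cball p r \<noteq> {}" using r_pos by auto
  have \<pi>_in: "\<pi> x \<in> cball p r" for x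
    unfolding \<pi>_def using closest_point_in_set[OF ball(2,3)] .
  have lip_\<pi>: "1-lipschitz_on UNIV \<pi>"
    unfolding \<pi>_def using closest_point_lipschitz[OF ball] by (auto simp: lipschitz_on_def)
  define g where "g = (\<lambda>x. f (\<pi> x))"
  have gf: "g x = f x" if "x \<in> cball p r" for x
    using that unfolding g_def \<pi>_def by (simp add: closest_point_self)
  have "(L * 1)-lipschitz_on UNIV (\<lambda>x. f (\<pi> x))"
    using lip lip_\<pi> \<pi>_in by (intro lipschitz_on_compose2 lipschitz_on_subset[OF lip]) auto
  then have g_lip: "L-lipschitz_on UNIV g" by (simp add: g_def)
  have "compact (f ` cball p r)"
    using lipschitz_on_continuous_on[OF lip] by (intro compact_continuous_image) auto
  from compact_imp_bounded[OF this] obtain B where "\<And>y. y \<in> f ` cball p r \<Longrightarrow> norm y \<le> B"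
    unfolding bounded_iff by blast
  then have g_bdd: "norm (g x) \<le> B" for x using \<pi>_in by (auto simp: g_def)
  obtain \<delta> where \<delta>: "0 < \<delta>" "\<And>T z. solves_on g z {0..T} \<Longrightarrow> dist (z 0) p < \<delta> \<Longrightarrow> \<forall>t\<in>{0..T}. dist (z t) p < r"
    using confined[OF gf r_pos order_refl] by blast
  have "\<exists>z. solves_on f z {0..} \<and> z 0 = z0" if "dist z0 p < \<delta>" for z0
  proof -
    obtain z where z: "solves_on g z {0..}" "z 0 = z0" by (rule global_solution[OF g_lip g_bdd])
    have "dist (z t) p < r" if "t \<ge> 0" for t
      using \<delta>(2)[OF solves_on_subset[OF z(1), of "{0..t}"]] that z(2) \<open>dist z0 p < \<delta>\<close> by auto
    then have "g (z t) = f (z t)" if "t \<ge> 0" for t using that by (intro gf) (auto simp: dist_commute less_imp_le)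
    then have "solves_on f z {0..}" using z(1) unfolding solves_on_def by simp
    then show ?thesis using z(2) by blast
  qed
  then show ?thesis by (rule that[OF \<delta>(1)])
qed

text \<open>A solution that never comes \<open>\<delta>\<close>-close to \<open>p\<close> stays in a
  compact annulus, on which \<open>V\<close> is bounded although it grows there at a positive
  uniform rate. Once it has come close, \<open>confined\<close> applies to the time-shifted
  solution.\<close>

lemma solution_tendsto:
  assumes sol: "solves_on f z {0..}" and in_ball: "\<And>t. t \<ge> 0 \<Longrightarrow> dist (z t) p \<le> r"
  shows "(z \<longlongrightarrow> p) at_top"
proof (rule tendstoI)
  fix \<epsilon> :: real assume "\<epsilon> > 0"
  then have \<epsilon>r: "0 < min \<epsilon> r" using r_pos by simp
  obtain \<delta> where \<delta>: "0 < \<delta>" "\<And>T z. solves_on f z {0..T} \<Longrightarrow> dist (z 0) p < \<delta> \<Longrightarrow> \<forall>t\<in>{0..T}. dist (z t) p < min \<epsilon> r"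
    using confined[OF refl \<epsilon>r min.cobounded2] by blast
  have "\<exists>t0\<ge>0. dist (z t0) p < \<delta>"
  proof (rule ccontr)
    assume "\<not> (\<exists>t0\<ge>0. dist (z t0) p < \<delta>)"
    then have far: "\<delta> \<le> dist (z t) p" if "t \<ge> 0" for t using that by force
    define K where "K = cball p r - ball p \<delta>"
    have K: "compact K" "K \<subseteq> cball p r - {p}" using \<delta> by (auto simp: K_def compact_diff)
    have zK: "z t \<in> K" if "t \<ge> 0" for t
      using far[OF that] in_ball[OF that] by (auto simp: K_def dist_commute)
    then have "K \<noteq> {}" using zK[of 0] by auto
    obtain x0 where x0: "x0 \<in> K" "\<And>x. x \<in> K \<Longrightarrow> D x0 \<le> D x"
      using continuous_attains_inf[OF K(1) \<open>K \<noteq> {}\<close> continuous_on_subset[OF D_cont K(2)]] by blast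
    define c where "c = D x0"
    have c: "c > 0" "\<And>x. x \<in> K \<Longrightarrow> c \<le> D x"
      using D_pos[of x0] x0 K(2) unfolding c_def by blast+
    obtain x1 where M: "\<And>x. x \<in> K \<Longrightarrow> V x \<le> V x1"
      using continuous_attains_sup[OF K(1) \<open>K \<noteq> {}\<close> V_cont[OF K(2)]] by blast
    define M where "M = V x1"
    note M = M[folded M_def]
    define T where "T = (\<bar>M - V (z 0)\<bar> + 1) / c"
    have T: "T \<ge> 0" using c by (simp add: T_def)
    have "V (z 0) + c * (T - 0) \<le> V (z T)"
    proof (rule V_growth[OF refl sol])
      fix t assume "t \<in> {0..T}"
      then have "z t \<in> K" using zK by simp
      then show "z t \<in> cball p r - {p} \<and> c \<le> D (z t)" using K(2) c(2) by blast
    qed (use T in auto)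
    moreover have "c * (T - 0) = \<bar>M - V (z 0)\<bar> + 1" using c by (simp add: T_def)
    moreover have "V (z T) \<le> M" using M zK T by blast
    ultimately show False by linarith
  qed
  then obtain t0 where t0: "t0 \<ge> 0" "dist (z t0) p < \<delta>" by blast
  have "dist (z t) p < \<epsilon>" if "t \<ge> t0" for t
  proof -
    have "solves_on f (\<lambda>t. z (t0 + t)) {0..t - t0}"
      using solves_on_shift[OF sol t0(1)] by (rule solves_on_subset) auto
    from bspec[OF \<delta>(2)[OF this], of "t - t0"] t0(2) that show ?thesis by simp
  qed
  then show "eventually (\<lambda>t. dist (z t) p < \<epsilon>) at_top"
    unfolding eventually_at_top_linorder by blast
qed

theorem asymptotically_stable: "asymptotically_stable f p"
proof -
  obtain \<delta>1 where \<delta>1: "\<delta>1 > 0" "\<And>z0. dist z0 p < \<delta>1 \<Longrightarrow> \<exists>z. solves_on f z {0..} \<and> z 0 = z0"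
    using solution_exists by blast
  obtain \<delta>2 where \<delta>2: "0 < \<delta>2" "\<And>T z. solves_on f z {0..T} \<Longrightarrow> dist (z 0) p < \<delta>2 \<Longrightarrow> \<forall>t\<in>{0..T}. dist (z t) p < r"
    using confined[OF refl r_pos order_refl] by blast
  have "(z \<longlongrightarrow> p) at_top" if sol: "solves_on f z {0..}" and "dist (z 0) p < \<delta>2" for z
  proof (rule solution_tendsto[OF sol])
    fix t :: real assume "t \<ge> 0"
    then show "dist (z t) p \<le> r"
      using \<delta>2(2)[OF solves_on_subset[OF sol, of "{0..t}"]] that by force
  qed
  then have "locally_attractive f p"
    unfolding locally_attractive_def using \<delta>1 \<delta>2(1)
    by (intro exI[of _ "min \<delta>1 \<delta>2"]) auto
  then show ?thesis unfolding asymptotically_stable_def equilibrium_def using equil stable by simp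
qed

end

section \<open>Quasihomogeneous functions\<close>

locale hamiltonian =
  fixes l :: nat
  assumes l_pos: "1 \<le> l"
begin

definition H :: "real \<times> real \<Rightarrow> real" where
  "H z = fst z ^ 2 / 2 + snd z ^ (2 * l) / (2 * real l)"

text \<open>\<open>Z\<close> has weighted degree \<open>w\<close> (Euler's identity) and \<open>D\<close> is its derivative along the
  Hamiltonian field of \<open>H\<close>. The origin is excluded, so real powers of \<open>H\<close> are admitted.\<close>

definition quasihom :: "real \<Rightarrow> (real \<times> real \<Rightarrow> real) \<Rightarrow> (real \<times> real \<Rightarrow> real) \<Rightarrow> bool" where
  "quasihom w Z D \<longleftrightarrow>
     (\<forall>z. z \<noteq> 0 \<longrightarrow> (\<exists>a b. (Z has_derivative (\<lambda>h. a * fst h + b * snd h)) (at z) \<and>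
        D z = a * snd z ^ (2 * l - 1) - b * fst z \<and> real l * fst z * a + snd z * b = w * Z z)) \<and>
     (\<exists>C. \<forall>z. z \<noteq> 0 \<longrightarrow> \<bar>Z z\<bar> \<le> C * H z powr (w / (2 * real l)) \<and>
        \<bar>D z\<bar> \<le> C * H z powr ((w + real l - 1) / (2 * real l)))"

lemma H_nonneg: "H z \<ge> 0"
  unfolding H_def by (intro add_nonneg_nonneg divide_nonneg_nonneg zero_le_even_power) auto

lemma H_pos:
  assumes "z \<noteq> 0" shows "H z > 0"
proof (cases "fst z = 0")
  case True
  then have "snd z \<noteq> 0" using assms by (simp add: prod_eq_iff)
  then have "snd z ^ (2 * l) > 0" by (simp add: zero_less_power_eq)
  then show ?thesis using True l_pos by (simp add: H_def)
next
  case False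
  then have "fst z ^ 2 / 2 > 0" by simp
  moreover have "snd z ^ (2 * l) / (2 * real l) \<ge> 0" by (intro divide_nonneg_nonneg zero_le_even_power) auto
  ultimately show ?thesis unfolding H_def by linarith
qed

lemma quasihomI:
  assumes "\<And>z. z \<noteq> 0 \<Longrightarrow> (\<exists>a b. (Z has_derivative (\<lambda>h. a * fst h + b * snd h)) (at z) \<and>
        D z = a * snd z ^ (2 * l - 1) - b * fst z \<and> real l * fst z * a + snd z * b = w * Z z)"
    and "\<And>z. z \<noteq> 0 \<Longrightarrow> \<bar>Z z\<bar> \<le> C1 * H z powr (w / (2 * real l))"
    and "\<And>z. z \<noteq> 0 \<Longrightarrow> \<bar>D z\<bar> \<le> C2 * H z powr ((w + real l - 1) / (2 * real l))"
  shows "quasihom w Z D"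
proof -
  have "\<bar>Z z\<bar> \<le> max C1 C2 * H z powr (w / (2 * real l)) \<and>
        \<bar>D z\<bar> \<le> max C1 C2 * H z powr ((w + real l - 1) / (2 * real l))" if z: "z \<noteq> 0" for z
  proof -
    have "C1 * H z powr (w / (2 * real l)) \<le> max C1 C2 * H z powr (w / (2 * real l))"
      "C2 * H z powr ((w + real l - 1) / (2 * real l)) \<le> max C1 C2 * H z powr ((w + real l - 1) / (2 * real l))"
      by (intro mult_right_mono; simp)+
    then show ?thesis using assms(2,3)[OF z] by linarith
  qed
  then show ?thesis unfolding quasihom_def using assms(1) by blast
qed

lemma quasihom_deriv:
  assumes "quasihom w Z D" "z \<noteq> 0"
  obtains a b where "(Z has_derivative (\<lambda>h. a * fst h + b * snd h)) (at z)"
    "D z = a * snd z ^ (2 * l - 1) - b * fst z" "real l * fst z * a + snd z * b = w * Z z"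
  using assms unfolding quasihom_def by blast

lemma quasihom_bound:
  assumes "quasihom w Z D"
  obtains C where "0 \<le> C" "\<forall>z. z \<noteq> 0 \<longrightarrow> \<bar>Z z\<bar> \<le> C * H z powr (w / (2 * real l))"
    "\<forall>z. z \<noteq> 0 \<longrightarrow> \<bar>D z\<bar> \<le> C * H z powr ((w + real l - 1) / (2 * real l))"
proof -
  obtain C where C: "\<And>z. z \<noteq> 0 \<Longrightarrow> \<bar>Z z\<bar> \<le> C * H z powr (w / (2 * real l))"
    "\<And>z. z \<noteq> 0 \<Longrightarrow> \<bar>D z\<bar> \<le> C * H z powr ((w + real l - 1) / (2 * real l))"
    using assms unfolding quasihom_def by blast
  have z1: "((1, 0)::real\<times>real) \<noteq> 0" by (simp add: zero_prod_def)
  have "0 \<le> C * H (1, 0) powr (w / (2 * real l))"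
    using C(1)[OF z1] by linarith
  then have "0 \<le> C" using H_pos[OF z1] by (simp add: zero_le_mult_iff)
  then show ?thesis using that C by blast
qed

lemma quasihom_add:
  assumes "quasihom w Z D" "quasihom w Z' D'"
  shows "quasihom w (\<lambda>z. Z z + Z' z) (\<lambda>z. D z + D' z)"
proof -
  obtain C where C: "0 \<le> C" "\<forall>z. z \<noteq> 0 \<longrightarrow> \<bar>Z z\<bar> \<le> C * H z powr (w / (2 * real l))"
    "\<forall>z. z \<noteq> 0 \<longrightarrow> \<bar>D z\<bar> \<le> C * H z powr ((w + real l - 1) / (2 * real l))"
    using assms(1) by (rule quasihom_bound)
  obtain C' where C': "0 \<le> C'" "\<forall>z. z \<noteq> 0 \<longrightarrow> \<bar>Z' z\<bar> \<le> C' * H z powr (w / (2 * real l))"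
    "\<forall>z. z \<noteq> 0 \<longrightarrow> \<bar>D' z\<bar> \<le> C' * H z powr ((w + real l - 1) / (2 * real l))"
    using assms(2) by (rule quasihom_bound)
  show ?thesis
  proof (rule quasihomI[of _ _ _ "C + C'" "C + C'"])
    fix z :: "real \<times> real" assume z: "z \<noteq> 0"
    obtain a b where 1: "(Z has_derivative (\<lambda>h. a * fst h + b * snd h)) (at z)"
      "D z = a * snd z ^ (2 * l - 1) - b * fst z" "real l * fst z * a + snd z * b = w * Z z"
      using assms(1) z by (rule quasihom_deriv)
    obtain a' b' where 2: "(Z' has_derivative (\<lambda>h. a' * fst h + b' * snd h)) (at z)"
      "D' z = a' * snd z ^ (2 * l - 1) - b' * fst z" "real l * fst z * a' + snd z * b' = w * Z' z"
      using assms(2) z by (rule quasihom_deriv)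
    have "((\<lambda>z. Z z + Z' z) has_derivative (\<lambda>h. (a + a') * fst h + (b + b') * snd h)) (at z)"
      using has_derivative_add[OF 1(1) 2(1)] by (simp add: algebra_simps)
    then show "\<exists>a b. ((\<lambda>z. Z z + Z' z) has_derivative (\<lambda>h. a * fst h + b * snd h)) (at z) \<and>
        D z + D' z = a * snd z ^ (2 * l - 1) - b * fst z \<and> real l * fst z * a + snd z * b = w * (Z z + Z' z)"
      using 1 2 by (intro exI[of _ "a + a'"] exI[of _ "b + b'"]) (auto simp: algebra_simps)
    show "\<bar>Z z + Z' z\<bar> \<le> (C + C') * H z powr (w / (2 * real l))"
      using C(2)[rule_format, OF z] C'(2)[rule_format, OF z] abs_triangle_ineq[of "Z z" "Z' z"] by (simp add: algebra_simps)
    show "\<bar>D z + D' z\<bar> \<le> (C + C') * H z powr ((w + real l - 1) / (2 * real l))"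
      using C(3)[rule_format, OF z] C'(3)[rule_format, OF z] abs_triangle_ineq[of "D z" "D' z"] by (simp add: algebra_simps)
  qed
qed

lemma quasihom_mult:
  assumes "quasihom w Z D" "quasihom w' Z' D'"
  shows "quasihom (w + w') (\<lambda>z. Z z * Z' z) (\<lambda>z. D z * Z' z + Z z * D' z)"
proof -
  obtain C where C: "0 \<le> C" "\<forall>z. z \<noteq> 0 \<longrightarrow> \<bar>Z z\<bar> \<le> C * H z powr (w / (2 * real l))"
    "\<forall>z. z \<noteq> 0 \<longrightarrow> \<bar>D z\<bar> \<le> C * H z powr ((w + real l - 1) / (2 * real l))"
    using assms(1) by (rule quasihom_bound)
  obtain C' where C': "0 \<le> C'" "\<forall>z. z \<noteq> 0 \<longrightarrow> \<bar>Z' z\<bar> \<le> C' * H z powr (w' / (2 * real l))"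
    "\<forall>z. z \<noteq> 0 \<longrightarrow> \<bar>D' z\<bar> \<le> C' * H z powr ((w' + real l - 1) / (2 * real l))"
    using assms(2) by (rule quasihom_bound)
  show ?thesis
  proof (rule quasihomI[of _ _ _ "C * C'" "C * C' + C * C'"])
    fix z :: "real \<times> real" assume z: "z \<noteq> 0"
    obtain a b where 1: "(Z has_derivative (\<lambda>h. a * fst h + b * snd h)) (at z)"
      "D z = a * snd z ^ (2 * l - 1) - b * fst z" "real l * fst z * a + snd z * b = w * Z z"
      using assms(1) z by (rule quasihom_deriv)
    obtain a' b' where 2: "(Z' has_derivative (\<lambda>h. a' * fst h + b' * snd h)) (at z)"
      "D' z = a' * snd z ^ (2 * l - 1) - b' * fst z" "real l * fst z * a' + snd z * b' = w' * Z' z"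
      using assms(2) z by (rule quasihom_deriv)
    have "((\<lambda>z. Z z * Z' z) has_derivative (\<lambda>h. (Z z * a' + a * Z' z) * fst h + (Z z * b' + b * Z' z) * snd h)) (at z)"
      using has_derivative_mult[OF 1(1) 2(1)] by (simp add: algebra_simps)
    moreover have "D z * Z' z + Z z * D' z = (Z z * a' + a * Z' z) * snd z ^ (2 * l - 1) - (Z z * b' + b * Z' z) * fst z"
      unfolding 1(2) 2(2) by (simp add: algebra_simps)
    moreover have "real l * fst z * (Z z * a' + a * Z' z) + snd z * (Z z * b' + b * Z' z) = (w + w') * (Z z * Z' z)"
    proof -
      have "real l * fst z * (Z z * a' + a * Z' z) + snd z * (Z z * b' + b * Z' z) =
        Z z * (real l * fst z * a' + snd z * b') + Z' z * (real l * fst z * a + snd z * b)"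
        by (simp add: algebra_simps)
      then show ?thesis unfolding 1(3) 2(3) by (simp add: algebra_simps)
    qed
    ultimately show "\<exists>a b. ((\<lambda>z. Z z * Z' z) has_derivative (\<lambda>h. a * fst h + b * snd h)) (at z) \<and>
        D z * Z' z + Z z * D' z = a * snd z ^ (2 * l - 1) - b * fst z \<and> real l * fst z * a + snd z * b = (w + w') * (Z z * Z' z)"
      by blast
    have prod: "\<bar>A * B\<bar> \<le> C * C' * H z powr r"
      if "\<bar>A\<bar> \<le> C * H z powr p" "\<bar>B\<bar> \<le> C' * H z powr q" "r = p + q" for A B p q r
    proof -
      have "\<bar>A\<bar> * \<bar>B\<bar> \<le> (C * H z powr p) * (C' * H z powr q)"
        using that C(1) by (intro mult_mono) auto
      then show ?thesis unfolding that(3) by (simp add: abs_mult powr_add mult_ac)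
    qed
    show "\<bar>Z z * Z' z\<bar> \<le> C * C' * H z powr ((w + w') / (2 * real l))"
      by (rule prod[OF C(2)[rule_format, OF z] C'(2)[rule_format, OF z]]) (simp add: add_divide_distrib)
    have "\<bar>D z * Z' z\<bar> \<le> C * C' * H z powr ((w + w' + real l - 1) / (2 * real l))"
      by (rule prod[OF C(3)[rule_format, OF z] C'(2)[rule_format, OF z]]) (simp add: add_divide_distrib diff_divide_distrib)
    moreover have "\<bar>Z z * D' z\<bar> \<le> C * C' * H z powr ((w + w' + real l - 1) / (2 * real l))"
      by (rule prod[OF C(2)[rule_format, OF z] C'(3)[rule_format, OF z]]) (simp add: add_divide_distrib diff_divide_distrib)
    ultimately show "\<bar>D z * Z' z + Z z * D' z\<bar> \<le> (C * C' + C * C') * H z powr ((w + w' + real l - 1) / (2 * real l))"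
      by (simp add: algebra_simps)
  qed
qed

lemma quasihom_const: "quasihom 0 (\<lambda>z. c) (\<lambda>z. 0)"
  by (rule quasihomI[of _ _ _ "\<bar>c\<bar>" 0])
     (auto intro!: exI[of _ 0] derivative_eq_intros dest: H_pos)

lemma quasihom_cmult:
  assumes "quasihom w Z D"
  shows "quasihom w (\<lambda>z. c * Z z) (\<lambda>z. c * D z)"
  using quasihom_mult[OF quasihom_const assms, of c] by simp

lemma quasihom_cong:
  assumes "quasihom w Z D" "\<And>z. Z z = Z' z" "\<And>z. D z = D' z" "w = w'"
  shows "quasihom w' Z' D'"
proof -
  have "Z = Z'" "D = D'" using assms(2,3) by auto
  then show ?thesis using assms(1,4) by simp
qed

lemma quasihom_power:
  assumes "quasihom w Z D"
  shows "quasihom (real n * w) (\<lambda>z. Z z ^ n) (\<lambda>z. real n * Z z ^ (n - 1) * D z)"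
proof (induction n)
  case 0
  then show ?case using quasihom_const[of 1] by simp
next
  case (Suc n)
  show ?case
  proof (rule quasihom_cong[OF quasihom_mult[OF assms Suc]])
    show "D z * Z z ^ n + Z z * (real n * Z z ^ (n - 1) * D z) = real (Suc n) * Z z ^ (Suc n - 1) * D z" for z
      by (cases n) (auto simp: algebra_simps)
  qed (auto simp: algebra_simps)
qed

lemma quasihom_fst: "quasihom (real l) fst (\<lambda>z. snd z ^ (2 * l - 1))"
  and quasihom_snd: "quasihom 1 snd (\<lambda>z. - fst z)"
proof -
  have x: "\<bar>fst z\<bar> \<le> sqrt 2 * H z powr (1/2)" for z
  proof -
    have "fst z ^ 2 \<le> 2 * H z" unfolding H_def
      using zero_le_even_power[of "2 * l" "snd z"] by simp
    then have "sqrt (fst z ^ 2) \<le> sqrt (2 * H z)" by (rule real_sqrt_le_mono)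
    then show ?thesis using H_nonneg[of z] by (simp add: real_sqrt_mult powr_half_sqrt)
  qed
  have y: "\<bar>snd z\<bar> \<le> (2 * real l) powr (1 / (2 * real l)) * H z powr (1 / (2 * real l))" for z
  proof (cases "snd z = 0")
    case False
    have "\<bar>snd z\<bar> powr (2 * real l) = \<bar>snd z\<bar> ^ (2 * l)"
      using False by (simp add: powr_realpow[symmetric])
    also have "\<dots> = snd z ^ (2 * l)" by (rule power_even_abs) simp
    also have "\<dots> \<le> 2 * real l * H z" unfolding H_def using l_pos by (simp add: distrib_left)
    finally have "(\<bar>snd z\<bar> powr (2 * real l)) powr (1 / (2 * real l)) \<le> (2 * real l * H z) powr (1 / (2 * real l))"
      by (intro powr_mono2) auto
    then show ?thesis using l_pos H_nonneg[of z] by (simp add: powr_powr powr_mult)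
  qed simp
  have yn: "\<bar>snd z ^ (2 * l - 1)\<bar> \<le> ((2 * real l) powr (1 / (2 * real l))) ^ (2 * l - 1) * H z powr ((2 * real l - 1) / (2 * real l))"
    if "z \<noteq> 0" for z
  proof -
    have "\<bar>snd z\<bar> ^ (2 * l - 1) \<le> ((2 * real l) powr (1 / (2 * real l)) * H z powr (1 / (2 * real l))) ^ (2 * l - 1)"
      using y by (intro power_mono) auto
    also have "\<dots> = ((2 * real l) powr (1 / (2 * real l))) ^ (2 * l - 1) * (H z powr (1 / (2 * real l))) ^ (2 * l - 1)"
      by (rule power_mult_distrib)
    also have "(H z powr (1 / (2 * real l))) ^ (2 * l - 1) = H z powr ((2 * real l - 1) / (2 * real l))"
      using H_pos[OF that] l_pos by (simp add: powr_powr powr_realpow[symmetric] of_nat_diff)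
    finally show ?thesis by (simp add: power_abs)
  qed
  show "quasihom (real l) fst (\<lambda>z. snd z ^ (2 * l - 1))"
  proof (rule quasihomI)
    fix z :: "real \<times> real" assume z: "z \<noteq> 0"
    show "\<exists>a b. (fst has_derivative (\<lambda>h. a * fst h + b * snd h)) (at z) \<and>
        snd z ^ (2 * l - 1) = a * snd z ^ (2 * l - 1) - b * fst z \<and> real l * fst z * a + snd z * b = real l * fst z"
      by (intro exI[of _ 1] exI[of _ 0]) (auto intro!: derivative_eq_intros)
    show "\<bar>fst z\<bar> \<le> sqrt 2 * H z powr (real l / (2 * real l))" using x[of z] l_pos by simp
    show "\<bar>snd z ^ (2 * l - 1)\<bar> \<le> ((2 * real l) powr (1 / (2 * real l))) ^ (2 * l - 1) * H z powr ((real l + real l - 1) / (2 * real l))"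
      using yn[OF z] by simp
  qed
  show "quasihom 1 snd (\<lambda>z. - fst z)"
  proof (rule quasihomI)
    fix z :: "real \<times> real" assume z: "z \<noteq> 0"
    show "\<exists>a b. (snd has_derivative (\<lambda>h. a * fst h + b * snd h)) (at z) \<and>
        - fst z = a * snd z ^ (2 * l - 1) - b * fst z \<and> real l * fst z * a + snd z * b = 1 * snd z"
      by (intro exI[of _ 0] exI[of _ 1]) (auto intro!: derivative_eq_intros)
    show "\<bar>snd z\<bar> \<le> (2 * real l) powr (1 / (2 * real l)) * H z powr (1 / (2 * real l))" by (rule y)
    show "\<bar>- fst z\<bar> \<le> sqrt 2 * H z powr ((1 + real l - 1) / (2 * real l))" using x[of z] l_pos by simp
  qed
qed

definition u :: "real \<times> real \<Rightarrow> real" where "u z = fst z ^ 2 / 2"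
definition v :: "real \<times> real \<Rightarrow> real" where "v z = snd z ^ (2 * l) / (2 * real l)"

lemma H_eq: "H z = u z + v z"
  by (simp add: H_def u_def v_def)

lemma v_eq: "snd z * snd z ^ (2 * l - 1) = 2 * real l * v z"
  using l_pos by (simp add: v_def power_Suc[symmetric] del: power_Suc)

lemma quasihom_u: "quasihom (2 * real l) u (\<lambda>z. fst z * snd z ^ (2 * l - 1))"
  by (rule quasihom_cong[OF quasihom_cmult[OF quasihom_power[OF quasihom_fst, of 2], of "1/2"]]) (auto simp: u_def)

lemma quasihom_v: "quasihom (2 * real l) v (\<lambda>z. - (fst z * snd z ^ (2 * l - 1)))"
  by (rule quasihom_cong[OF quasihom_cmult[OF quasihom_power[OF quasihom_snd, of "2 * l"], of "1 / (2 * real l)"]])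
     (use l_pos in \<open>auto simp: v_def\<close>)

lemma quasihom_H: "quasihom (2 * real l) H (\<lambda>z. 0)"
  by (rule quasihom_cong[OF quasihom_add[OF quasihom_u quasihom_v]]) (auto simp: H_eq)

lemma quasihom_H_powr: "quasihom (2 * real l * g) (\<lambda>z. H z powr g) (\<lambda>z. 0)"
proof (rule quasihomI[of _ _ _ 1 0])
  fix z :: "real \<times> real" assume z: "z \<noteq> 0"
  obtain a b where 1: "(H has_derivative (\<lambda>h. a * fst h + b * snd h)) (at z)"
      "0 = a * snd z ^ (2 * l - 1) - b * fst z" "real l * fst z * a + snd z * b = 2 * real l * H z"
    using quasihom_H z by (rule quasihom_deriv)
  define c where "c = g * H z powr (g - 1)"
  have "((\<lambda>t. t powr g) has_real_derivative c) (at (H z))"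
    unfolding c_def using H_pos[OF z] by (auto intro!: derivative_eq_intros)
  then have "((\<lambda>t. t powr g) has_derivative (*) c) (at (H z))"
    by (simp add: has_field_derivative_def)
  from has_derivative_compose[OF 1(1) this]
  have "((\<lambda>z. H z powr g) has_derivative (\<lambda>h. (c * a) * fst h + (c * b) * snd h)) (at z)"
    by (simp add: algebra_simps)
  moreover have "0 = (c * a) * snd z ^ (2 * l - 1) - (c * b) * fst z"
  proof -
    have "(c * a) * snd z ^ (2 * l - 1) - (c * b) * fst z = c * (a * snd z ^ (2 * l - 1) - b * fst z)"
      by (simp add: algebra_simps)
    then show ?thesis using 1(2) by simp
  qed
  moreover have "real l * fst z * (c * a) + snd z * (c * b) = 2 * real l * g * H z powr g"
  proof -
    have "real l * fst z * (c * a) + snd z * (c * b) = c * (2 * real l * H z)"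
      unfolding 1(3)[symmetric] by (simp add: algebra_simps)
    also have "H z powr (g - 1) * H z = H z powr g"
      using H_pos[OF z] by (simp add: powr_diff)
    then have "c * (2 * real l * H z) = 2 * real l * g * H z powr g" by (simp add: c_def mult_ac)
    finally show ?thesis .
  qed
  ultimately show "\<exists>a b. ((\<lambda>z. H z powr g) has_derivative (\<lambda>h. a * fst h + b * snd h)) (at z) \<and>
        0 = a * snd z ^ (2 * l - 1) - b * fst z \<and> real l * fst z * a + snd z * b = 2 * real l * g * H z powr g"
    by blast
qed (use l_pos in auto)

lemma quasihom_zero: "quasihom w (\<lambda>z. 0) (\<lambda>z. 0)"
proof -
  have "2 * real l * (w / (2 * real l)) = w" using l_pos by simp
  then show ?thesis using quasihom_cmult[OF quasihom_H_powr[of "w / (2 * real l)"], of 0] by simp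
qed

section \<open>Primitives of monomials along the Hamiltonian field\<close>

text \<open>Since \<open>x^2 = 2 * u\<close> and \<open>y^(2l) = 2 * l * v\<close>, differentiating
  a monomial along \<open>X\<close> gives only two neighbours, which differ by one factor
  \<open>u\<close> traded for \<open>v\<close>. The case \<open>(i, j) = (0, 0)\<close> yields
  \<open>W\<close>, \<open>(1, 1)\<close> the odd primitives, and \<open>(0, 2)\<close>,
  \<open>(2, 2)\<close> the averages.\<close>

lemma quasihom_monomial:
  "quasihom (real l * real (Suc i) + real (Suc j) + 2 * real l * real (a + b))
     (\<lambda>z. fst z ^ Suc i * snd z ^ Suc j * u z ^ a * v z ^ b)
     (\<lambda>z. fst z ^ i * snd z ^ j * (2 * real l * (real (Suc i) + 2 * real a) * (u z ^ a * v z ^ Suc b)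
        - 2 * (real (Suc j) + 2 * real l * real b) * (u z ^ Suc a * v z ^ b)))"
proof (rule quasihom_cong[OF quasihom_mult[OF quasihom_mult[OF quasihom_mult[OF
      quasihom_power[OF quasihom_fst, of "Suc i"] quasihom_power[OF quasihom_snd, of "Suc j"]]
      quasihom_power[OF quasihom_u, of a]] quasihom_power[OF quasihom_v, of b]]])
  fix z :: "real \<times> real"
  define x y q U W where "x = fst z" and "y = snd z" and "q = y ^ (2 * l - 1)" and "U = u z" and "W = v z"
  have xx: "x * x = 2 * U" by (simp add: x_def U_def u_def power2_eq_square)
  have yq: "y * q = 2 * real l * W" using v_eq[of z] by (simp add: y_def q_def W_def)
  \<comment> \<open>For \<open>a = 0\<close> the truncated exponent is harmless because of the
    factor \<open>real a\<close>.\<close>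
  have da: "real a * U ^ (a - 1) * U = real a * U ^ a" by (cases a) auto
  have db: "real b * W ^ (b - 1) * W = real b * W ^ b" by (cases b) auto
  have "((real (Suc i) * x ^ i * q * y ^ Suc j + x ^ Suc i * (real (Suc j) * y ^ j * - x)) * U ^ a +
       x ^ Suc i * y ^ Suc j * (real a * U ^ (a - 1) * (x * q))) * W ^ b +
       x ^ Suc i * y ^ Suc j * U ^ a * (real b * W ^ (b - 1) * - (x * q))
     = x ^ i * y ^ j * (real (Suc i) * (y * q) * (U ^ a * W ^ b) - real (Suc j) * (x * x) * (U ^ a * W ^ b)
        + (real a * U ^ (a - 1)) * (x * x) * (y * q) * W ^ b - (real b * W ^ (b - 1)) * (x * x) * (y * q) * U ^ a)"
    by (simp add: algebra_simps)
  also have "(real a * U ^ (a - 1)) * (x * x) * (y * q) * W ^ b = 2 * (2 * real l) * (real a * U ^ (a - 1) * U) * (W * W ^ b)"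
    unfolding xx yq by (simp add: mult_ac)
  also have "(real b * W ^ (b - 1)) * (x * x) * (y * q) * U ^ a = 2 * (2 * real l) * (real b * W ^ (b - 1) * W) * (U * U ^ a)"
    unfolding xx yq by (simp add: mult_ac)
  finally have "((real (Suc i) * x ^ i * q * y ^ Suc j + x ^ Suc i * (real (Suc j) * y ^ j * - x)) * U ^ a +
       x ^ Suc i * y ^ Suc j * (real a * U ^ (a - 1) * (x * q))) * W ^ b +
       x ^ Suc i * y ^ Suc j * U ^ a * (real b * W ^ (b - 1) * - (x * q))
     = x ^ i * y ^ j * (2 * real l * (real (Suc i) + 2 * real a) * (U ^ a * W ^ Suc b)
        - 2 * (real (Suc j) + 2 * real l * real b) * (U ^ Suc a * W ^ b))"
    unfolding da db xx yq by (simp add: algebra_simps)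
  then show "((real (Suc i) * fst z ^ (Suc i - 1) * snd z ^ (2 * l - 1) * snd z ^ Suc j +
         fst z ^ Suc i * (real (Suc j) * snd z ^ (Suc j - 1) * - fst z)) * u z ^ a +
        fst z ^ Suc i * snd z ^ Suc j * (real a * u z ^ (a - 1) * (fst z * snd z ^ (2 * l - 1)))) * v z ^ b +
       fst z ^ Suc i * snd z ^ Suc j * u z ^ a * (real b * v z ^ (b - 1) * - (fst z * snd z ^ (2 * l - 1))) =
       fst z ^ i * snd z ^ j * (2 * real l * (real (Suc i) + 2 * real a) * (u z ^ a * v z ^ Suc b)
        - 2 * (real (Suc j) + 2 * real l * real b) * (u z ^ Suc a * v z ^ b))"
    unfolding x_def y_def q_def U_def W_def by simp
qed (auto simp: algebra_simps)

lemma quasihom_sum: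
  assumes "\<And>i. i \<in> S \<Longrightarrow> quasihom w (Z i) (D i)"
  shows "quasihom w (\<lambda>z. \<Sum>i\<in>S. Z i z) (\<lambda>z. \<Sum>i\<in>S. D i z)"
  using assms
proof (induction S rule: infinite_finite_induct)
  case (insert i S)
  then show ?case using quasihom_add[of w "Z i" "D i"] by simp
qed (simp_all add: quasihom_zero)

text \<open>The algebraic form of the reflection symmetry. One factor \<open>u\<close> at a time is
  traded for \<open>v\<close>, down to \<open>x y v^b\<close>, which is a multiple of the derivative
  of \<open>y^2 v^b\<close>.\<close>

lemma ex_quasihom_odd:
  "\<exists>Z. quasihom (2 + 2 * real l * real (a + b)) Z (\<lambda>z. fst z * snd z * u z ^ a * v z ^ b)"
proof (induction a arbitrary: b)
  case 0
  have "quasihom (real 2 * 1 + real b * (2 * real l)) (\<lambda>z. snd z ^ 2 * v z ^ b)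
     (\<lambda>z. real 2 * snd z ^ (2 - 1) * - fst z * v z ^ b + snd z ^ 2 * (real b * v z ^ (b - 1) * - (fst z * snd z ^ (2 * l - 1))))"
    by (intro quasihom_mult quasihom_power quasihom_snd quasihom_v)
  from quasihom_cmult[OF this, of "- 1 / (2 + 2 * real l * real b)"]
  have "quasihom (2 + 2 * real l * real (0 + b)) (\<lambda>z. - 1 / (2 + 2 * real l * real b) * (snd z ^ 2 * v z ^ b))
     (\<lambda>z. fst z * snd z * u z ^ 0 * v z ^ b)"
  proof (rule quasihom_cong)
    fix z
    have "snd z ^ 2 * (real b * v z ^ (b - 1) * - (fst z * snd z ^ (2 * l - 1)))
       = - (real b * v z ^ (b - 1)) * fst z * snd z * (snd z * snd z ^ (2 * l - 1))"
      by (simp add: power2_eq_square)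
    also have "\<dots> = - 2 * real l * (real b * v z ^ (b - 1) * v z) * fst z * snd z"
      unfolding v_eq by simp
    also have "real b * v z ^ (b - 1) * v z = real b * v z ^ b" by (cases b) auto
    finally have h: "snd z ^ 2 * (real b * v z ^ (b - 1) * - (fst z * snd z ^ (2 * l - 1)))
      = - 2 * real l * (real b * v z ^ b) * fst z * snd z" .
    have *: "real 2 * snd z ^ (2 - 1) * - fst z * v z ^ b + snd z ^ 2 * (real b * v z ^ (b - 1) * - (fst z * snd z ^ (2 * l - 1)))
      = - (2 + 2 * real l * real b) * (fst z * snd z * v z ^ b)"
      unfolding h by (simp add: algebra_simps)
    have nz: "2 + 2 * real l * real b \<noteq> 0"
      by (metis add_pos_nonneg less_irrefl mult_nonneg_nonneg of_nat_0_le_iff zero_le_numeral zero_less_numeral)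
    have neg_cancel: "- 1 / c * (- c * X) = X" if "c \<noteq> 0" for c X :: real using that by simp
    show "- 1 / (2 + 2 * real l * real b) *
         (real 2 * snd z ^ (2 - 1) * - fst z * v z ^ b + snd z ^ 2 * (real b * v z ^ (b - 1) * - (fst z * snd z ^ (2 * l - 1))))
       = fst z * snd z * u z ^ 0 * v z ^ b"
      unfolding * neg_cancel[OF nz] by simp
  qed auto
  then show ?case by blast
next
  case (Suc a)
  obtain Z where Z: "quasihom (2 + 2 * real l * real (a + Suc b)) Z (\<lambda>z. fst z * snd z * u z ^ a * v z ^ Suc b)"
    using Suc by blast
  define c where "c = 4 + 4 * real l * real b"
  have c: "c > 0" unfolding c_def by (intro add_pos_nonneg) auto
  have "quasihom (2 + 2 * real l * real (Suc a + b))
    (\<lambda>z. (- 1 / c) * (fst z ^ Suc 1 * snd z ^ Suc 1 * u z ^ a * v z ^ b) + (4 * real l * (1 + real a) / c) * Z z)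
    (\<lambda>z. fst z * snd z * u z ^ Suc a * v z ^ b)"
  proof (rule quasihom_cong[OF quasihom_add[OF quasihom_cmult[OF quasihom_cong[OF quasihom_monomial[of 1 1 a b] refl refl]]
        quasihom_cmult[OF Z]]])
    fix z
    define A B where "A = fst z * snd z * u z ^ a * v z ^ Suc b" and "B = fst z * snd z * u z ^ Suc a * v z ^ b"
    have "fst z ^ 1 * snd z ^ 1 * (2 * real l * (real (Suc 1) + 2 * real a) * (u z ^ a * v z ^ Suc b)
        - 2 * (real (Suc 1) + 2 * real l * real b) * (u z ^ Suc a * v z ^ b))
        = 4 * real l * (1 + real a) * A - c * B"
      by (simp add: A_def B_def c_def algebra_simps)
    note h = this
    have g: "- 1 / c * (p * A - c * B) + p / c * A = B" for p using c by (simp add: field_simps)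
    show "- 1 / c * (fst z ^ 1 * snd z ^ 1 * (2 * real l * (real (Suc 1) + 2 * real a) * (u z ^ a * v z ^ Suc b)
        - 2 * (real (Suc 1) + 2 * real l * real b) * (u z ^ Suc a * v z ^ b))) +
        4 * real l * (1 + real a) / c * (fst z * snd z * u z ^ a * v z ^ Suc b) = fst z * snd z * u z ^ Suc a * v z ^ b"
      unfolding h unfolding A_def[symmetric] B_def[symmetric] by (rule g)
  qed (auto simp: algebra_simps)
  then show ?case by blast
qed

text \<open>\<open>q\<close> and \<open>c y\<^sup>2 v\<^bsup>n+1\<^esup>\<close> differ by a derivative along the Hamiltonian field, so they have the same
  average along its orbits.\<close>

definition cohom :: "nat \<Rightarrow> real \<Rightarrow> (real \<times> real \<Rightarrow> real) \<Rightarrow> bool" where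
  "cohom n c q \<longleftrightarrow> (\<exists>Z. quasihom (real l + 3 + 2 * real l * real n) Z (\<lambda>z. q z - c * (snd z ^ 2 * v z ^ Suc n)))"

lemma cohom_add:
  assumes "cohom n c q" "cohom n c' q'"
  shows "cohom n (c + c') (\<lambda>z. q z + q' z)"
proof -
  obtain Z Z' where Z: "quasihom (real l + 3 + 2 * real l * real n) Z (\<lambda>z. q z - c * (snd z ^ 2 * v z ^ Suc n))"
    "quasihom (real l + 3 + 2 * real l * real n) Z' (\<lambda>z. q' z - c' * (snd z ^ 2 * v z ^ Suc n))"
    using assms unfolding cohom_def by blast
  show ?thesis unfolding cohom_def
    by (rule exI, rule quasihom_cong[OF quasihom_add[OF Z] refl _ refl]) (simp add: algebra_simps)
qed

lemma cohom_cmult: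
  assumes "cohom n c q"
  shows "cohom n (d * c) (\<lambda>z. d * q z)"
proof -
  obtain Z where Z: "quasihom (real l + 3 + 2 * real l * real n) Z (\<lambda>z. q z - c * (snd z ^ 2 * v z ^ Suc n))"
    using assms unfolding cohom_def by blast
  show ?thesis unfolding cohom_def
    by (rule exI, rule quasihom_cong[OF quasihom_cmult[OF Z, of d] refl _ refl]) (simp add: algebra_simps)
qed

lemma cohom_sum:
  assumes "\<And>i. i \<in> S \<Longrightarrow> cohom n (c i) (q i)"
  shows "cohom n (\<Sum>i\<in>S. c i) (\<lambda>z. \<Sum>i\<in>S. q i z)"
  using assms
proof (induction S rule: infinite_finite_induct)
  case (insert i S)
  then show ?case using cohom_add[of n "c i" "q i"] by simp
qed (auto simp: cohom_def intro!: exI quasihom_zero)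

text \<open>This is the recursion of the Beta function: the derivative of
  \<open>x^3 y^3 u^a v^b\<close> shows that trading one \<open>u\<close> for one \<open>v\<close>
  costs the factor \<open>(3/2 + a) / (t + b)\<close>, and \<open>x y^3 v^b\<close> finally trades
  \<open>x^2\<close>.\<close>

lemma cohom_monomial:
  assumes "a + b = n"
  defines "t \<equiv> 3 / (2 * real l)"
  shows "cohom n (pochhammer (3/2) a * pochhammer t b / pochhammer t (Suc n))
    (\<lambda>z. fst z ^ 2 * snd z ^ 2 * u z ^ a * v z ^ b)"
  using assms(1)
proof (induction a arbitrary: b)
  case 0
  have t: "t > 0" unfolding t_def using l_pos by simp
  then have pp: "pochhammer t b > 0" "t + real b > 0" by (auto intro: pochhammer_pos add_pos_nonneg)
  have tb: "3 + 2 * real l * real b = 2 * real l * (t + real b)" unfolding t_def using l_pos by (simp add: field_simps)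
  have cc: "pochhammer (3/2) 0 * pochhammer t b / pochhammer t (Suc b) = 1 / (t + real b)"
    using pp by (simp add: pochhammer_Suc)
  have "quasihom (real l + 3 + 2 * real l * real b)
     (\<lambda>z. (- 1 / (2 * real l * (t + real b))) * (fst z ^ Suc 0 * snd z ^ Suc 2 * u z ^ 0 * v z ^ b))
     (\<lambda>z. fst z ^ 2 * snd z ^ 2 * u z ^ 0 * v z ^ b - 1 / (t + real b) * (snd z ^ 2 * v z ^ Suc b))"
  proof (rule quasihom_cong[OF quasihom_cmult[OF quasihom_monomial[of 0 2 0 b]] refl])
    fix z
    define A B where "A = fst z ^ 2 * snd z ^ 2 * v z ^ b" and "B = snd z ^ 2 * v z ^ Suc b"
    have "fst z ^ 0 * snd z ^ 2 * (2 * real l * (real (Suc 0) + 2 * real 0) * (u z ^ 0 * v z ^ Suc b) -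
        2 * (real (Suc 2) + 2 * real l * real b) * (u z ^ Suc 0 * v z ^ b)) = 2 * real l * B - (3 + 2 * real l * real b) * A"
      by (simp add: A_def B_def u_def algebra_simps)
    also have "\<dots> = 2 * real l * (B - (t + real b) * A)" unfolding tb by (simp add: algebra_simps)
    finally have h: "fst z ^ 0 * snd z ^ 2 * (2 * real l * (real (Suc 0) + 2 * real 0) * (u z ^ 0 * v z ^ Suc b) -
        2 * (real (Suc 2) + 2 * real l * real b) * (u z ^ Suc 0 * v z ^ b)) = 2 * real l * (B - (t + real b) * A)" .
    have g: "- 1 / (2 * real l * T) * (2 * real l * (B - T * A)) = A - 1 / T * B" if "T > 0" for T
      using that l_pos by (simp add: field_simps)
    show "- 1 / (2 * real l * (t + real b)) * (fst z ^ 0 * snd z ^ 2 * (2 * real l * (real (Suc 0) + 2 * real 0) * (u z ^ 0 * v z ^ Suc b) -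
        2 * (real (Suc 2) + 2 * real l * real b) * (u z ^ Suc 0 * v z ^ b)))
        = fst z ^ 2 * snd z ^ 2 * u z ^ 0 * v z ^ b - 1 / (t + real b) * (snd z ^ 2 * v z ^ Suc b)"
      unfolding h g[OF pp(2)] by (simp add: A_def B_def)
  qed (auto simp: algebra_simps)
  then show ?case unfolding cohom_def using 0 cc by auto
next
  case (Suc a)
  have t: "t > 0" unfolding t_def using l_pos by simp
  then have pp: "t + real b > 0" by auto
  have tb: "3 + 2 * real l * real b = 2 * real l * (t + real b)" unfolding t_def using l_pos by (simp add: field_simps)
  have n: "n = Suc (a + b)" using Suc.prems by simp
  have IH: "cohom n (pochhammer (3/2) a * pochhammer t (Suc b) / pochhammer t (Suc n))
    (\<lambda>z. fst z ^ 2 * snd z ^ 2 * u z ^ a * v z ^ Suc b)" using Suc.IH[of "Suc b"] Suc.prems by simp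
  define r where "r = (3/2 + real a) / (t + real b)"
  define d where "d = - 1 / (4 * real l * (t + real b))"
  have e1: "r * (pochhammer (3/2) a * pochhammer t (Suc b) / pochhammer t (Suc n))
    = pochhammer (3/2) (Suc a) * pochhammer t b / pochhammer t (Suc n)"
    using pp by (simp add: r_def pochhammer_Suc)
  have "cohom n 0 (\<lambda>z. fst z ^ 2 * snd z ^ 2 * u z ^ Suc a * v z ^ b - r * (fst z ^ 2 * snd z ^ 2 * u z ^ a * v z ^ Suc b))"
    unfolding cohom_def
  proof (rule exI, rule quasihom_cong[OF quasihom_cmult[OF quasihom_monomial[of 2 2 a b], of d] refl])
    fix z
    define A B where "A = fst z ^ 2 * snd z ^ 2 * u z ^ Suc a * v z ^ b" and "B = fst z ^ 2 * snd z ^ 2 * u z ^ a * v z ^ Suc b"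
    have "fst z ^ 2 * snd z ^ 2 * (2 * real l * (real (Suc 2) + 2 * real a) * (u z ^ a * v z ^ Suc b) -
        2 * (real (Suc 2) + 2 * real l * real b) * (u z ^ Suc a * v z ^ b)) = 4 * real l * (3/2 + real a) * B - 2 * (3 + 2 * real l * real b) * A"
      by (simp add: A_def B_def algebra_simps)
    also have "\<dots> = 4 * real l * ((3/2 + real a) * B - (t + real b) * A)" unfolding tb by (simp add: algebra_simps)
    finally have h: "fst z ^ 2 * snd z ^ 2 * (2 * real l * (real (Suc 2) + 2 * real a) * (u z ^ a * v z ^ Suc b) -
        2 * (real (Suc 2) + 2 * real l * real b) * (u z ^ Suc a * v z ^ b)) = 4 * real l * ((3/2 + real a) * B - (t + real b) * A)" .
    have g: "- 1 / (4 * real l * T) * (4 * real l * (p * B - T * A)) = A - p / T * B" if "T > 0" for T p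
      using that l_pos by (simp add: field_simps)
    show "d * (fst z ^ 2 * snd z ^ 2 * (2 * real l * (real (Suc 2) + 2 * real a) * (u z ^ a * v z ^ Suc b) -
        2 * (real (Suc 2) + 2 * real l * real b) * (u z ^ Suc a * v z ^ b))) =
        fst z ^ 2 * snd z ^ 2 * u z ^ Suc a * v z ^ b - r * (fst z ^ 2 * snd z ^ 2 * u z ^ a * v z ^ Suc b) - 0 * (snd z ^ 2 * v z ^ Suc n)"
      unfolding h d_def r_def g[OF pp] by (simp add: A_def B_def)
  qed (auto simp: n algebra_simps)
  from cohom_add[OF this cohom_cmult[OF IH, of r]]
  show ?case unfolding e1 by simp
qed

end

section \<open>The degenerate focus\<close>

lemma lipschitz_on_power:
  fixes r :: real
  assumes "0 \<le> r"
  shows "(real n * r ^ (n - 1))-lipschitz_on {-r..r} (\<lambda>x. x ^ n)"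
proof (rule lipschitz_onI)
  fix x y assume xy: "x \<in> {-r..r}" "y \<in> {-r..r}"
  have "norm (x ^ n - y ^ n) \<le> real n * r ^ (n - 1) * norm (x - y)"
  proof (rule field_differentiable_bound[of "{-r..r}" "\<lambda>x. x ^ n" "\<lambda>x. real n * x ^ (n - 1)"])
    fix z assume "z \<in> {-r..r}"
    then have "\<bar>z\<bar> ^ (n - 1) \<le> r ^ (n - 1)" by (intro power_mono) auto
    then show "norm (real n * z ^ (n - 1)) \<le> real n * r ^ (n - 1)"
      by (simp add: abs_mult power_abs mult_left_mono)
  qed (use xy in \<open>auto intro!: derivative_eq_intros\<close>)
  then show "dist (x ^ n) (y ^ n) \<le> real n * r ^ (n - 1) * dist x y" by (simp add: dist_norm)
qed (use assms in auto)

text \<open>If \<open>c * v <= u + v\<close>, the added term alone suffices. Otherwise the deficit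
  is at most \<open>\<delta> * (c * v) powr P\<close>, which the first term pays for when
  \<open>\<delta> = K / c powr P\<close>.\<close>

lemma definite_of_semidefinite:
  fixes K P c :: real
  assumes "K > 0" "P \<ge> 1" "c \<ge> 1"
  obtains \<delta> where "\<delta> > 0"
    "\<forall>u\<ge>0. \<forall>v\<ge>0. \<delta> * (u + v) powr P \<le> K * v powr P + \<delta> * (u + v) powr (P - 1) * (2 * (u + v) - c * v)"
proof -
  define \<delta> where "\<delta> = K / c powr P"
  have \<delta>: "\<delta> > 0" using assms by (simp add: \<delta>_def)
  have "\<delta> * (u + v) powr P \<le> K * v powr P + \<delta> * (u + v) powr (P - 1) * (2 * (u + v) - c * v)" if uv: "u \<ge> 0" "v \<ge> 0" for u v
  proof (cases "u + v = 0")
    case True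
    then have "u = 0" "v = 0" using uv by auto
    then show ?thesis by simp
  next
    case False
    define h where "h = u + v"
    have h: "h > 0" "v \<le> h" using False uv by (auto simp: h_def)
    have hP: "h powr P = h powr (P - 1) * h" using h by (simp add: powr_diff)
    have "\<delta> * h powr (P - 1) * (c * v - h) \<le> K * v powr P"
    proof (cases "c * v \<le> h")
      case True
      then have "\<delta> * h powr (P - 1) * (c * v - h) \<le> 0"
        using \<delta> by (intro mult_nonneg_nonpos) auto
      also have "0 \<le> K * v powr P" using assms by simp
      finally show ?thesis .
    next
      case False
      then have v: "v > 0" using assms h by (metis less_eq_real_def mult_zero_right uv(2) not_le)
      have "h powr (P - 1) * (c * v - h) \<le> (c * v) powr (P - 1) * (c * v)"
        using False h assms v by (intro mult_mono powr_mono2) auto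
      also have "\<dots> = (c * v) powr P" using assms v by (simp add: powr_diff)
      finally have "\<delta> * (h powr (P - 1) * (c * v - h)) \<le> \<delta> * (c powr P * v powr P)"
        using \<delta> assms v by (intro mult_left_mono) (auto simp: powr_mult)
      also have "\<dots> = K * v powr P" using assms by (simp add: \<delta>_def)
      finally show ?thesis by (simp add: mult.assoc)
    qed
    then show ?thesis unfolding h_def[symmetric] hP by (simp add: algebra_simps)
  qed
  then show ?thesis using that \<delta> by blast
qed

section \<open>The perturbation and its correctors\<close>

locale degenerate_focus = hamiltonian l for l +
  fixes k :: nat
  assumes l_ge: "2 \<le> l" and k_ge1: "1 \<le> k"
begin

definition e :: real where "e = 1 / (2 * real l)"

sublocale averaging e k
  using l_ge k_ge1 by unfold_locales (auto simp: e_def field_simps)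

text \<open>The value that makes \<open>G\<close> proportional to
  \<open>F v^(k+1) - E u^(k+1)\<close>, the difference left over by the telescoping sum behind
  \<open>W\<close>.\<close>

definition m :: real where "m = F / (real l ^ Suc k * E)"
definition \<kappa> :: real where "\<kappa> = real k - 1/2 + e"
text \<open>\<open>G\<close> and \<open>b\<close> are written in \<open>u\<close> and
  \<open>v\<close>, as the averages need them; \<open>G_eq\<close> and \<open>b_eq\<close> give them
  in the coordinates of the system.\<close>

definition G :: "real \<times> real \<Rightarrow> real" where
  "G z = 2 ^ Suc k / E * (F * v z ^ Suc k - E * u z ^ Suc k)"
definition b :: "real \<times> real \<Rightarrow> real" where
  "b z = 2 ^ k * e / E * (fst z * snd z * (E * u z ^ k + F * v z ^ k))"
definition W :: "real \<times> real \<Rightarrow> real" where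
  "W z = \<kappa> * (2 ^ k * e / E) * (\<Sum>j\<le>k. nn j * (fst z * snd z * u z ^ (k - j) * v z ^ j))"
definition field :: "real \<times> real \<Rightarrow> real \<times> real" where
  "field z = (snd z ^ (2 * l - 1) - fst z ^ (2 * k + 1), - fst z + m * snd z ^ (2 * (k * l) + 1))"

lemma l_e: "real l * e = 1/2" "real l > 0" "e > 0"
  using l_ge by (auto simp: e_def)

lemma \<kappa>_pos: "\<kappa> > 0"
  using k_ge1 l_e by (simp add: \<kappa>_def)

lemma G_eq: "G z = m * (snd z ^ (2 * l - 1) * snd z ^ (2 * (k * l) + 1)) - fst z ^ (2 * k + 2)"
proof -
  have "(2 * l - 1) + (2 * (k * l) + 1) = 2 * l * Suc k" using l_ge by (simp add: algebra_simps)
  then have y: "snd z ^ (2 * l - 1) * snd z ^ (2 * (k * l) + 1) = (snd z ^ (2 * l)) ^ Suc k"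
    by (simp only: power_add[symmetric] power_mult[symmetric])
  have "2 * k + 2 = 2 * Suc k" by simp
  then have x: "fst z ^ (2 * k + 2) = (fst z ^ 2) ^ Suc k" by (simp only: power_mult)
  have U: "u z ^ Suc k = (fst z ^ 2) ^ Suc k / 2 ^ Suc k" by (simp only: u_def power_divide)
  have V: "v z ^ Suc k = (snd z ^ (2 * l)) ^ Suc k / (2 ^ Suc k * real l ^ Suc k)"
    by (simp only: v_def power_divide power_mult_distrib)
  define X Y T L where "X = (fst z ^ 2) ^ Suc k" and "Y = (snd z ^ (2 * l)) ^ Suc k" and "T = (2::real) ^ Suc k" and "L = real l ^ Suc k"
  have "T > 0" "L > 0" using l_e by (auto simp: T_def L_def)
  then show ?thesis
    unfolding G_def m_def x y U V X_def[symmetric] Y_def[symmetric] T_def[symmetric] L_def[symmetric]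
    using E_pos by (simp add: field_simps)
qed

lemma b_eq: "b z = fst z * snd z * (fst z ^ (2 * k) + real l * m * snd z ^ (2 * (k * l))) / (2 * real l)"
proof -
  have y: "snd z ^ (2 * (k * l)) = (snd z ^ (2 * l)) ^ k" by (simp only: power_mult[symmetric] mult_ac)
  have x: "fst z ^ (2 * k) = (fst z ^ 2) ^ k" by (simp add: power_mult[symmetric])
  have U: "u z ^ k = (fst z ^ 2) ^ k / 2 ^ k" by (simp only: u_def power_divide)
  have V: "v z ^ k = (snd z ^ (2 * l)) ^ k / (2 ^ k * real l ^ k)"
    by (simp only: v_def power_divide power_mult_distrib)
  define X Y T L where "X = (fst z ^ 2) ^ k" and "Y = (snd z ^ (2 * l)) ^ k" and "T = (2::real) ^ k" and "L = real l ^ k"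
  define E' F' where "E' = E" and "F' = F"
  have pos: "T > 0" "L > 0" "E' > 0" using l_e E_pos by (auto simp: T_def L_def E'_def)
  show ?thesis
    unfolding b_def m_def x y U V power_Suc X_def[symmetric] Y_def[symmetric] T_def[symmetric] L_def[symmetric]
      E'_def[symmetric] F'_def[symmetric] unfolding e_def
    using pos l_e(2) by (simp add: field_simps)
qed

text \<open>The perturbation \<open>field - (y^(2l-1), -x)\<close> equals \<open>- (b/H)\<close> times the Hamiltonian field plus
  \<open>G/(2lH)\<close> times the Euler field \<open>(lx, y)\<close>.\<close>

lemma quasihom_along_field:
  assumes "quasihom w Z D" "z \<noteq> 0"
  obtains Z' where "(Z has_derivative Z') (at z)"
    "Z' (field z) = (1 - b z / H z) * D z + G z / (2 * real l * H z) * (w * Z z)"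
proof -
  obtain a c where ac: "(Z has_derivative (\<lambda>h. a * fst h + c * snd h)) (at z)"
      "D z = a * snd z ^ (2 * l - 1) - c * fst z" "real l * fst z * a + snd z * c = w * Z z"
    using assms by (rule quasihom_deriv)
  define x y q X Y where "x = fst z" and "y = snd z" and "q = y ^ (2 * l - 1)" and "X = x ^ (2 * k)" and "Y = y ^ (2 * (k * l))"
  have Hp: "H z > 0" using assms(2) by (rule H_pos)
  \<comment> \<open>This is the determinant of the fields \<open>(q, -x)\<close> and
    \<open>(l x, y)\<close>, the common denominator when the perturbation is expressed through
    them.\<close>
  have H2: "2 * real l * H z = real l * (x * x) + y * q"
  proof -
    have "y * q = snd z ^ (2 * l)" unfolding y_def q_def using l_ge by (simp add: power_Suc[symmetric] del: power_Suc)
    then show ?thesis unfolding H_def using l_e(2) by (simp add: x_def power2_eq_square field_simps)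
  qed
  have Gx: "G z = m * (q * (y * Y)) - x * x * X"
    unfolding G_eq by (simp add: x_def y_def q_def X_def Y_def power_add power2_eq_square)
  have bx: "2 * real l * b z = x * y * (X + real l * m * Y)"
    unfolding b_eq using l_e(2) by (simp add: x_def y_def X_def Y_def)
  have "2 * real l * H z * (- a * (x * X) + c * (m * (y * Y)))
     = - (2 * real l * b z) * (a * q - c * x) + G z * (real l * x * a + y * c)"
    unfolding H2 bx Gx by (simp add: algebra_simps)
  then have "- a * (x * X) + c * (m * (y * Y))
     = (- (2 * real l * b z) * (a * q - c * x) + G z * (real l * x * a + y * c)) / (2 * real l * H z)"
    using Hp l_e(2) by (simp add: field_simps)
  also have "\<dots> = - (b z / H z) * (a * q - c * x) + G z / (2 * real l * H z) * (real l * x * a + y * c)"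
  proof -
    have "2 * real l * b z / (2 * real l * H z) = b z / H z" using l_e(2) by simp
    then show ?thesis by (simp only: add_divide_distrib minus_mult_left[symmetric] minus_divide_left[symmetric] times_divide_eq_left[symmetric])
  qed
  finally have "a * fst (field z) + c * snd (field z)
     = (1 - b z / H z) * (a * q - c * x) + G z / (2 * real l * H z) * (real l * x * a + y * c)"
    by (simp add: field_def x_def y_def q_def X_def Y_def algebra_simps)
  then have "a * fst (field z) + c * snd (field z) = (1 - b z / H z) * D z + G z / (2 * real l * H z) * (w * Z z)"
    unfolding ac(2) ac(3)[symmetric] x_def y_def q_def .
  then show ?thesis by (rule that[OF ac(1)])
qed

text \<open>By \<open>nn_Suc\<close> the contributions of neighbouring monomials cancel, and only
  \<open>v^(k+1)\<close> and \<open>u^(k+1)\<close> survive.\<close>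

lemma quasihom_W: "quasihom (real l + 1 + 2 * real l * real k) W (\<lambda>z. \<kappa> * G z)"
proof -
  have each: "quasihom (real l + 1 + 2 * real l * real k) (\<lambda>z. nn j * (fst z * snd z * u z ^ (k - j) * v z ^ j))
     (\<lambda>z. 4 * real l * (nn j * (real (k - j) + 1/2) * (u z ^ (k - j) * v z ^ Suc j)
         - nn j * (real j + e) * (u z ^ Suc (k - j) * v z ^ j)))" if "j \<le> k" for j
  proof (rule quasihom_cong[OF quasihom_cmult[OF quasihom_monomial[of 0 0 "k - j" j], of "nn j"]])
    fix z
    define A B where "A = u z ^ (k - j) * v z ^ Suc j" and "B = u z ^ Suc (k - j) * v z ^ j"
    have "1 = 2 * (real l * e)" using l_e by simp
    then show "nn j * (fst z ^ 0 * snd z ^ 0 * (2 * real l * (real (Suc 0) + 2 * real (k - j)) * (u z ^ (k - j) * v z ^ Suc j)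
      - 2 * (real (Suc 0) + 2 * real l * real j) * (u z ^ Suc (k - j) * v z ^ j)))
      = 4 * real l * (nn j * (real (k - j) + 1/2) * (u z ^ (k - j) * v z ^ Suc j)
         - nn j * (real j + e) * (u z ^ Suc (k - j) * v z ^ j))"
      unfolding A_def[symmetric] B_def[symmetric] by (simp add: algebra_simps)
  qed (use that in \<open>auto simp: of_nat_diff\<close>)
  have tele: "(\<Sum>j\<le>k. nn j * (real (k - j) + 1/2) * (u z ^ (k - j) * v z ^ Suc j)
         - nn j * (real j + e) * (u z ^ Suc (k - j) * v z ^ j)) = F * v z ^ Suc k - E * u z ^ Suc k" for z
  proof -
    define f where "f = (\<lambda>j. nn j * (real j + e) * (u z ^ Suc (k - j) * v z ^ j))"
    have step: "nn j * (real (k - j) + 1/2) * (u z ^ (k - j) * v z ^ Suc j) = f (Suc j)" if "j < k" for j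
    proof -
      have "Suc (k - Suc j) = k - j" using that by simp
      then show ?thesis unfolding f_def nn_Suc[OF that] by simp
    qed
    have "(\<Sum>j\<le>k. nn j * (real (k - j) + 1/2) * (u z ^ (k - j) * v z ^ Suc j) - f j)
       = (\<Sum>j<k. f (Suc j) - f j) + (F * v z ^ Suc k - f k)"
      unfolding lessThan_Suc_atMost[symmetric] sum.lessThan_Suc using step F_eq by simp
    also have "\<dots> = F * v z ^ Suc k - f 0" by (simp add: sum_lessThan_telescope)
    also have "f 0 = E * u z ^ Suc k" by (simp add: f_def E_eq)
    finally show ?thesis by (simp add: f_def)
  qed
  have s: "quasihom (real l + 1 + 2 * real l * real k) (\<lambda>z. \<Sum>j\<le>k. nn j * (fst z * snd z * u z ^ (k - j) * v z ^ j))
     (\<lambda>z. \<Sum>j\<le>k. 4 * real l * (nn j * (real (k - j) + 1/2) * (u z ^ (k - j) * v z ^ Suc j)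
         - nn j * (real j + e) * (u z ^ Suc (k - j) * v z ^ j)))"
    by (rule quasihom_sum) (use each in auto)
  show ?thesis
  proof (rule quasihom_cong[OF quasihom_cmult[OF s, of "\<kappa> * (2 ^ k * e / E)"]])
    fix z
    have "\<kappa> * (2 ^ k * e / E) * (4 * real l * (F * v z ^ Suc k - E * u z ^ Suc k))
       = \<kappa> * (2 ^ k / E) * (4 * (real l * e) * (F * v z ^ Suc k - E * u z ^ Suc k))" by simp
    also have "\<dots> = \<kappa> * G z" unfolding G_def l_e(1) by simp
    finally show "\<kappa> * (2 ^ k * e / E) * (\<Sum>j\<le>k. 4 * real l * (nn j * (real (k - j) + 1/2) * (u z ^ (k - j) * v z ^ Suc j)
         - nn j * (real j + e) * (u z ^ Suc (k - j) * v z ^ j))) = \<kappa> * G z"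
      unfolding sum_distrib_left[symmetric] tele .
  qed (simp_all add: W_def)
qed

lemma quasihom_b: "\<exists>D. quasihom (real l + 1 + 2 * real l * real k) b D"
proof -
  have 1: "quasihom (real l + 1 + 2 * real l * real k) (\<lambda>z. fst z ^ Suc 0 * snd z ^ Suc 0 * u z ^ k * v z ^ 0)
     (\<lambda>z. fst z ^ 0 * snd z ^ 0 * (2 * real l * (real (Suc 0) + 2 * real k) * (u z ^ k * v z ^ Suc 0)
        - 2 * (real (Suc 0) + 2 * real l * real 0) * (u z ^ Suc k * v z ^ 0)))"
    using quasihom_monomial[of 0 0 k 0] by simp
  have 2: "quasihom (real l + 1 + 2 * real l * real k) (\<lambda>z. fst z ^ Suc 0 * snd z ^ Suc 0 * u z ^ 0 * v z ^ k)
     (\<lambda>z. fst z ^ 0 * snd z ^ 0 * (2 * real l * (real (Suc 0) + 2 * real 0) * (u z ^ 0 * v z ^ Suc k)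
        - 2 * (real (Suc 0) + 2 * real l * real k) * (u z ^ Suc 0 * v z ^ k)))"
    using quasihom_monomial[of 0 0 0 k] by simp
  show ?thesis
    by (rule exI, rule quasihom_cong[OF quasihom_add[OF quasihom_cmult[OF 1, of "2 ^ k * e"]
        quasihom_cmult[OF 2, of "2 ^ k * e / E * F"]] _ refl refl])
      (use E_pos in \<open>simp add: b_def field_simps\<close>)
qed

lemma ex_quasihom_G_b: "\<exists>Z. quasihom (2 + 2 * real l * real (2 * k + 1)) Z (\<lambda>z. \<kappa> * G z * b z)"
proof -
  define w where "w = 2 + 2 * real l * real (2 * k + 1)"
  have "\<exists>Z. quasihom w Z (\<lambda>z. fst z * snd z * u z ^ i * v z ^ j)" if "i + j = 2 * k + 1" for i j
    using ex_quasihom_odd[of i j] that by (simp add: w_def)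
  from this[of 0 "2 * k + 1"] this[of "2 * k + 1" 0] this[of k "k + 1"] this[of "k + 1" k]
  obtain Z1 Z2 Z3 Z4 where Z: "quasihom w Z1 (\<lambda>z. fst z * snd z * u z ^ 0 * v z ^ (2 * k + 1))"
    "quasihom w Z2 (\<lambda>z. fst z * snd z * u z ^ (2 * k + 1) * v z ^ 0)"
    "quasihom w Z3 (\<lambda>z. fst z * snd z * u z ^ k * v z ^ (k + 1))"
    "quasihom w Z4 (\<lambda>z. fst z * snd z * u z ^ (k + 1) * v z ^ k)" by auto
  define c where "c = \<kappa> * (2 ^ Suc k / E) * (2 ^ k * e / E)"
  show ?thesis unfolding w_def[symmetric]
  proof (rule exI, rule quasihom_cong[OF quasihom_cmult[OF quasihom_add[OF quasihom_add[OF quasihom_cmult[OF Z(1), of "F * F"]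
        quasihom_cmult[OF Z(2), of "- (E * E)"]] quasihom_add[OF quasihom_cmult[OF Z(3), of "E * F"]
        quasihom_cmult[OF Z(4), of "- (E * F)"]]], of c] refl _ refl])
    fix z
    have pw: "x ^ (2 * k + 1) = x * (x ^ k * x ^ k)" "x ^ (k + 1) = x * x ^ k" "x ^ Suc k = x * x ^ k" for x :: real
      by (simp_all add: mult_2 power_add)
    have "\<kappa> * G z * b z = c * (fst z * snd z * ((F * (v z * v z ^ k) - E * (u z * u z ^ k)) * (E * u z ^ k + F * v z ^ k)))"
      unfolding G_def b_def c_def pw(3) by simp
    then show "c * (F * F * (fst z * snd z * u z ^ 0 * v z ^ (2 * k + 1)) + - (E * E) * (fst z * snd z * u z ^ (2 * k + 1) * v z ^ 0) +
        (E * F * (fst z * snd z * u z ^ k * v z ^ (k + 1)) + - (E * F) * (fst z * snd z * u z ^ (k + 1) * v z ^ k))) = \<kappa> * G z * b z"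
      unfolding pw by (simp add: algebra_simps)
  qed
qed

text \<open>\<open>b * b\<close> contributes \<open>I\<^sub>A\<close> and \<open>b * W\<close>
  contributes \<open>\<kappa> * I\<^sub>B\<close>, with a common positive factor. The product
  contains \<open>W\<close> rather than \<open>Z2\<close> because the coefficients of
  \<open>W\<close> are explicit.\<close>

lemma cohom_G_b: "\<exists>c>0. cohom (3 * k + 1) c (\<lambda>z. \<kappa> * G z * b z * (b z + W z))"
proof -
  define n where "n = 3 * k + 1"
  define T where "T = pochhammer t (Suc n)"
  have T: "T > 0" unfolding T_def by (rule pt_pos)
  have mono: "cohom n (P i j / T) (\<lambda>z. fst z ^ 2 * snd z ^ 2 * u z ^ i * v z ^ j)" if "i + j = n" for i j
  proof -
    have "3 / (2 * real l) = t" unfolding t_def by (simp add: e_def)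
    then show ?thesis using cohom_monomial[OF that] unfolding P_def T_def s_def by simp
  qed
  define q where "q = (\<lambda>i j z. fst z ^ 2 * snd z ^ 2 * u z ^ i * v z ^ j :: real)"
  have mono: "cohom n (P i j / T) (q i j)" if "i + j = n" for i j
    using mono[OF that] unfolding q_def .
  have A: "cohom n (F ^ 3 * (P 0 n / T) + (- (E ^ 3)) * (P n 0 / T) + 2 * E * F\<^sup>2 * (P k (2 * k + 1) / T)
     + (- 2 * E\<^sup>2 * F) * (P (2 * k + 1) k / T) + E\<^sup>2 * F * (P (2 * k) (k + 1) / T) + (- E * F\<^sup>2) * (P (k + 1) (2 * k) / T))
    (\<lambda>z. F ^ 3 * q 0 n z + (- (E ^ 3)) * q n 0 z + 2 * E * F\<^sup>2 * q k (2 * k + 1) z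
     + (- 2 * E\<^sup>2 * F) * q (2 * k + 1) k z + E\<^sup>2 * F * q (2 * k) (k + 1) z + (- E * F\<^sup>2) * q (k + 1) (2 * k) z)"
    by (intro cohom_add cohom_cmult mono) (simp_all add: n_def)
  have B: "cohom n (\<Sum>j\<le>k. nn j * (F\<^sup>2 * (P (k - j) (2 * k + 1 + j) / T) + E * F * (P (2 * k - j) (k + j + 1) / T)
      + (- E * F) * (P (2 * k + 1 - j) (k + j) / T) + (- (E\<^sup>2)) * (P (3 * k + 1 - j) j / T)))
    (\<lambda>z. \<Sum>j\<le>k. nn j * (F\<^sup>2 * q (k - j) (2 * k + 1 + j) z + E * F * q (2 * k - j) (k + j + 1) z
      + (- E * F) * q (2 * k + 1 - j) (k + j) z + (- (E\<^sup>2)) * q (3 * k + 1 - j) j z))"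
    by (intro cohom_sum cohom_add cohom_cmult mono) (auto simp: n_def)
  have cA: "F ^ 3 * (P 0 n / T) + (- (E ^ 3)) * (P n 0 / T) + 2 * E * F\<^sup>2 * (P k (2 * k + 1) / T)
     + (- 2 * E\<^sup>2 * F) * (P (2 * k + 1) k / T) + E\<^sup>2 * F * (P (2 * k) (k + 1) / T) + (- E * F\<^sup>2) * (P (k + 1) (2 * k) / T) = I\<^sub>A / T"
    unfolding I\<^sub>A_def n_def by (simp add: add_divide_distrib diff_divide_distrib)
  have cB: "(\<Sum>j\<le>k. nn j * (F\<^sup>2 * (P (k - j) (2 * k + 1 + j) / T) + E * F * (P (2 * k - j) (k + j + 1) / T)
      + (- E * F) * (P (2 * k + 1 - j) (k + j) / T) + (- (E\<^sup>2)) * (P (3 * k + 1 - j) j / T))) = I\<^sub>B / T"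
    unfolding I\<^sub>B_def sum_divide_distrib by (intro sum.cong) (auto simp: add_divide_distrib diff_divide_distrib algebra_simps)
  define c where "c = \<kappa> * (2 ^ Suc k / E) * (2 ^ k * e / E)\<^sup>2"
  have c: "c > 0" unfolding c_def using \<kappa>_pos E_pos l_e by simp
  have "cohom n (c * (I\<^sub>A / T + \<kappa> * (I\<^sub>B / T))) (\<lambda>z. \<kappa> * G z * b z * (b z + W z))"
  proof -
    define R where "R = (\<lambda>z. c * ((F ^ 3 * q 0 n z + (- (E ^ 3)) * q n 0 z + 2 * E * F\<^sup>2 * q k (2 * k + 1) z
     + (- 2 * E\<^sup>2 * F) * q (2 * k + 1) k z + E\<^sup>2 * F * q (2 * k) (k + 1) z + (- E * F\<^sup>2) * q (k + 1) (2 * k) z)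
     + \<kappa> * (\<Sum>j\<le>k. nn j * (F\<^sup>2 * q (k - j) (2 * k + 1 + j) z + E * F * q (2 * k - j) (k + j + 1) z
      + (- E * F) * q (2 * k + 1 - j) (k + j) z + (- (E\<^sup>2)) * q (3 * k + 1 - j) j z))))"
    have "cohom n (c * (I\<^sub>A / T + \<kappa> * (I\<^sub>B / T))) R"
      unfolding R_def by (intro cohom_cmult cohom_add A[unfolded cA] B[unfolded cB])
    moreover have "R = (\<lambda>z. \<kappa> * G z * b z * (b z + W z))"
    proof
      fix z
      define U V where "U = u z ^ k" and "V = v z ^ k"
      define g where "g = (F * (v z * V) - E * (u z * U)) * (E * U + F * V)"
      define xy where "xy = fst z * snd z"
      have pw: "x ^ (k + 1) = x * x ^ k" "x ^ (2 * k) = x ^ k * x ^ k" "x ^ (2 * k + 1) = x * (x ^ k * x ^ k)"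
        "x ^ (3 * k + 1) = x * (x ^ k * x ^ k * x ^ k)" for x :: real
      proof -
        have "3 * k + 1 = Suc (k + k + k)" by simp
        then show "x ^ (3 * k + 1) = x * (x ^ k * x ^ k * x ^ k)" by (simp only: power_Suc power_add)
      qed (simp_all add: mult_2 power_add)
      have a: "F ^ 3 * q 0 n z + (- (E ^ 3)) * q n 0 z + 2 * E * F\<^sup>2 * q k (2 * k + 1) z
     + (- 2 * E\<^sup>2 * F) * q (2 * k + 1) k z + E\<^sup>2 * F * q (2 * k) (k + 1) z + (- E * F\<^sup>2) * q (k + 1) (2 * k) z
       = xy\<^sup>2 * (g * (E * U + F * V))"
        unfolding q_def n_def pw g_def xy_def U_def[symmetric] V_def[symmetric]
        by (simp add: algebra_simps power2_eq_square power3_eq_cube)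
      have bj: "nn j * (F\<^sup>2 * q (k - j) (2 * k + 1 + j) z + E * F * q (2 * k - j) (k + j + 1) z
      + (- E * F) * q (2 * k + 1 - j) (k + j) z + (- (E\<^sup>2)) * q (3 * k + 1 - j) j z)
        = xy * g * (nn j * (fst z * snd z * u z ^ (k - j) * v z ^ j))" if "j \<le> k" for j
      proof -
        have ex: "2 * k - j = k + (k - j)" "2 * k + 1 - j = Suc (k + (k - j))" "3 * k + 1 - j = Suc (k + k + (k - j))"
          "2 * k + 1 + j = Suc (k + k + j)" "k + j + 1 = Suc (k + j)" using that by auto
        show ?thesis unfolding q_def ex power_Suc power_add g_def xy_def U_def[symmetric] V_def[symmetric]
          by (simp add: algebra_simps power2_eq_square)
      qed
      have sumj: "(\<Sum>j\<le>k. nn j * (F\<^sup>2 * q (k - j) (2 * k + 1 + j) z + E * F * q (2 * k - j) (k + j + 1) z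
      + (- E * F) * q (2 * k + 1 - j) (k + j) z + (- (E\<^sup>2)) * q (3 * k + 1 - j) j z))
        = xy * g * (\<Sum>j\<le>k. nn j * (fst z * snd z * u z ^ (k - j) * v z ^ j))"
        unfolding sum_distrib_left by (intro sum.cong bj) auto
      define S where "S = (\<Sum>j\<le>k. nn j * (fst z * snd z * u z ^ (k - j) * v z ^ j))"
      have "\<kappa> * G z * b z * (b z + W z) = c * (xy\<^sup>2 * (g * (E * U + F * V)) + \<kappa> * (xy * g * S))"
      proof -
        have "\<kappa> * (\<alpha> * N) * (\<beta> * (xy * M)) * (\<beta> * (xy * M) + \<kappa> * \<beta> * S)
           = \<kappa> * \<alpha> * \<beta>\<^sup>2 * (xy\<^sup>2 * (N * M * M) + \<kappa> * (xy * (N * M) * S))" for \<alpha> \<beta> N M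
          by (simp add: algebra_simps power2_eq_square)
        then show ?thesis
          unfolding G_def b_def W_def S_def[symmetric] c_def g_def xy_def power_Suc U_def[symmetric] V_def[symmetric] .
      qed
      then show "R z = \<kappa> * G z * b z * (b z + W z)" unfolding R_def a sumj S_def by simp
    qed
    ultimately show ?thesis by simp
  qed
  moreover have "c * (I\<^sub>A / T + \<kappa> * (I\<^sub>B / T)) > 0"
    using c T I\<^sub>A_pos I\<^sub>B_pos \<kappa>_pos by (intro mult_pos_pos add_pos_pos divide_pos_pos) auto
  ultimately show ?thesis unfolding n_def by blast
qed

section \<open>The Lyapunov function and the conclusion\<close>

lemma H_continuous: "continuous_on S H"
  unfolding H_def by (intro continuous_intros) (use l_ge in auto)

lemma H_powr_tendsto: "g > 0 \<Longrightarrow> ((\<lambda>z. H z powr g) \<longlongrightarrow> 0) (at 0)"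
proof -
  assume g: "g > 0"
  have "isCont H 0" using H_continuous[of UNIV] by (simp add: continuous_on_eq_continuous_at del: split_paired_All)
  then have "(H \<longlongrightarrow> H 0) (at 0)" by (rule isContD)
  moreover have "H 0 = 0" using l_ge by (simp add: H_def)
  ultimately have "(H \<longlongrightarrow> 0) (at 0)" by simp
  then show ?thesis
    by (rule tendsto_zero_powrI[OF _ tendsto_const]) (use g H_nonneg in auto)
qed

lemma field_lipschitz:
  assumes "r > 0"
  obtains L where "L-lipschitz_on (cball 0 r) (\<lambda>z. - field z)"
proof -
  have lip_fst: "1-lipschitz_on (cball 0 r) (fst :: real \<times> real \<Rightarrow> real)"
    and lip_snd: "1-lipschitz_on (cball 0 r) (snd :: real \<times> real \<Rightarrow> real)"
    by (rule lipschitz_onI; simp add: dist_fst_le dist_snd_le)+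
  have img: "(fst :: real \<times> real \<Rightarrow> real) ` cball 0 r \<subseteq> {-r..r}"
    "(snd :: real \<times> real \<Rightarrow> real) ` cball 0 r \<subseteq> {-r..r}"
  proof -
    have in_box: "fst z \<in> {-r..r} \<and> snd z \<in> {-r..r}" if "z \<in> cball 0 r" for z :: "real \<times> real"
    proof -
      have "norm z \<le> r" using that by (simp only: mem_cball_0)
      then have "\<bar>fst z\<bar> \<le> r" "\<bar>snd z\<bar> \<le> r"
        using norm_fst_le[of "fst z" "snd z"] norm_snd_le[of "snd z" "fst z"]
        unfolding real_norm_def prod.collapse by linarith+
      then show ?thesis unfolding atLeastAtMost_iff by linarith
    qed
    show "(fst :: real \<times> real \<Rightarrow> real) ` cball 0 r \<subseteq> {-r..r}" by (rule image_subsetI) (use in_box in blast)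
    show "(snd :: real \<times> real \<Rightarrow> real) ` cball 0 r \<subseteq> {-r..r}" by (rule image_subsetI) (use in_box in blast)
  qed
  note pow = lipschitz_on_power[OF less_imp_le[OF assms]]
  have fst_pow: "(real n * r ^ (n - 1) * 1)-lipschitz_on (cball 0 r) (\<lambda>z::real\<times>real. fst z ^ n)" for n
    by (rule lipschitz_on_compose2[OF lip_fst lipschitz_on_subset[OF pow img(1)]])
  have snd_pow: "(real n * r ^ (n - 1) * 1)-lipschitz_on (cball 0 r) (\<lambda>z::real\<times>real. snd z ^ n)" for n
    by (rule lipschitz_on_compose2[OF lip_snd lipschitz_on_subset[OF pow img(2)]])
  have 1: "\<exists>L. L-lipschitz_on (cball 0 r) (\<lambda>z::real\<times>real. fst z ^ (2 * k + 1) - snd z ^ (2 * l - 1))"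
    using lipschitz_on_diff[OF fst_pow[of "2 * k + 1"] snd_pow[of "2 * l - 1"]] by (rule exI)
  have 2: "\<exists>L. L-lipschitz_on (cball 0 r) (\<lambda>z::real\<times>real. fst z ^ 1 - m * snd z ^ (2 * (k * l) + 1))"
    using lipschitz_on_diff[OF fst_pow[of 1] lipschitz_on_cmult_real[OF snd_pow[of "2 * (k * l) + 1"], of m]] by (rule exI)
  obtain L1 L2 where L: "L1-lipschitz_on (cball 0 r) (\<lambda>z::real\<times>real. fst z ^ (2 * k + 1) - snd z ^ (2 * l - 1))"
    "L2-lipschitz_on (cball 0 r) (\<lambda>z::real\<times>real. fst z ^ 1 - m * snd z ^ (2 * (k * l) + 1))"
    using 1 2 by blast
  have "(\<lambda>z. - field z) = (\<lambda>z. (fst z ^ (2 * k + 1) - snd z ^ (2 * l - 1), fst z ^ 1 - m * snd z ^ (2 * (k * l) + 1)))"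
    by (auto simp: field_def)
  with lipschitz_on_Pair[OF L] have "(sqrt (L1\<^sup>2 + L2\<^sup>2))-lipschitz_on (cball 0 r) (\<lambda>z. - field z)"
    by (simp only:)
  then show ?thesis by (rule that)
qed

text \<open>Each summand of \<open>V\<close> cancels what the preceding one leaves: up to powers of
  \<open>H\<close>, these are \<open>- \<kappa> G\<close>, then \<open>- \<kappa> G b\<close>, then
  \<open>- \<kappa> G (b^2 - Z2)\<close>. The last is turned by \<open>Z3\<close> into a negative
  definite term.\<close>

lemma ex_lyapunov_function:
  obtains \<delta> C M q :: real and V :: "real \<times> real \<Rightarrow> real"
  where "\<delta> > 0"
    "\<forall>z. z \<noteq> 0 \<longrightarrow> (\<exists>V'. (V has_derivative V') (at z) \<and> V' (field z) \<le> H z powr q * (C * H z powr \<kappa> - \<delta>))"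
    "\<forall>z. z \<noteq> 0 \<longrightarrow> H z powr (- \<kappa>) - M * (1 + H z powr \<kappa> + H z powr (2 * \<kappa>)) \<le> V z"
proof -
  define n where "n = 3 * k + 1"
  define il where "il = 1 / real l"
  have il: "il > 0" "real l * il = 1" "e = il / 2" using l_e by (auto simp: il_def e_def)
  \<comment> \<open>The weight of \<open>y^2 v^(n+1)\<close> measured in powers of \<open>H\<close>:
    the factor \<open>y^2\<close> counts \<open>1 / l\<close>.\<close>
  define P where "P = real n + 1 + il"
  obtain Z2 where Z2: "quasihom (2 + 2 * real l * real (2 * k + 1)) Z2 (\<lambda>z. \<kappa> * G z * b z)"
    using ex_quasihom_G_b by blast
  obtain \<Lambda> Z where \<Lambda>: "\<Lambda> > 0" and Z: "quasihom (real l + 3 + 2 * real l * real n) Z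
      (\<lambda>z. \<kappa> * G z * b z * (b z + W z) - \<Lambda> * (snd z ^ 2 * v z ^ Suc n))"
    using cohom_G_b unfolding cohom_def n_def by blast
  have "\<Lambda> * (2 * real l) powr il > 0" "P \<ge> 1" "2 * real l + 2 \<ge> 1"
    using \<Lambda> l_e il by (auto simp: P_def)
  then obtain \<delta> where \<delta>: "\<delta> > 0" and def: "\<forall>x\<ge>0. \<forall>y\<ge>0. \<delta> * (x + y) powr P \<le> \<Lambda> * (2 * real l) powr il * y powr P
      + \<delta> * (x + y) powr (P - 1) * (2 * (x + y) - (2 * real l + 2) * y)"
    by (rule definite_of_semidefinite)
  have w3: "real l + 1 + 2 * real l * real k + (2 + 2 * real l * real (2 * k + 1)) = real l + 3 + 2 * real l * real n"
    by (simp add: n_def algebra_simps)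
  \<comment> \<open>The integration by parts: subtracting \<open>W * Z2\<close> from
    \<open>Z\<close> changes \<open>b * (b + W)\<close> into \<open>b * b - Z2\<close>.\<close>
  have WZ2: "quasihom (real l + 3 + 2 * real l * real n) (\<lambda>z. W z * Z2 z) (\<lambda>z. \<kappa> * G z * Z2 z + W z * (\<kappa> * G z * b z))"
    using quasihom_mult[OF quasihom_W Z2] unfolding w3 .
  have xy: "quasihom (real l + 3 + 2 * real l * real n) (\<lambda>z. \<delta> * (fst z * snd z * H z powr (P - 1)))
     (\<lambda>z. \<delta> * (2 * real l * v z - 2 * u z) * H z powr (P - 1))"
  proof (rule quasihom_cong[OF quasihom_cmult[OF quasihom_mult[OF quasihom_mult[OF quasihom_fst quasihom_snd] quasihom_H_powr[of "P - 1"]], of \<delta>] refl])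
    fix z
    show "\<delta> * ((snd z ^ (2 * l - 1) * snd z + fst z * - fst z) * H z powr (P - 1) + fst z * snd z * 0)
      = \<delta> * (2 * real l * v z - 2 * u z) * H z powr (P - 1)"
      using v_eq[of z] by (simp add: u_def power2_eq_square mult.commute)
    have "2 * real l * (P - 1) = 2 * real l * real n + 2 * (real l * il)" by (simp add: P_def algebra_simps)
    then show "real l + 1 + 2 * real l * (P - 1) = real l + 3 + 2 * real l * real n" using il by simp
  qed
  \<comment> \<open>The last summand makes the leading part definite: \<open>y\<^sup>2 v\<^bsup>n+1\<^esup>\<close> alone vanishes on the \<open>x\<close>-axis.\<close>
  define Z3 where "Z3 = (\<lambda>z. (Z z + - 1 * (W z * Z2 z)) + \<delta> * (fst z * snd z * H z powr (P - 1)))"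
  define D3 where "D3 = (\<lambda>z. (\<kappa> * G z * b z * (b z + W z) - \<Lambda> * (snd z ^ 2 * v z ^ Suc n)
     + - 1 * (\<kappa> * G z * Z2 z + W z * (\<kappa> * G z * b z))) + \<delta> * (2 * real l * v z - 2 * u z) * H z powr (P - 1))"
  have Z3: "quasihom (real l + 3 + 2 * real l * real n) Z3 D3"
    unfolding Z3_def D3_def by (intro quasihom_add quasihom_cmult Z WZ2 xy)
  \<comment> \<open>By this identity the four summands of \<open>V\<close> have weights
    \<open>-1\<close>, \<open>0\<close>, \<open>1\<close>, \<open>2\<close> times
    \<open>2 * l * \<kappa>\<close>, so each is smaller than the previous one by a factor of order
    \<open>H powr \<kappa>\<close>.\<close>
  have l\<kappa>: "2 * real l * \<kappa> = 2 * real l * real k - real l + 1"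
    using l_e by (simp add: \<kappa>_def algebra_simps)
  define p where "p = - \<kappa> - 3"
  have T0: "quasihom (- (2 * real l * \<kappa>)) (\<lambda>z. H z powr (- \<kappa>)) (\<lambda>z. 0)"
    using quasihom_H_powr[of "- \<kappa>"] by simp
  have T1: "quasihom 0 (\<lambda>z. W z * H z powr (p + 2)) (\<lambda>z. \<kappa> * G z * H z powr (p + 2))"
    by (rule quasihom_cong[OF quasihom_mult[OF quasihom_W quasihom_H_powr[of "p + 2"]]])
       (use l\<kappa> in \<open>simp_all add: p_def algebra_simps\<close>)
  have T2: "quasihom (2 * real l * \<kappa>) (\<lambda>z. Z2 z * H z powr (p + 1)) (\<lambda>z. \<kappa> * G z * b z * H z powr (p + 1))"
    by (rule quasihom_cong[OF quasihom_mult[OF Z2 quasihom_H_powr[of "p + 1"]]])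
       (use l\<kappa> in \<open>simp_all add: p_def algebra_simps\<close>)
  have T3: "quasihom (2 * (2 * real l * \<kappa>)) (\<lambda>z. Z3 z * H z powr p) (\<lambda>z. D3 z * H z powr p)"
    by (rule quasihom_cong[OF quasihom_mult[OF Z3 quasihom_H_powr[of p]]])
       (use l\<kappa> in \<open>simp_all add: p_def n_def algebra_simps\<close>)
  define V where "V = (\<lambda>z. H z powr (- \<kappa>) + W z * H z powr (p + 2) + Z2 z * H z powr (p + 1) + Z3 z * H z powr p)"
  obtain C1 where C1: "0 \<le> C1" "\<forall>z. z \<noteq> 0 \<longrightarrow> \<bar>W z * H z powr (p + 2)\<bar> \<le> C1 * H z powr (0 / (2 * real l))"
    using T1 by (rule quasihom_bound)
  obtain C2 where C2: "0 \<le> C2" "\<forall>z. z \<noteq> 0 \<longrightarrow> \<bar>Z2 z * H z powr (p + 1)\<bar> \<le> C2 * H z powr (2 * real l * \<kappa> / (2 * real l))"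
    using T2 by (rule quasihom_bound)
  obtain C3 where C3: "0 \<le> C3" "\<forall>z. z \<noteq> 0 \<longrightarrow> \<bar>Z3 z * H z powr p\<bar> \<le> C3 * H z powr (2 * (2 * real l * \<kappa>) / (2 * real l))"
    using T3 by (rule quasihom_bound)
  define M where "M = C1 + C2 + C3"
  have lower: "H z powr (- \<kappa>) - M * (1 + H z powr \<kappa> + H z powr (2 * \<kappa>)) \<le> V z" if z: "z \<noteq> 0" for z
  proof -
    have h: "H z > 0" using z by (rule H_pos)
    have "\<bar>W z * H z powr (p + 2)\<bar> \<le> C1 * 1" using C1(2)[rule_format, OF z] h by simp
    moreover have "\<bar>Z2 z * H z powr (p + 1)\<bar> \<le> C2 * H z powr \<kappa>" using C2(2)[rule_format, OF z] l_e(2) by simp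
    moreover have "\<bar>Z3 z * H z powr p\<bar> \<le> C3 * H z powr (2 * \<kappa>)"
    proof -
      have "2 * (2 * real l * \<kappa>) / (2 * real l) = 2 * \<kappa>" using l_e(2) by (simp add: field_simps)
      then show ?thesis using C3(2)[rule_format, OF z] by simp
    qed
    moreover have "C1 * 1 \<le> M * 1" "C2 * H z powr \<kappa> \<le> M * H z powr \<kappa>" "C3 * H z powr (2 * \<kappa>) \<le> M * H z powr (2 * \<kappa>)"
      using C1(1) C2(1) C3(1) by (auto simp: M_def intro!: mult_right_mono)
    ultimately show ?thesis unfolding V_def by (simp add: algebra_simps abs_le_iff)
  qed
  obtain Db where Db: "quasihom (real l + 1 + 2 * real l * real k) b Db" using quasihom_b by blast
  obtain Cb where Cb: "0 \<le> Cb" "\<forall>z. z \<noteq> 0 \<longrightarrow> \<bar>b z\<bar> \<le> Cb * H z powr ((real l + 1 + 2 * real l * real k) / (2 * real l))"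
    using Db by (rule quasihom_bound)
  obtain CG where CG: "0 \<le> CG" "\<forall>z. z \<noteq> 0 \<longrightarrow> \<bar>\<kappa> * G z\<bar> \<le> CG * H z powr ((real l + 1 + 2 * real l * real k + real l - 1) / (2 * real l))"
    using quasihom_W by (rule quasihom_bound)
  obtain CZ where CZ: "0 \<le> CZ" "\<forall>z. z \<noteq> 0 \<longrightarrow> \<bar>Z3 z\<bar> \<le> CZ * H z powr ((real l + 3 + 2 * real l * real n) / (2 * real l))"
    "\<forall>z. z \<noteq> 0 \<longrightarrow> \<bar>D3 z\<bar> \<le> CZ * H z powr ((real l + 3 + 2 * real l * real n + real l - 1) / (2 * real l))"
    using Z3 by (rule quasihom_bound)
  define C where "C = 2 * CG * CZ + Cb * CZ"
  have deriv: "\<exists>V'. (V has_derivative V') (at z) \<and> V' (field z) \<le> H z powr (p + P) * (C * H z powr \<kappa> - \<delta>)"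
    if z: "z \<noteq> 0" for z
  proof -
    define h where "h = H z"
    have h: "h > 0" unfolding h_def using z by (rule H_pos)
    obtain V0 where V0: "((\<lambda>z. H z powr (- \<kappa>)) has_derivative V0) (at z)"
      "V0 (field z) = (1 - b z / H z) * 0 + G z / (2 * real l * H z) * (- (2 * real l * \<kappa>) * H z powr (- \<kappa>))"
      using T0 z by (rule quasihom_along_field)
    obtain V1 where V1: "((\<lambda>z. W z * H z powr (p + 2)) has_derivative V1) (at z)"
      "V1 (field z) = (1 - b z / H z) * (\<kappa> * G z * H z powr (p + 2)) + G z / (2 * real l * H z) * (0 * (W z * H z powr (p + 2)))"
      using T1 z by (rule quasihom_along_field)
    obtain V2 where V2: "((\<lambda>z. Z2 z * H z powr (p + 1)) has_derivative V2) (at z)"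
      "V2 (field z) = (1 - b z / H z) * (\<kappa> * G z * b z * H z powr (p + 1)) + G z / (2 * real l * H z) * (2 * real l * \<kappa> * (Z2 z * H z powr (p + 1)))"
      using T2 z by (rule quasihom_along_field)
    obtain V3 where V3: "((\<lambda>z. Z3 z * H z powr p) has_derivative V3) (at z)"
      "V3 (field z) = (1 - b z / H z) * (D3 z * H z powr p) + G z / (2 * real l * H z) * (2 * (2 * real l * \<kappa>) * (Z3 z * H z powr p))"
      using T3 z by (rule quasihom_along_field)
    have der: "(V has_derivative (\<lambda>x. V0 x + V1 x + V2 x + V3 x)) (at z)"
      unfolding V_def by (intro has_derivative_add V0(1) V1(1) V2(1) V3(1))
    define a where "a = h powr p"
    have pw: "H z powr (p + 1) = a * h" "H z powr (p + 2) = a * h\<^sup>2" "H z powr (- \<kappa>) = a * h ^ 3" "H z powr p = a"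
    proof -
      show "H z powr (p + 1) = a * h" "H z powr (p + 2) = a * h\<^sup>2" "H z powr p = a"
        using h by (simp_all add: a_def h_def[symmetric] powr_add)
      have "- \<kappa> = p + 3" by (simp add: p_def)
      then show "H z powr (- \<kappa>) = a * h ^ 3"
        using h by (simp add: a_def h_def[symmetric] powr_add)
    qed
    define main where "main = \<Lambda> * (snd z ^ 2 * v z ^ Suc n) + \<delta> * h powr (P - 1) * (2 * u z - 2 * real l * v z)"
    define rest where "rest = 2 * (\<kappa> * G z) * Z3 z - b z * D3 z"
    have D3_eq: "D3 z = \<kappa> * G z * (b z * b z) - \<kappa> * G z * Z2 z - main"
      unfolding D3_def main_def h_def by (simp add: algebra_simps)
    have total: "V0 (field z) + V1 (field z) + V2 (field z) + V3 (field z) = a * (rest / h - main)"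
    proof -
      \<comment> \<open>The letters stand for \<open>b\<close>, \<open>G\<close>, \<open>l\<close>,
        \<open>\<kappa>\<close>, \<open>D3\<close>, \<open>W h^2\<close>-terms, \<open>Z3\<close>
        and \<open>Z2\<close>, so that the identity is pure algebra: everything of order
        \<open>h^2\<close> and \<open>h\<close> cancels.\<close>
      have "(1 - B / h) * 0 + g / (2 * L * h) * (- (2 * L * K) * (a * h ^ 3))
          + ((1 - B / h) * (K * g * (a * h\<^sup>2)) + g / (2 * L * h) * (0 * w))
          + ((1 - B / h) * (K * g * B * (a * h)) + g / (2 * L * h) * (2 * L * K * (y * (a * h))))
          + ((1 - B / h) * (d * a) + g / (2 * L * h) * (2 * (2 * L * K) * (x * a)))
          = a * ((2 * (K * g) * x - B * d) / h + (d - (K * g * (B * B) - K * g * y)))" if "L > 0" for B g L K d w x y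
      proof -
        have c: "g / (2 * L * h) * (- (2 * L * K) * (a * h ^ 3)) = - (K * g * a * h\<^sup>2)"
          "g / (2 * L * h) * (2 * L * K * (y * (a * h))) = K * g * a * y"
          "g / (2 * L * h) * (2 * (2 * L * K) * (x * a)) = 2 * K * g * a * x / h"
          "(1 - B / h) * (K * g * (a * h\<^sup>2)) = K * g * a * h\<^sup>2 - K * g * a * B * h"
          "(1 - B / h) * (K * g * B * (a * h)) = K * g * a * B * h - K * g * a * (B * B)"
          "(1 - B / h) * (d * a) = d * a - B * d * a / h"
          using h that by (simp_all add: field_simps power2_eq_square power3_eq_cube)
        show ?thesis unfolding c by (simp add: algebra_simps diff_divide_distrib)
      qed
      note this[of "real l" "b z" "G z" \<kappa> "W z * (a * h\<^sup>2)" "Z2 z" "D3 z" "Z3 z", OF l_e(2)]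
      moreover have "D3 z - (\<kappa> * G z * (b z * b z) - \<kappa> * G z * Z2 z) = - main" using D3_eq by simp
      ultimately show ?thesis
        unfolding V0(2) V1(2) V2(2) V3(2) pw rest_def unfolding h_def[symmetric]
        by (simp only: diff_conv_add_uminus)
    qed
    have main_ge: "\<delta> * h powr P \<le> main"
    proof -
      have uv: "u z \<ge> 0" "v z \<ge> 0" "h = u z + v z"
        by (auto simp: h_def H_eq u_def v_def intro!: divide_nonneg_nonneg zero_le_even_power)
      have y2: "snd z ^ 2 * v z ^ Suc n = (2 * real l) powr il * v z powr P"
      proof (cases "snd z = 0")
        case True
        then have "v z = 0" using l_ge by (simp add: v_def)
        then show ?thesis using True by simp
      next
        case False
        then have vp: "v z > 0" using l_ge by (simp add: v_def zero_less_power_eq)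
        have "(2 * real l * v z) powr il = (snd z ^ (2 * l)) powr il" using l_e(2) by (simp add: v_def)
        also have "snd z ^ (2 * l) = \<bar>snd z\<bar> powr (2 * real l)"
        proof -
          have "snd z ^ (2 * l) = \<bar>snd z\<bar> ^ (2 * l)" by (rule power_even_abs[symmetric]) simp
          then show ?thesis using False by (simp add: powr_realpow[symmetric])
        qed
        also have "(\<bar>snd z\<bar> powr (2 * real l)) powr il = \<bar>snd z\<bar> powr (2 * (real l * il))" by (simp add: powr_powr mult.assoc)
        also have "\<dots> = snd z ^ 2" unfolding il(2) using False by simp
        finally have "snd z ^ 2 = (2 * real l * v z) powr il" by simp
        also have "\<dots> = (2 * real l) powr il * v z powr il" using vp by (simp add: powr_mult)
        finally have "snd z ^ 2 * v z ^ Suc n = (2 * real l) powr il * (v z powr il * v z powr real (Suc n))"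
          using vp by (simp add: powr_realpow del: of_nat_Suc)
        also have "v z powr il * v z powr real (Suc n) = v z powr P"
          by (simp add: powr_add[symmetric] P_def add_ac)
        finally show ?thesis .
      qed
      have eq: "2 * (u z + v z) - (2 * real l + 2) * v z = 2 * u z - 2 * real l * v z" by (simp add: algebra_simps)
      show ?thesis using def[rule_format, OF uv(1,2)]
        unfolding main_def y2 eq unfolding uv(3)[symmetric] by (simp only: mult.assoc)
    qed
    \<comment> \<open>The exponents of \<open>G\<close> and \<open>Z3\<close>, and those of
      \<open>b\<close> and \<open>D3\<close>, add up to \<open>P + \<kappa> + 1\<close>; after
      division by \<open>h\<close> the remainder is thus smaller than \<open>main\<close> by
      \<open>h powr \<kappa>\<close>.\<close>
    have rest_le: "rest / h \<le> C * h powr (P + \<kappa>)"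
    proof -
      have ex1: "(real l + 1 + 2 * real l * real k + real l - 1) / (2 * real l) + (real l + 3 + 2 * real l * real n) / (2 * real l) = P + \<kappa> + 1"
        using l_e(2) unfolding P_def \<kappa>_def e_def il_def by (simp add: field_simps)
      have ex2: "(real l + 1 + 2 * real l * real k) / (2 * real l) + (real l + 3 + 2 * real l * real n + real l - 1) / (2 * real l) = P + \<kappa> + 1"
        using l_e(2) unfolding P_def \<kappa>_def e_def il_def by (simp add: field_simps)
      have prod: "\<bar>X * Y\<bar> \<le> A * B * h powr (P + \<kappa> + 1)"
        if "\<bar>X\<bar> \<le> A * h powr i" "\<bar>Y\<bar> \<le> B * h powr j" "i + j = P + \<kappa> + 1" "0 \<le> A" for X Y A B i j
      proof -
        have "\<bar>X\<bar> * \<bar>Y\<bar> \<le> (A * h powr i) * (B * h powr j)" using that by (intro mult_mono) auto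
        then show ?thesis unfolding that(3)[symmetric] by (simp add: abs_mult powr_add mult_ac)
      qed
      have r1: "\<bar>\<kappa> * G z * Z3 z\<bar> \<le> CG * CZ * h powr (P + \<kappa> + 1)"
        by (rule prod[OF CG(2)[rule_format, OF z, folded h_def] CZ(2)[rule_format, OF z, folded h_def] ex1 CG(1)])
      have r2: "\<bar>b z * D3 z\<bar> \<le> Cb * CZ * h powr (P + \<kappa> + 1)"
        by (rule prod[OF Cb(2)[rule_format, OF z, folded h_def] CZ(3)[rule_format, OF z, folded h_def] ex2 Cb(1)])
      have "rest \<le> C * h powr (P + \<kappa> + 1)"
        unfolding rest_def C_def using r1 r2 by (simp add: algebra_simps abs_le_iff)
      then show ?thesis using h by (simp add: powr_add pos_divide_le_eq mult_ac)
    qed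
    have "a * (rest / h - main) \<le> a * (C * h powr (P + \<kappa>) - \<delta> * h powr P)"
      using main_ge rest_le by (intro mult_left_mono) (auto simp: a_def)
    also have "\<dots> = H z powr (p + P) * (C * H z powr \<kappa> - \<delta>)"
      unfolding a_def h_def by (simp add: powr_add algebra_simps)
    finally show ?thesis using der unfolding total[symmetric] by blast
  qed
  show ?thesis using that[OF \<delta>] \<delta> deriv lower by blast
qed

theorem repeller_field: "repeller field 0"
proof -
  obtain \<delta> C M q :: real and V :: "real \<times> real \<Rightarrow> real" where \<delta>: "\<delta> > 0"
    and Vd: "\<forall>z. z \<noteq> 0 \<longrightarrow> (\<exists>V'. (V has_derivative V') (at z) \<and> V' (field z) \<le> H z powr q * (C * H z powr \<kappa> - \<delta>))"
    and Vl: "\<forall>z. z \<noteq> 0 \<longrightarrow> H z powr (- \<kappa>) - M * (1 + H z powr \<kappa> + H z powr (2 * \<kappa>)) \<le> V z"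
    by (rule ex_lyapunov_function)
  have "((\<lambda>z. C * H z powr \<kappa>) \<longlongrightarrow> C * 0) (at 0)"
    by (intro tendsto_intros H_powr_tendsto \<kappa>_pos)
  then have "eventually (\<lambda>z. C * H z powr \<kappa> < \<delta> / 2) (at 0)"
    using \<delta> by (intro order_tendstoD(2)) auto
  then obtain d where d: "d > 0" "\<And>z. z \<noteq> 0 \<Longrightarrow> dist z 0 < d \<Longrightarrow> C * H z powr \<kappa> < \<delta> / 2"
    unfolding eventually_at by auto
  define r where "r = d / 2"
  have r: "r > 0" using d by (simp add: r_def)
  obtain L where L: "L-lipschitz_on (cball 0 r) (\<lambda>z. - field z)" using field_lipschitz[OF r] .
  \<comment> \<open>The derivative is known only pointwise, whereas the locale asks for one function
    of \<open>z\<close>; uniqueness of the derivative identifies the two.\<close>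
  define V' where "V' = (\<lambda>z. frechet_derivative V (at z))"
  have V': "(V has_derivative V' z) (at z)" "V' z (field z) \<le> H z powr q * (C * H z powr \<kappa> - \<delta>)" if z: "z \<noteq> 0" for z
  proof -
    obtain X where X: "(V has_derivative X) (at z)" "X (field z) \<le> H z powr q * (C * H z powr \<kappa> - \<delta>)"
      using Vd z by blast
    then have "X = V' z" unfolding V'_def by (intro frechet_derivative_at)
    then show "(V has_derivative V' z) (at z)" "V' z (field z) \<le> H z powr q * (C * H z powr \<kappa> - \<delta>)" using X by auto
  qed
  have "lyapunov (\<lambda>z. - field z) 0 r L V V' (\<lambda>z. \<delta> / 2 * H z powr q)"
  proof
    show "- field 0 = 0" using l_ge by (simp add: field_def zero_prod_def)
    show "r > 0" by (rule r)
    show "L-lipschitz_on (cball 0 r) (\<lambda>z. - field z)" by (rule L)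
  next
    fix z :: "real \<times> real" assume "z \<in> cball 0 r - {0}"
    then have z: "z \<noteq> 0" and zr: "dist z 0 < d" using r by (auto simp: r_def)
    show "(V has_derivative V' z) (at z)" using V' z by blast
    show "0 < \<delta> / 2 * H z powr q" using \<delta> H_pos[OF z] by simp
    have "V' z (- field z) = - V' z (field z)"
      using V'(1)[OF z] by (intro linear_neg has_derivative_linear)
    moreover have "H z powr q * (C * H z powr \<kappa> - \<delta>) \<le> H z powr q * (- (\<delta> / 2))"
      using d(2)[OF z zr] by (intro mult_left_mono) auto
    moreover have "H z powr q * (- (\<delta> / 2)) = - (\<delta> / 2 * H z powr q)" by simp
    ultimately show "\<delta> / 2 * H z powr q \<le> V' z (- field z)"
      using V'(2)[OF z] by linarith
  next
    show "continuous_on (cball 0 r - {0}) (\<lambda>z. \<delta> / 2 * H z powr q)"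
      by (intro continuous_intros H_continuous) (use H_pos in force)
  next
    have pos: "eventually (\<lambda>z. 0 < H z) (at 0)"
      unfolding eventually_at using H_pos by (auto intro!: exI[of _ 1])
    have "filterlim (\<lambda>z. inverse (H z powr \<kappa>)) at_top (at 0)"
      by (intro filterlim_inverse_at_top H_powr_tendsto \<kappa>_pos eventually_mono[OF pos]) auto
    then have 1: "filterlim (\<lambda>z. H z powr (- \<kappa>)) at_top (at 0)" by (simp add: powr_minus)
    have "((\<lambda>z. - (M * (1 + H z powr \<kappa> + H z powr (2 * \<kappa>)))) \<longlongrightarrow> - (M * (1 + 0 + 0))) (at 0)"
      using \<kappa>_pos by (intro tendsto_intros H_powr_tendsto) auto
    then have "filterlim (\<lambda>z. - (M * (1 + H z powr \<kappa> + H z powr (2 * \<kappa>))) + H z powr (- \<kappa>)) at_top (at 0)"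
      using 1 by (rule filterlim_tendsto_add_at_top)
    then show "filterlim V at_top (at 0)"
    proof (rule filterlim_at_top_mono)
      show "eventually (\<lambda>z. - (M * (1 + H z powr \<kappa> + H z powr (2 * \<kappa>))) + H z powr (- \<kappa>) \<le> V z) (at 0)"
        unfolding eventually_at using Vl by (intro exI[of _ 1]) auto
    qed
  qed
  then interpret lyapunov "\<lambda>z. - field z" 0 r L V V' "\<lambda>z. \<delta> / 2 * H z powr q" .
  show ?thesis unfolding repeller_def by (rule asymptotically_stable)
qed

text \<open>A product of terms \<open>n * j + 1\<close> is a Pochhammer symbol at
  \<open>1 / n\<close> scaled by \<open>n^(k+1)\<close>; in the quotient for \<open>n = 2\<close>
  and \<open>n = 2 * l\<close> the powers of two cancel.\<close>

lemma m_eq: "m = multifact 2 (real (2 * k + 1)) / multifact (2 * l) (real (2 * k * l + 1))"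
proof -
  have poch: "(\<Prod>j=0..k. real (n * j + 1)) = real n ^ Suc k * pochhammer (1 / real n) (Suc k)" if "n > 0" for n
  proof -
    have "(\<Prod>j=0..k. real (n * j + 1)) = (\<Prod>j=0..k. real n * (1 / real n + real j))"
      using that by (intro prod.cong) (auto simp: field_simps)
    then show ?thesis by (simp add: prod.distrib pochhammer_prod atLeast0AtMost lessThan_Suc_atMost atLeast0LessThan)
  qed
  have 1: "multifact 2 (real (2 * k + 1)) = 2 ^ Suc k * F"
    using multifact_mult_add_1[of 2 k] poch[of 2] by (simp add: F_def)
  have kl: "real (2 * k * l + 1) = real (2 * l * k + 1)" by simp
  have 2: "multifact (2 * l) (real (2 * k * l + 1)) = (2 * real l) ^ Suc k * E"
  proof -
    have "E = pochhammer (1 / real (2 * l)) (Suc k)" unfolding E_def by (simp add: e_def)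
    then show ?thesis using multifact_mult_add_1[of "2 * l" k] poch[of "2 * l"] l_ge
      unfolding kl by simp
  qed
  define F' E' T L where "F' = F" and "E' = E" and "T = (2::real) ^ Suc k" and "L = real l ^ Suc k"
  have "T > 0" by (simp add: T_def)
  then show ?thesis unfolding 1 2 m_def power_mult_distrib F'_def[symmetric] E'_def[symmetric] T_def[symmetric] L_def[symmetric] by simp
qed

end

theorem theorem1p3:
  fixes l k s :: nat and m :: real
  assumes "l \<ge> 2" and "k \<ge> 1"
    and "s = k * l"
    and "m = multifact 2 (real (2 * k + 1)) / multifact (2 * l) (real (2 * k * l + 1))"
  shows "repeller (\<lambda>(x, y). (y ^ (2 * l - 1) - x ^ (2 * k + 1), - x + m * y ^ (2 * s + 1)))
           ((0, 0) :: real \<times> real)"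
proof -
  interpret D: degenerate_focus l k
    using assms by unfold_locales auto
  have "(\<lambda>(x, y). (y ^ (2 * l - 1) - x ^ (2 * k + 1), - x + m * y ^ (2 * s + 1))) = D.field"
    unfolding D.field_def D.m_eq assms(3,4) by (auto simp: fun_eq_iff)
  then show ?thesis using D.repeller_field by (simp add: zero_prod_def)
qed

end
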